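(* Let $F$ be a separable reflexive Banach space. Let $H:[0,T]\times\Omega\to\mathscr{K}_{cmpt}(F)$ be a set-valued function and assume that the set $\Delta_{0,T}$ of elements of $L^2_{\mathbb{F}}(\Omega;\gamma(0,T;F))$ that can be defined by a measurable process $h$ with $h(t,\omega)\in H(t,\omega)$ for a.e. $(t,\omega)\in[0,T]\times\Omega$ is non-empty. Then: (a) If $F$ has cotype $2$, then each element of $\Delta_{0,T}$ can be defined by an element of $S^2_{\Sigma_{\mathbb{F}}}(H)$. (b) If $F$ is a Hilbert space, then each element $g\in S^2_{\Sigma_{\mathbb{F}}}(H)$ defines an element $U_g\in\Delta_{0,T}$, and $\|g\|_{L^2([0,T]\times\Omega;F)}=\|U_g\|_{L^2_{\mathbb{F}}(\Omega;\gamma(0,T;F))}$.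
   Context: $T>0$; $(\Omega,\mathscr{F},\mathbb{P})$ is a probability space carrying a real standard Brownian motion $W=(W_t)_{t\in[0,T]}$; $\mathbb{F}=(\mathscr{F}_t)_{t\in[0,T]}$ is the augmented natural filtration of $W$, and $\mathscr{F}=\mathscr{F}_T$. All vector spaces are real. $\mathscr{K}_{cmpt}(F)$ is the family of non-empty compact subsets of $F$. $\Sigma_{\mathbb{F}}$ is the $\sigma$-algebra of all measurable and adapted subsets of $[0,T]\times\Omega$, i.e. sets $B\in\mathscr{B}([0,T])\otimes\mathscr{F}$ with $\mathbf{1}_B(u,\cdot)$ $\mathscr{F}_u$-measurable for every $u$. The subtrajectory integrals of $H$ are $$S^2_{\Sigma_{\mathbb{F}}}(H)=\{h\in L^2([0,T]\times\Omega,\Sigma_{\mathbb{F}};F):\ h(u,\omega)\in H(u,\omega)\ \text{a.e. }(u,\omega)\in[0,T]\times\Omega\}.$$ $\gamma(0,T;F)$ is the space of $\gamma$-radonifying operators $L^2([0,T])\to F$, i.e. the closure of the finite rank operators for the norm $\|R\|=(\sup\mathbb{E}'\|\sum_{j}\gamma'_jRh_j\|^2)^{1/2}$, the supremum being over finite orthonormal systems $(h_j)$ in $L^2([0,T])$ and $(\gamma'_j)$ being independent standard Gaussians. A strongly measurable process $\phi:[0,T]\times\Omega\to F$ defines a random variable $X:\Omega\to\gamma(0,T;F)$ if for all $x^*\in F^*$, $\langle\phi(\cdot,\omega),x^*\rangle\in L^2([0,T])$ a.s., and for all $h\in L^2([0,T])$, $x^*\in F^*$, $\langle X(\omega)h,x^*\rangle=\int_{[0,T]}h(u)\langle\phi(u,\omega),x^*\rangle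 du$ a.s. $L^2_{\mathbb{F}}(\Omega;\gamma(0,T;F))$ is the closure in $L^2(\Omega;\gamma(0,T;F))$ of the $\mathbb{F}$-adapted step processes $\mathbf{1}_{\{0\}\times A}\tilde e+\sum_{i=1}^n\sum_{j=1}^m\mathbf{1}_{(t_{i-1},t_i]\times D_{ji}}e_{ji}$ with $0\le t_0<\dots<t_n\le T$, $A\in\mathscr{F}_0$, $D_{1i},\dots,D_{mi}\in\mathscr{F}_{t_{i-1}}$ disjoint, $\tilde e,e_{ji}\in F$. *)

theory Defs
  imports "HOL-Probability.Probability"
begin

subsection \<open>Geometry of Banach spaces\<close>

definition reflexive_space :: "'b::real_normed_vector itself \<Rightarrow> bool" where
  "reflexive_space _ \<longleftrightarrow>
     (\<forall>\<Phi> :: ('b \<Rightarrow>\<^sub>L real) \<Rightarrow>\<^sub>L real. \<exists>x :: 'b. \<forall>f. blinfun_apply \<Phi> f = blinfun_apply f x)"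

text \<open>The norm comes from an inner product. A class constraint \<open>real_inner\<close> is not possible here,
  since being a Hilbert space is only a hypothesis on a given Banach space.\<close>

definition hilbert_space :: "'b::banach itself \<Rightarrow> bool" where
  "hilbert_space _ \<longleftrightarrow>
     (\<exists>ip :: 'b \<Rightarrow> 'b \<Rightarrow> real. bilinear ip \<and> (\<forall>x y. ip x y = ip y x) \<and>
        (\<forall>x. norm x = sqrt (ip x x)))"

text \<open>Under the product measure below the coordinates \<open>r i\<close> are independent Rademacher variables.\<close>

definition cotype_2 :: "'b::real_normed_vector itself \<Rightarrow> bool" where
  "cotype_2 _ \<longleftrightarrow>
     (\<exists>C\<ge>0. \<forall>(n::nat) (x :: nat \<Rightarrow> 'b).
        sqrt (\<Sum>i<n. (norm (x i))\<^sup>2) \<le>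
        C * sqrt (measure_pmf.expectation (Pi_pmf {..<n} 0 (\<lambda>_. pmf_of_set {-1, 1 :: real}))
                    (\<lambda>r. (norm (\<Sum>i<n. r i *\<^sub>R x i))\<^sup>2)))"


subsection \<open>Brownian motion and its augmented filtration\<close>

definition brownian_motion :: "'a measure \<Rightarrow> real \<Rightarrow> (real \<Rightarrow> 'a \<Rightarrow> real) \<Rightarrow> bool" where
  "brownian_motion M T W \<longleftrightarrow>
     prob_space M \<and>
     (\<forall>t\<in>{0..T}. W t \<in> borel_measurable M) \<and>
     (AE \<omega> in M. W 0 \<omega> = 0) \<and>
     (\<forall>s t. 0 \<le> s \<and> s < t \<and> t \<le> T \<longrightarrow>
        distributed M lborel (\<lambda>\<omega>. W t \<omega> - W s \<omega>) (normal_density 0 (sqrt (t - s)))) \<and>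
     (\<forall>(n::nat) (t :: nat \<Rightarrow> real). 0 \<le> t 0 \<and> (\<forall>i<n. t i < t (Suc i)) \<and> t n \<le> T \<longrightarrow>
        prob_space.indep_vars M (\<lambda>_. borel) (\<lambda>i \<omega>. W (t (Suc i)) \<omega> - W (t i) \<omega>) {..<n}) \<and>
     (AE \<omega> in M. continuous_on {0..T} (\<lambda>t. W t \<omega>))"

text \<open>The augmentation is by all subsets of null sets of the ambient space \<open>M\<close>.\<close>

definition aug_filtration :: "'a measure \<Rightarrow> (real \<Rightarrow> 'a \<Rightarrow> real) \<Rightarrow> real \<Rightarrow> 'a measure" where
  "aug_filtration M W t = sigma (space M)
     ({W s -` B \<inter> space M | s B. s \<in> {0..t} \<and> B \<in> sets borel} \<union>
      {N. \<exists>N'\<in>null_sets M. N \<subseteq> N'})"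

abbreviation time_measure :: "real \<Rightarrow> real measure" where
  "time_measure T \<equiv> restrict_space lborel {0..T}"

definition adapted_sets :: "'a measure \<Rightarrow> real \<Rightarrow> (real \<Rightarrow> 'a measure) \<Rightarrow> (real \<times> 'a) set set" where
  "adapted_sets M T Fil =
     {B \<in> sets (time_measure T \<Otimes>\<^sub>M M).
        \<forall>u\<in>{0..T}. (\<lambda>\<omega>. indicator B (u, \<omega>) :: real) \<in> borel_measurable (Fil u)}"

definition adapted_algebra :: "'a measure \<Rightarrow> real \<Rightarrow> (real \<Rightarrow> 'a measure) \<Rightarrow> (real \<times> 'a) measure" where
  "adapted_algebra M T Fil = sigma ({0..T} \<times> space M) (adapted_sets M T Fil)"


subsection \<open>\<open>\<gamma>\<close>-radonifying operators\<close>

text \<open>Elements of \<open>L\<^sup>2([0,T])\<close> are given by their representatives. An operator on \<open>L\<^sup>2([0,T])\<close> is a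
  function on representatives; the bound in \<open>L2_operators\<close> makes it independent of the choice of the
  representative, and the value \<open>0\<close> outside of \<open>L2 T\<close> makes equality of operators coincide with
  equality of functions.\<close>

definition L2 :: "real \<Rightarrow> (real \<Rightarrow> real) set" where
  "L2 T = {f \<in> borel_measurable (time_measure T). integrable (time_measure T) (\<lambda>u. (f u)\<^sup>2)}"

definition L2_inner :: "real \<Rightarrow> (real \<Rightarrow> real) \<Rightarrow> (real \<Rightarrow> real) \<Rightarrow> real" where
  "L2_inner T f g = (\<integral>u. f u * g u \<partial>time_measure T)"

type_synonym 'b op = "(real \<Rightarrow> real) \<Rightarrow> 'b"

definition L2_operators :: "real \<Rightarrow> 'b::real_normed_vector op set" where
  "L2_operators T = {R.
     (\<forall>f\<in>L2 T. \<forall>g\<in>L2 T. R (\<lambda>u. f u + g u) = R f + R g) \<and>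
     (\<forall>f\<in>L2 T. \<forall>c. R (\<lambda>u. c * f u) = c *\<^sub>R R f) \<and>
     (\<exists>C. \<forall>f\<in>L2 T. norm (R f) \<le> C * sqrt (L2_inner T f f)) \<and>
     (\<forall>f. f \<notin> L2 T \<longrightarrow> R f = 0)}"

definition op_diff :: "'b::real_normed_vector op \<Rightarrow> 'b op \<Rightarrow> 'b op" where
  "op_diff R S = (\<lambda>f. R f - S f)"

definition finite_rank :: "real \<Rightarrow> 'b::real_normed_vector op set" where
  "finite_rank T = {R \<in> L2_operators T. \<exists>B. finite B \<and> R ` L2 T \<subseteq> span B}"

definition orthonormal_systems :: "real \<Rightarrow> (nat \<times> (nat \<Rightarrow> real \<Rightarrow> real)) set" where
  "orthonormal_systems T = {(n, h). (\<forall>i<n. h i \<in> L2 T) \<and>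
     (\<forall>i<n. \<forall>j<n. L2_inner T (h i) (h j) = (if i = j then 1 else 0))}"

definition gamma_norm_sq :: "real \<Rightarrow> 'b::real_normed_vector op \<Rightarrow> ennreal" where
  "gamma_norm_sq T R = (SUP (n, h) \<in> orthonormal_systems T.
     \<integral>\<^sup>+ z. ennreal ((norm (\<Sum>j<n. z j *\<^sub>R R (h j)))\<^sup>2)
       \<partial>(\<Pi>\<^sub>M j\<in>{..<n}. density lborel std_normal_density))"

definition gamma_norm :: "real \<Rightarrow> 'b::real_normed_vector op \<Rightarrow> real" where
  "gamma_norm T R = sqrt (enn2real (gamma_norm_sq T R))"

text \<open>The closure of the finite rank operators. It is taken among the operators with finite norm, so
  the truncation of \<open>\<infinity>\<close> to \<open>0\<close> in \<open>enn2real\<close> never matters: finite rank operators, and hence the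
  differences below, have finite norm.\<close>

definition gamma_space :: "real \<Rightarrow> 'b::real_normed_vector op set" where
  "gamma_space T = {R \<in> L2_operators T. gamma_norm_sq T R < \<infinity> \<and>
     (\<forall>\<epsilon>>0. \<exists>S\<in>finite_rank T. gamma_norm T (op_diff R S) < \<epsilon>)}"


subsection \<open>Random variables with values in \<open>\<gamma>(0,T;F)\<close>\<close>

text \<open>Elements of \<open>L\<^sup>2(\<Omega>;\<gamma>(0,T;F))\<close>, like those of all \<open>L\<^sup>2\<close>-spaces here, are given by their
  representatives.\<close>

definition gamma_strongly_measurable ::
  "'a measure \<Rightarrow> real \<Rightarrow> ('a \<Rightarrow> 'b::real_normed_vector op) \<Rightarrow> bool" where
  "gamma_strongly_measurable M T X \<longleftrightarrow>
     (\<forall>\<omega>\<in>space M. X \<omega> \<in> gamma_space T) \<and>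
     (\<exists>s. (\<forall>n. simple_function M (s n) \<and> s n ` space M \<subseteq> gamma_space T) \<and>
          (AE \<omega> in M. (\<lambda>n. gamma_norm T (op_diff (s n \<omega>) (X \<omega>))) \<longlonglongrightarrow> 0))"

definition L2_gamma :: "'a measure \<Rightarrow> real \<Rightarrow> ('a \<Rightarrow> 'b::real_normed_vector op) set" where
  "L2_gamma M T = {X. gamma_strongly_measurable M T X \<and>
     integrable M (\<lambda>\<omega>. (gamma_norm T (X \<omega>))\<^sup>2)}"

definition L2_gamma_norm :: "'a measure \<Rightarrow> real \<Rightarrow> ('a \<Rightarrow> 'b::real_normed_vector op) \<Rightarrow> real" where
  "L2_gamma_norm M T X = sqrt (\<integral>\<omega>. (gamma_norm T (X \<omega>))\<^sup>2 \<partial>M)"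

definition defines_rv ::
  "'a measure \<Rightarrow> real \<Rightarrow> (real \<times> 'a \<Rightarrow> 'b::{banach, second_countable_topology}) \<Rightarrow>
   ('a \<Rightarrow> 'b op) \<Rightarrow> bool" where
  "defines_rv M T \<phi> X \<longleftrightarrow>
     \<phi> \<in> borel_measurable (time_measure T \<Otimes>\<^sub>M M) \<and>
     (\<forall>f :: 'b \<Rightarrow>\<^sub>L real. AE \<omega> in M. (\<lambda>u. blinfun_apply f (\<phi> (u, \<omega>))) \<in> L2 T) \<and>
     (\<forall>h\<in>L2 T. \<forall>f :: 'b \<Rightarrow>\<^sub>L real. AE \<omega> in M.
        blinfun_apply f (X \<omega> h) = (\<integral>u. h u * blinfun_apply f (\<phi> (u, \<omega>)) \<partial>time_measure T))"

definition adapted_step ::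
  "real \<Rightarrow> (real \<Rightarrow> 'a measure) \<Rightarrow> (real \<times> 'a \<Rightarrow> 'b::real_normed_vector) set" where
  "adapted_step T Fil = {\<phi>. \<exists>(n::nat) (m::nat) (t :: nat \<Rightarrow> real) A D e0 e.
     0 \<le> t 0 \<and> (\<forall>i\<in>{1..n}. t (i - 1) < t i) \<and> t n \<le> T \<and>
     A \<in> sets (Fil 0) \<and>
     (\<forall>i\<in>{1..n}. (\<forall>j\<in>{1..m}. D j i \<in> sets (Fil (t (i - 1)))) \<and>
                  disjoint_family_on (\<lambda>j. D j i) {1..m}) \<and>
     \<phi> = (\<lambda>p. indicator ({0} \<times> A) p *\<^sub>R e0 +
               (\<Sum>i=1..n. \<Sum>j=1..m. indicator ({t (i - 1)<..t i} \<times> D j i) p *\<^sub>R e j i))}"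

definition L2_gamma_adapted ::
  "'a measure \<Rightarrow> real \<Rightarrow> (real \<Rightarrow> 'a measure) \<Rightarrow>
   ('a \<Rightarrow> 'b::{banach, second_countable_topology} op) set" where
  "L2_gamma_adapted M T Fil = {X \<in> L2_gamma M T.
     \<forall>\<epsilon>>0. \<exists>\<phi>\<in>adapted_step T Fil. \<exists>Y\<in>L2_gamma M T.
       defines_rv M T \<phi> Y \<and> L2_gamma_norm M T (\<lambda>\<omega>. op_diff (X \<omega>) (Y \<omega>)) < \<epsilon>}"


subsection \<open>Subtrajectory integrals and the set \<open>\<Delta>\<close>\<close>

definition process_norm ::
  "'a measure \<Rightarrow> real \<Rightarrow> (real \<times> 'a \<Rightarrow> 'b::{banach, second_countable_topology}) \<Rightarrow> real" where
  "process_norm M T h = sqrt (\<integral>p. (norm (h p))\<^sup>2 \<partial>(time_measure T \<Otimes>\<^sub>M M))"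

definition subtraj_integrals ::
  "'a measure \<Rightarrow> real \<Rightarrow> (real \<Rightarrow> 'a measure) \<Rightarrow>
   (real \<times> 'a \<Rightarrow> 'b::{banach, second_countable_topology} set) \<Rightarrow> (real \<times> 'a \<Rightarrow> 'b) set" where
  "subtraj_integrals M T Fil H = {h \<in> borel_measurable (adapted_algebra M T Fil).
     integrable (time_measure T \<Otimes>\<^sub>M M) (\<lambda>p. (norm (h p))\<^sup>2) \<and>
     (AE p in time_measure T \<Otimes>\<^sub>M M. h p \<in> H p)}"

definition Delta ::
  "'a measure \<Rightarrow> real \<Rightarrow> (real \<Rightarrow> 'a measure) \<Rightarrow>
   (real \<times> 'a \<Rightarrow> 'b::{banach, second_countable_topology} set) \<Rightarrow> ('a \<Rightarrow> 'b op) set" where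
  "Delta M T Fil H = {X \<in> L2_gamma_adapted M T Fil.
     \<exists>h. defines_rv M T h X \<and> (AE p in time_measure T \<Otimes>\<^sub>M M. h p \<in> H p)}"

end

theory Submission
  imports Defs
begin

text \<open>Both parts compare the norm of an operator \<open>R\<close> on \<open>L\<^sup>2([0,T])\<close> with the \<open>L\<^sup>2\<close>-norm of a
  function \<open>f\<close> that represents it, \<open>R h = \<integral> h f\<close>.

  \<^bold>\<open>Cotype 2.\<close> The norm of \<open>f\<close> is at most a constant times the norm of \<open>R\<close> (\<open>cotype_embedding\<close>).
  Normalized indicators of disjoint sets \<open>A i\<close> form an orthonormal system, on which \<open>R\<close> yields the
  averages of \<open>f\<close> over the \<open>A i\<close>; the cotype inequality, passed from signs to Gaussian
  variables, bounds the weighted sum of the squared norms of these averages. If the \<open>A i\<close> are level sets on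
  which \<open>f\<close> is almost constant, this sum is almost the integral of the squared norm of \<open>f\<close>.
  Integrated over the sample space (\<open>process_distance_le\<close>), the inequality shows that the
  adapted step processes whose operators approximate \<open>X\<close> converge in \<open>L\<^sup>2([0,T] \<times> \<Omega>)\<close> to the process \<open>h\<close> that
  defines \<open>X\<close>. An almost everywhere limit of them is measurable and adapted, equals \<open>h\<close> almost everywhere, hence takes its
  values in \<open>H\<close>, and still defines \<open>X\<close> (\<open>cotype_2_adapted_version\<close>).

  \<^bold>\<open>Hilbert spaces.\<close> The cotype inequality holds with constant \<open>1\<close>, and Bessel's inequality
  gives the converse estimate, so the two norms coincide (\<open>hilbert_gamma_norm_sq\<close>). Almost every section of \<open>g\<close>
  defines an operator, and approximating \<open>g\<close> amounts to approximating the operators.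
  What remains is that adapted step processes are dense among the
  square integrable, measurable and adapted processes (\<open>adapted_step_dense\<close>). This is the
  density theorem that underlies the Ito integral; it is proved by sampling
  the process on a randomly shifted grid.

  The operator \<open>X \<omega>\<close> is tied to the process only through functionals and test functions, and
  the exceptional null set depends on both. A countable separating set of
  functionals, provided by the Hahn--Banach theorem (\<open>countable_separating_set\<close>), and countably
  many step functions that determine an operator on \<open>L\<^sup>2([0,T])\<close> (\<open>L2_functional_zero\<close>) leave one null
  set, outside of which the tie holds for all test functions (\<open>defines_rv_weakly_represents\<close>).\<close>

section \<open>Norming functionals\<close>

definition sublinear :: "('b::real_vector \<Rightarrow> real) \<Rightarrow> bool" where
  "sublinear p \<longleftrightarrow> (\<forall>x y. p (x + y) \<le> p x + p y) \<and> (\<forall>c\<ge>0. \<forall>x. p (c *\<^sub>R x) = c * p x)"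

lemma sublinearD:
  assumes "sublinear p"
  shows "p (x + y) \<le> p x + p y" "c \<ge> 0 \<Longrightarrow> p (c *\<^sub>R x) = c * p x" "p 0 = 0" "- p (- x) \<le> p x"
proof -
  show *: "p (x + y) \<le> p x + p y" "c \<ge> 0 \<Longrightarrow> p (c *\<^sub>R x) = c * p x" for x y c
    using assms by (auto simp: sublinear_def)
  show 0: "p 0 = 0" using *(2)[of 0 0] by simp
  show "- p (- x) \<le> p x" using *(1)[of x "-x"] 0 by simp
qed

text \<open>The largest sublinear functional below \<open>p\<close> whose value at \<open>- x\<close> is at most \<open>- p x\<close>.\<close>

definition shift_inf :: "('b::real_vector \<Rightarrow> real) \<Rightarrow> 'b \<Rightarrow> 'b \<Rightarrow> real" where
  "shift_inf p x y = (INF t\<in>{0..}. p (y + t *\<^sub>R x) - t * p x)"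

lemma shift_inf_props:
  fixes p :: "'b::real_vector \<Rightarrow> real"
  assumes p: "sublinear p"
  shows "sublinear (shift_inf p x)" "shift_inf p x y \<le> p y" "shift_inf p x (- x) \<le> - p x"
proof -
  have lb: "- p (- y) \<le> p (y + t *\<^sub>R x) - t * p x" if "t \<ge> 0" for t y
    using sublinearD(1)[OF p, of "y + t *\<^sub>R x" "- y"] sublinearD(2)[OF p, of t x] that by simp
  have bdd: "bdd_below ((\<lambda>t. p (y + t *\<^sub>R x) - t * p x) ` {0..})" for y
    by (rule bdd_belowI[of _ "- p (- y)"]) (use lb in auto)
  have low: "shift_inf p x y \<le> p (y + t *\<^sub>R x) - t * p x" if "t \<ge> 0" for t y
    unfolding shift_inf_def by (rule cINF_lower[OF bdd]) (use that in auto)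
  have great: "c \<le> shift_inf p x y" if "\<And>t. t \<ge> 0 \<Longrightarrow> c \<le> p (y + t *\<^sub>R x) - t * p x" for c y
    unfolding shift_inf_def by (rule cINF_greatest) (use that in auto)
  show "shift_inf p x y \<le> p y" using low[of 0 y] by simp
  show "shift_inf p x (- x) \<le> - p x" using low[of 1 "- x"] sublinearD(3)[OF p] by simp
  have add: "shift_inf p x (y + z) \<le> shift_inf p x y + shift_inf p x z" for y z
  proof -
    have "shift_inf p x (y + z) - (p (z + s *\<^sub>R x) - s * p x) \<le> shift_inf p x y" if "s \<ge> 0" for s
    proof (rule great)
      fix t :: real assume "t \<ge> 0"
      have "shift_inf p x (y + z) \<le> p ((y + z) + (t + s) *\<^sub>R x) - (t + s) * p x"
        by (rule low) (use \<open>t \<ge> 0\<close> that in auto)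
      also have "(y + z) + (t + s) *\<^sub>R x = (y + t *\<^sub>R x) + (z + s *\<^sub>R x)" by (simp add: algebra_simps)
      also have "p \<dots> \<le> p (y + t *\<^sub>R x) + p (z + s *\<^sub>R x)" by (rule sublinearD(1)[OF p])
      finally show "shift_inf p x (y + z) - (p (z + s *\<^sub>R x) - s * p x) \<le> p (y + t *\<^sub>R x) - t * p x"
        by (simp add: algebra_simps)
    qed
    then have "shift_inf p x (y + z) - shift_inf p x y \<le> shift_inf p x z"
      by (intro great) (auto simp: algebra_simps)
    then show ?thesis by simp
  qed
  have scale_le: "c * shift_inf p x y \<le> shift_inf p x (c *\<^sub>R y)" if "c > 0" for c y
  proof (rule great)
    fix t :: real assume "t \<ge> 0"
    have "c * shift_inf p x y \<le> c * (p (y + (t / c) *\<^sub>R x) - (t / c) * p x)"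
      by (rule mult_left_mono[OF low]) (use \<open>t \<ge> 0\<close> that in auto)
    also have "\<dots> = p (c *\<^sub>R y + t *\<^sub>R x) - t * p x"
      using sublinearD(2)[OF p, of c "y + (t / c) *\<^sub>R x"] that by (simp add: algebra_simps)
    finally show "c * shift_inf p x y \<le> p (c *\<^sub>R y + t *\<^sub>R x) - t * p x" .
  qed
  have scale: "shift_inf p x (c *\<^sub>R y) = c * shift_inf p x y" if "c \<ge> 0" for c y
  proof (cases "c = 0")
    case True
    have "shift_inf p x 0 = 0"
      using low[of 0 0] great[of 0 0] lb[of _ 0] sublinearD(3)[OF p] by force
    then show ?thesis using True by simp
  next
    case False
    then have c: "c > 0" using that by simp
    have "inverse c * shift_inf p x (c *\<^sub>R y) \<le> shift_inf p x y"
      using scale_le[of "inverse c" "c *\<^sub>R y"] c by simp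
    then show ?thesis using scale_le[OF c, of y] c by (simp add: field_simps)
  qed
  show "sublinear (shift_inf p x)" unfolding sublinear_def using add scale by blast
qed

text \<open>A minimal sublinear functional is linear, because
  the functional \<open>shift_inf m x\<close> cannot be smaller than \<open>m\<close>, which forces \<open>m (- x) = - m x\<close>.\<close>

lemma linear_below_sublinear:
  fixes q :: "'b::real_vector \<Rightarrow> real"
  assumes q: "sublinear q"
  shows "\<exists>m. linear m \<and> (\<forall>y. m y \<le> q y)"
proof -
  define A where "A = {p. sublinear p \<and> (\<forall>y. p y \<le> q y)}"
  define P where "P = (\<lambda>p p' :: 'b \<Rightarrow> real. \<forall>y. p' y \<le> p y)"
  have "\<exists>m\<in>A. \<forall>a\<in>A. P m a \<longrightarrow> a = m"
  proof (rule predicate_Zorn)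
    show "partial_order_on A (relation_of P A)"
      by (rule partial_order_on_relation_ofI) (auto simp: P_def fun_eq_iff intro: order_trans antisym)
  next
    fix C assume C: "C \<in> Chains (relation_of P A)"
    then have CA: "C \<subseteq> A" by (auto simp: Chains_def relation_of_def)
    have cmp: "(\<forall>y. a y \<le> b y) \<or> (\<forall>y. b y \<le> a y)" if "a \<in> C" "b \<in> C" for a b
      using C that by (auto simp: Chains_def relation_of_def P_def)
    show "\<exists>u\<in>A. \<forall>a\<in>C. P a u"
    proof (cases "C = {}")
      case True then show ?thesis using q by (auto simp: A_def)
    next
      case False
      define u where "u = (\<lambda>y. INF p\<in>C. p y)"
      have sub: "sublinear p" "p y \<le> q y" if "p \<in> C" for p y using that CA by (auto simp: A_def)
      have bdd: "bdd_below ((\<lambda>p. p y) ` C)" for y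
      proof (rule bdd_belowI[of _ "- q (- y)"])
        fix r assume "r \<in> (\<lambda>p. p y) ` C"
        then obtain p where "p \<in> C" "r = p y" by auto
        then show "- q (- y) \<le> r" using sublinearD(4)[OF sub(1), of p y] sub(2)[of p "-y"] by auto
      qed
      have low: "u y \<le> p y" if "p \<in> C" for p y
        unfolding u_def by (rule cINF_lower[OF bdd that])
      have great: "c \<le> u y" if "\<And>p. p \<in> C \<Longrightarrow> c \<le> p y" for c y
        unfolding u_def by (rule cINF_greatest) (use that False in auto)
      have add: "u (y + z) \<le> u y + u z" for y z
      proof -
        have "u (y + z) \<le> p y + p' z" if "p \<in> C" "p' \<in> C" for p p'
        proof -
          have "\<exists>r\<in>C. r y \<le> p y \<and> r z \<le> p' z" using cmp[OF that] that by blast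
          then obtain r where "r \<in> C" "r y \<le> p y" "r z \<le> p' z" by blast
          then show ?thesis using low[of r "y + z"] sublinearD(1)[OF sub(1), of r y z] by linarith
        qed
        then have "u (y + z) - p' z \<le> u y" if "p' \<in> C" for p'
          using that by (intro great) (auto simp: algebra_simps)
        then have "u (y + z) - u y \<le> u z" by (intro great) (auto simp: algebra_simps)
        then show ?thesis by simp
      qed
      have scale_le: "c * u y \<le> u (c *\<^sub>R y)" if "c \<ge> 0" for c y
      proof (rule great)
        fix p assume "p \<in> C"
        then show "c * u y \<le> p (c *\<^sub>R y)"
          using sublinearD(2)[OF sub(1) that, of p y] mult_left_mono[OF low that, of p y] by simp
      qed
      have scale: "u (c *\<^sub>R y) = c * u y" if "c \<ge> 0" for c y
      proof (cases "c = 0")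
        case True
        obtain p where "p \<in> C" using False by blast
        then have "u 0 \<le> 0" using low[of p 0] sublinearD(3)[OF sub(1), of p] by simp
        moreover have "0 \<le> u 0" using sublinearD(3)[OF sub(1)] by (intro great) (metis order_refl)
        ultimately show ?thesis using True by simp
      next
        case False
        then have c: "c > 0" using that by simp
        have "inverse c * u (c *\<^sub>R y) \<le> u y"
          using scale_le[of "inverse c" "c *\<^sub>R y"] c by simp
        then show ?thesis using scale_le[OF that, of y] c by (simp add: field_simps)
      qed
      have "\<exists>p. p \<in> C" using False by blast
      then have "u \<in> A" unfolding A_def sublinear_def
        using add scale low sub(2) order_trans by (smt (verit, best) mem_Collect_eq)
      then show ?thesis using low by (auto simp: P_def)
    qed
  qed
  then obtain m where m: "sublinear m" "\<And>y. m y \<le> q y"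
    and min: "\<And>a. sublinear a \<Longrightarrow> (\<And>y. a y \<le> m y) \<Longrightarrow> a = m"
    unfolding A_def P_def by (auto intro: order_trans) (metis order_trans)
  have neg: "m (- x) = - m x" for x
    using min[OF shift_inf_props(1)[OF m(1), of x] shift_inf_props(2)[OF m(1)]]
      shift_inf_props(3)[OF m(1), of x] sublinearD(4)[OF m(1), of x] by simp
  have "linear m"
  proof
    fix x y
    show "m (x + y) = m x + m y"
      using sublinearD(1)[OF m(1), of x y] sublinearD(1)[OF m(1), of "x + y" "- y"] neg[of y] by simp
  next
    fix c :: real and x
    show "m (c *\<^sub>R x) = c *\<^sub>R m x"
    proof (cases "c \<ge> 0")
      case True then show ?thesis using sublinearD(2)[OF m(1)] by simp
    next
      case False
      then show ?thesis using sublinearD(2)[OF m(1), of "- c" x] neg[of "c *\<^sub>R x"] by simp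
    qed
  qed
  then show ?thesis using m(2) by blast
qed

text \<open>The Hahn--Banach theorem. Applying the preceding lemma to \<open>shift_inf norm x\<close> rather than to
  the norm makes the functional attain its norm at \<open>x\<close>.\<close>

lemma norming_functional:
  fixes x :: "'b::real_normed_vector"
  shows "\<exists>f :: 'b \<Rightarrow>\<^sub>L real. norm f \<le> 1 \<and> blinfun_apply f x = norm x"
proof -
  have n: "sublinear (norm :: 'b \<Rightarrow> real)" by (auto simp: sublinear_def norm_triangle_ineq)
  obtain m where m: "linear m" "\<And>y. m y \<le> shift_inf norm x y"
    using linear_below_sublinear[OF shift_inf_props(1)[OF n]] by blast
  have le: "m y \<le> norm y" for y using m(2)[of y] shift_inf_props(2)[OF n, of x y] by linarith
  have abs: "norm (m y) \<le> norm y * 1" for y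
    using le[of y] le[of "- y"] linear_neg[OF m(1), of y] by auto
  have bl: "bounded_linear m"
    by (intro bounded_linear.intro m(1) bounded_linear_axioms.intro exI[of _ 1]) (use abs in auto)
  have "norm x \<le> m x"
    using m(2)[of "- x"] shift_inf_props(3)[OF n, of x] linear_neg[OF m(1), of x] by simp
  then have "m x = norm x" using le[of x] by simp
  moreover have "norm (Blinfun m) \<le> 1"
    by (rule norm_blinfun_bound) (use abs bl in \<open>auto simp: bounded_linear_Blinfun_apply\<close>)
  ultimately show ?thesis using bl by (intro exI[of _ "Blinfun m"]) (auto simp: bounded_linear_Blinfun_apply)
qed

definition separating :: "('b::real_normed_vector \<Rightarrow>\<^sub>L real) set \<Rightarrow> bool" where
  "separating D \<longleftrightarrow> (\<forall>x y. (\<forall>f\<in>D. blinfun_apply f x = blinfun_apply f y) \<longrightarrow> x = y)"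

text \<open>In a separable space, functionals that attain their norm along a dense sequence
  suffice. Countability allows the exceptional null sets, one for every functional, to be united.\<close>

lemma countable_separating_set:
  "\<exists>D :: ('b::{real_normed_vector, second_countable_topology} \<Rightarrow>\<^sub>L real) set. countable D \<and> separating D"
proof -
  obtain B :: "'b set" where B: "countable B" "\<And>U. open U \<Longrightarrow> U \<noteq> {} \<Longrightarrow> \<exists>d\<in>B. d \<in> U"
    using countable_dense_exists by metis
  obtain F :: "'b \<Rightarrow> 'b \<Rightarrow>\<^sub>L real" where F: "\<And>x. norm (F x) \<le> 1" "\<And>x. blinfun_apply (F x) x = norm x"
    using norming_functional by metis
  have "separating (F ` B)" unfolding separating_def
  proof (intro allI impI, rule ccontr)
    fix x y assume eq: "\<forall>f\<in>F ` B. blinfun_apply f x = blinfun_apply f y" and "x \<noteq> y"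
    define z where "z = x - y"
    have "z \<noteq> 0" using \<open>x \<noteq> y\<close> by (simp add: z_def)
    then obtain d where d: "d \<in> B" "dist z d < norm z / 2"
      using B(2)[of "ball z (norm z / 2)"] by (auto simp: ball_eq_empty)
    have "blinfun_apply (F d) z = 0" using eq d(1) by (auto simp: z_def blinfun.diff_right)
    then have "norm d = norm (blinfun_apply (F d) (d - z))" using F(2)[of d] by (simp add: blinfun.diff_right)
    also have "\<dots> \<le> norm (F d) * norm (d - z)" by (rule norm_blinfun)
    also have "\<dots> \<le> 1 * norm (d - z)" by (intro mult_right_mono F) auto
    finally have "norm d \<le> dist z d" by (simp add: dist_norm norm_minus_commute)
    moreover have "norm z \<le> norm d + dist z d" using norm_triangle_ineq[of d "z - d"]
      by (simp add: dist_norm)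
    ultimately show False using d(2) by linarith
  qed
  then show ?thesis using B(1) by (intro exI[of _ "F ` B"]) auto
qed

section \<open>Gaussian sums\<close>

abbreviation std_normal :: "real measure" where
  "std_normal \<equiv> density lborel (\<lambda>x. ennreal (std_normal_density x))"

abbreviation gauss :: "nat \<Rightarrow> (nat \<Rightarrow> real) measure" where
  "gauss n \<equiv> \<Pi>\<^sub>M j\<in>{..<n}. std_normal"

definition gauss_sq :: "nat \<Rightarrow> (nat \<Rightarrow> 'b::real_normed_vector) \<Rightarrow> ennreal" where
  "gauss_sq n x = (\<integral>\<^sup>+z. ennreal ((norm (\<Sum>j<n. z j *\<^sub>R x j))\<^sup>2) \<partial>gauss n)"

lemma prob_space_std_normal: "prob_space std_normal"
  using prob_space_normal_density[of 1 0] by simp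

lemma product_std_normal: "product_prob_space (\<lambda>_::nat. std_normal)"
  by (rule product_prob_spaceI) (rule prob_space_std_normal)

lemma std_normal_moments:
  "integrable std_normal (\<lambda>x. x)" "integrable std_normal (\<lambda>x. x * x)"
  "(\<integral>x. x \<partial>std_normal) = 0" "(\<integral>x. x * x \<partial>std_normal) = 1"
  using integrable_std_normal_moment[of 1] integrable_std_normal_moment[of 2]
    integral_std_normal_moment_odd[of 0] integral_std_normal_moment_even[of 1]
  by (auto simp: integrable_density integral_density power2_eq_square)

lemma gauss_product_moments:
  assumes "i < n" "j < n"
  shows "integrable (gauss n) (\<lambda>z. z i * z j)"
    "(\<integral>z. z i * z j \<partial>gauss n) = (if i = j then 1 else 0)"
proof -
  interpret product_prob_space "\<lambda>_::nat. std_normal" by (rule product_std_normal)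
  \<comment> \<open>\<open>z i * z j\<close> as a product over all coordinates, so that its integral factorizes also for \<open>i = j\<close>\<close>
  define f :: "nat \<Rightarrow> real \<Rightarrow> real" where
    "f = (\<lambda>k x. (if k = i then x else 1) * (if k = j then x else 1))"
  have eq: "(\<Prod>k<n. f k (z k)) = z i * z j" for z
    using assms by (simp add: f_def prod.distrib prod.delta)
  have int: "integrable std_normal (f k)" for k
    using std_normal_moments by (cases "k = i"; cases "k = j")
      (auto simp: f_def prob_space.finite_measure[OF prob_space_std_normal]
         intro!: finite_measure.integrable_const)
  show "integrable (gauss n) (\<lambda>z. z i * z j)"
    using product_integrable_prod[of "{..<n}" f] int by (simp add: eq)
  have "(\<integral>z. z i * z j \<partial>gauss n) = (\<Prod>k<n. \<integral>x. f k x \<partial>std_normal)"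
    using product_integral_prod[of "{..<n}" f] int by (simp add: eq)
  also have "\<dots> = (if i = j then 1 else 0)"
  proof (cases "i = j")
    case True
    have "(\<integral>x. f k x \<partial>std_normal) = 1" for k
      using std_normal_moments(4) prob_space.prob_space[OF prob_space_std_normal] True
      by (cases "k = i") (auto simp: f_def)
    then show ?thesis using True by simp
  next
    case False
    then have "(\<integral>x. f i x \<partial>std_normal) = 0" using std_normal_moments(3) by (simp add: f_def)
    then have "(\<Prod>k<n. \<integral>x. f k x \<partial>std_normal) = 0" using assms(1) by (intro prod_zero) auto
    then show ?thesis using False by simp
  qed
  finally show "(\<integral>z. z i * z j \<partial>gauss n) = (if i = j then 1 else 0)" .
qed

lemma gauss_sum_measurable [measurable]:
  fixes x :: "nat \<Rightarrow> 'b::{real_normed_vector, second_countable_topology}"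
  shows "(\<lambda>z. \<Sum>j<n. z j *\<^sub>R x j) \<in> borel_measurable (gauss n)"
  by (intro borel_measurable_sum borel_measurable_scaleR) auto

lemma gauss_sum_squares:
  fixes a :: "nat \<Rightarrow> real"
  assumes "\<And>j. j < n \<Longrightarrow> a j \<ge> 0"
  shows "(\<integral>\<^sup>+z. ennreal (\<Sum>j<n. (z j)\<^sup>2 * a j) \<partial>gauss n) = ennreal (\<Sum>j<n. a j)"
proof -
  have int: "integrable (gauss n) (\<lambda>z. (z j)\<^sup>2 * a j)" "(\<integral>z. (z j)\<^sup>2 * a j \<partial>gauss n) = a j"
    if "j < n" for j
    using gauss_product_moments[OF that that] by (simp_all add: power2_eq_square)
  have "(\<integral>\<^sup>+z. ennreal (\<Sum>j<n. (z j)\<^sup>2 * a j) \<partial>gauss n) = ennreal (\<integral>z. (\<Sum>j<n. (z j)\<^sup>2 * a j) \<partial>gauss n)"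
    by (rule nn_integral_eq_integral) (use int assms in \<open>auto intro!: sum_nonneg\<close>)
  also have "(\<integral>z. (\<Sum>j<n. (z j)\<^sup>2 * a j) \<partial>gauss n) = (\<Sum>j<n. a j)"
    by (subst Bochner_Integration.integral_sum) (use int(1) in blast, rule sum.cong[OF refl], use int(2) in blast)
  finally show ?thesis .
qed

lemma std_normal_sign:
  assumes "c = 1 \<or> c = (- 1 :: real)"
  shows "distr std_normal std_normal (\<lambda>x. c * x) = std_normal"
proof -
  interpret prob_space std_normal by (rule prob_space_std_normal)
  have "distributed std_normal lborel (\<lambda>x. x) (normal_density 0 1)"
    unfolding distributed_def by (auto intro!: measure_eqI simp: emeasure_distr)
  from normal_density_affine[OF this, of c 0]
  have "distributed std_normal lborel (\<lambda>x. 0 + c * x) (normal_density (0 + c * 0) (\<bar>c\<bar> * 1))"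
    using assms by linarith
  moreover have "\<bar>c\<bar> = 1" using assms by auto
  ultimately have "distr std_normal lborel (\<lambda>x. c * x) = std_normal"
    by (simp only: distributed_def add_0_left mult_zero_right mult_1_right)
  moreover have "distr std_normal std_normal (\<lambda>x. c * x) = distr std_normal lborel (\<lambda>x. c * x)"
    by (rule distr_cong) simp_all
  ultimately show ?thesis by simp
qed

text \<open>The Gaussian product measure is invariant under changes of signs. This turns a
  Gaussian sum into a Rademacher sum with the random coefficients \<open>z j\<close>.\<close>

lemma gauss_sign_invariant:
  assumes r: "\<And>j. j < n \<Longrightarrow> r j = 1 \<or> r j = (- 1 :: real)"
  shows "distr (gauss n) (gauss n) (\<lambda>z. \<lambda>j\<in>{..<n}. r j * z j) = gauss n"
proof -
  interpret product_prob_space "\<lambda>_::nat. std_normal" by (rule product_std_normal)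
  have meas: "(\<lambda>z. \<lambda>j\<in>{..<n}. r j * z j) \<in> measurable (gauss n) (gauss n)"
    by (rule measurable_restrict) auto
  show ?thesis
  proof (rule PiM_eqI)
    fix A :: "nat \<Rightarrow> real set" assume A: "\<And>i. i \<in> {..<n} \<Longrightarrow> A i \<in> sets std_normal"
    have pre: "(\<lambda>z. \<lambda>j\<in>{..<n}. r j * z j) -` (Pi\<^sub>E {..<n} A) \<inter> space (gauss n) =
        (\<Pi>\<^sub>E j\<in>{..<n}. {x. r j * x \<in> A j})"
    proof (rule set_eqI)
      fix z :: "nat \<Rightarrow> real"
      show "z \<in> (\<lambda>z. \<lambda>j\<in>{..<n}. r j * z j) -` (Pi\<^sub>E {..<n} A) \<inter> space (gauss n) \<longleftrightarrow>
          z \<in> (\<Pi>\<^sub>E j\<in>{..<n}. {x. r j * x \<in> A j})"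
        unfolding space_PiM PiE_iff vimage_eq Int_iff by simp
    qed
    have m: "{x. r j * x \<in> A j} \<in> sets std_normal" if "j < n" for j
      using A[of j] that measurable_sets[of "\<lambda>x. r j * x" std_normal borel "A j"] by (simp add: vimage_def)
    have e: "emeasure std_normal {x. r j * x \<in> A j} = emeasure std_normal (A j)" if "j < n" for j
      using A[of j] that arg_cong[OF std_normal_sign[OF r[OF that]], of "\<lambda>M. emeasure M (A j)"]
      by (simp add: emeasure_distr vimage_def)
    have "emeasure (distr (gauss n) (gauss n) (\<lambda>z. \<lambda>j\<in>{..<n}. r j * z j)) (Pi\<^sub>E {..<n} A) =
        emeasure (gauss n) (\<Pi>\<^sub>E j\<in>{..<n}. {x. r j * x \<in> A j})"
      using A by (subst emeasure_distr[OF meas]) (auto simp only: pre intro!: sets_PiM_I_finite)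
    also have "\<dots> = (\<Prod>j<n. emeasure std_normal {x. r j * x \<in> A j})"
      by (rule emeasure_PiM) (use m in auto)
    also have "\<dots> = (\<Prod>j<n. emeasure std_normal (A j))" by (rule prod.cong) (use e in auto)
    finally show "emeasure (distr (gauss n) (gauss n) (\<lambda>z. \<lambda>j\<in>{..<n}. r j * z j)) (Pi\<^sub>E {..<n} A) =
      (\<Prod>j<n. emeasure std_normal (A j))" .
  qed auto
qed

lemma gauss_sq_sign:
  fixes x :: "nat \<Rightarrow> 'b::{real_normed_vector, second_countable_topology}"
  assumes r: "\<And>j. j < n \<Longrightarrow> r j = 1 \<or> r j = (- 1 :: real)"
  shows "(\<integral>\<^sup>+z. ennreal ((norm (\<Sum>j<n. r j *\<^sub>R z j *\<^sub>R x j))\<^sup>2) \<partial>gauss n) = gauss_sq n x"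
proof -
  have meas: "(\<lambda>z. \<lambda>j\<in>{..<n}. r j * z j) \<in> measurable (gauss n) (gauss n)"
    by (rule measurable_restrict) auto
  have "gauss_sq n x = (\<integral>\<^sup>+z. ennreal ((norm (\<Sum>j<n. z j *\<^sub>R x j))\<^sup>2)
      \<partial>distr (gauss n) (gauss n) (\<lambda>z. \<lambda>j\<in>{..<n}. r j * z j))"
    by (simp only: gauss_sq_def gauss_sign_invariant[OF r])
  also have "\<dots> = (\<integral>\<^sup>+z. ennreal ((norm (\<Sum>j<n. r j *\<^sub>R z j *\<^sub>R x j))\<^sup>2) \<partial>gauss n)"
    by (subst nn_integral_distr[OF meas]) (auto intro!: nn_integral_cong)
  finally show ?thesis ..
qed

text \<open>The constant bounds the squares, so it is the square of the cotype constant.\<close>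

definition gauss_cotype_2 :: "'b::real_normed_vector itself \<Rightarrow> real \<Rightarrow> bool" where
  "gauss_cotype_2 _ C \<longleftrightarrow> C \<ge> 0 \<and>
     (\<forall>n (x :: nat \<Rightarrow> 'b). ennreal (\<Sum>i<n. (norm (x i))\<^sup>2) \<le> ennreal C * gauss_sq n x)"

text \<open>Cotype inequality for the vectors \<open>z j *\<^sub>R x j\<close>, integrated over the Gaussian
  variables \<open>z j\<close>, whose second moments are \<open>1\<close>.\<close>

lemma cotype_2_imp_gauss_cotype_2:
  assumes "cotype_2 TYPE('b::{real_normed_vector, second_countable_topology})"
  shows "\<exists>C. gauss_cotype_2 TYPE('b) C"
proof -
  obtain C where C: "C \<ge> 0" "\<And>n (x :: nat \<Rightarrow> 'b). sqrt (\<Sum>i<n. (norm (x i))\<^sup>2) \<le>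
        C * sqrt (measure_pmf.expectation (Pi_pmf {..<n} 0 (\<lambda>_. pmf_of_set {-1, 1 :: real}))
                    (\<lambda>r. (norm (\<Sum>i<n. r i *\<^sub>R x i))\<^sup>2))"
    using assms unfolding cotype_2_def by blast
  have "ennreal (\<Sum>i<n. (norm (x i))\<^sup>2) \<le> ennreal (C\<^sup>2) * gauss_sq n x" for n and x :: "nat \<Rightarrow> 'b"
  proof -
    define R where "R = Pi_pmf {..<n} 0 (\<lambda>_. pmf_of_set {-1, 1 :: real})"
    have S: "set_pmf R = PiE_dflt {..<n} 0 (\<lambda>_. {-1, 1})"
      unfolding R_def by (subst set_Pi_pmf) (auto simp: o_def)
    have fin: "finite (set_pmf R)" unfolding S by (rule finite_PiE_dflt) auto
    have sgn: "r j = 1 \<or> r j = -1" if "r \<in> set_pmf R" "j < n" for r j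
      using that unfolding S by (auto simp: PiE_dflt_def)
    have ex: "measure_pmf.expectation R (\<lambda>r. (norm (\<Sum>i<n. r i *\<^sub>R y i))\<^sup>2) =
        (\<Sum>r\<in>set_pmf R. (norm (\<Sum>i<n. r i *\<^sub>R y i))\<^sup>2 * pmf R r)" for y :: "nat \<Rightarrow> 'b"
      by (rule integral_measure_pmf_real) (use fin in auto)
    have pt: "(\<Sum>i<n. (norm (y i))\<^sup>2) \<le> C\<^sup>2 * (\<Sum>r\<in>set_pmf R. (norm (\<Sum>i<n. r i *\<^sub>R y i))\<^sup>2 * pmf R r)"
      for y :: "nat \<Rightarrow> 'b"
    proof -
      have "(sqrt (\<Sum>i<n. (norm (y i))\<^sup>2))\<^sup>2 \<le>
          (C * sqrt (\<Sum>r\<in>set_pmf R. (norm (\<Sum>i<n. r i *\<^sub>R y i))\<^sup>2 * pmf R r))\<^sup>2"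
        using C(2)[where n = n and x = y] unfolding R_def[symmetric] ex
        by (intro power_mono) (auto intro!: sum_nonneg)
      then show ?thesis by (simp add: power_mult_distrib sum_nonneg)
    qed
    have "ennreal (\<Sum>i<n. (norm (x i))\<^sup>2) = (\<integral>\<^sup>+z. ennreal (\<Sum>i<n. (norm (z i *\<^sub>R x i))\<^sup>2) \<partial>gauss n)"
      using gauss_sum_squares[of n "\<lambda>i. (norm (x i))\<^sup>2"] by (simp add: power_mult_distrib)
    also have "\<dots> \<le> (\<integral>\<^sup>+z. ennreal (C\<^sup>2) * (\<Sum>r\<in>set_pmf R.
        ennreal (pmf R r) * ennreal ((norm (\<Sum>i<n. r i *\<^sub>R z i *\<^sub>R x i))\<^sup>2)) \<partial>gauss n)"
    proof (rule nn_integral_mono)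
      fix z
      have "ennreal (\<Sum>i<n. (norm (z i *\<^sub>R x i))\<^sup>2) \<le> ennreal (C\<^sup>2 *
          (\<Sum>r\<in>set_pmf R. (norm (\<Sum>i<n. r i *\<^sub>R z i *\<^sub>R x i))\<^sup>2 * pmf R r))"
        by (rule ennreal_leI) (rule pt)
      also have "\<dots> = ennreal (C\<^sup>2) * (\<Sum>r\<in>set_pmf R.
          ennreal (pmf R r) * ennreal ((norm (\<Sum>i<n. r i *\<^sub>R z i *\<^sub>R x i))\<^sup>2))"
        by (subst ennreal_mult) (simp_all add: sum_nonneg ennreal_mult' mult.commute flip: sum_ennreal)
      finally show "ennreal (\<Sum>i<n. (norm (z i *\<^sub>R x i))\<^sup>2) \<le> ennreal (C\<^sup>2) * (\<Sum>r\<in>set_pmf R.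
          ennreal (pmf R r) * ennreal ((norm (\<Sum>i<n. r i *\<^sub>R z i *\<^sub>R x i))\<^sup>2))" .
    qed
    also have "\<dots> = ennreal (C\<^sup>2) * (\<Sum>r\<in>set_pmf R. ennreal (pmf R r) *
        (\<integral>\<^sup>+z. ennreal ((norm (\<Sum>i<n. r i *\<^sub>R z i *\<^sub>R x i))\<^sup>2) \<partial>gauss n))"
      by (simp add: nn_integral_cmult nn_integral_sum)
    also have "\<dots> = ennreal (C\<^sup>2) * (\<Sum>r\<in>set_pmf R. ennreal (pmf R r) * gauss_sq n x)"
      by (intro arg_cong[where f = "(*) _"] sum.cong refl gauss_sq_sign) (use sgn in blast)
    also have "(\<Sum>r\<in>set_pmf R. ennreal (pmf R r) * gauss_sq n x) = gauss_sq n x"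
      using sum_pmf_eq_1[OF fin, of R] by (simp add: sum_distrib_right[symmetric] sum_ennreal)
    finally show ?thesis .
  qed
  then show ?thesis unfolding gauss_cotype_2_def by (intro exI[of _ "C\<^sup>2"]) auto
qed

text \<open>Independent centered variables are orthogonal: in the expansion of the squared norm by the
  inner product only the diagonal has a nonzero mean.\<close>

lemma hilbert_gauss_sq:
  fixes x :: "nat \<Rightarrow> 'b::banach"
  assumes "hilbert_space TYPE('b)"
  shows "gauss_sq n x = ennreal (\<Sum>i<n. (norm (x i))\<^sup>2)"
proof -
  obtain ip :: "'b \<Rightarrow> 'b \<Rightarrow> real" where ip: "bilinear ip" "\<And>x y. ip x y = ip y x" "\<And>x. norm x = sqrt (ip x x)"
    using assms unfolding hilbert_space_def by blast
  have nsq: "(norm y)\<^sup>2 = ip y y" for y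
    using ip(3)[of y] norm_ge_zero[of y] by (metis real_sqrt_ge_0_iff real_sqrt_pow2)
  have eq: "(norm (\<Sum>j<n. z j *\<^sub>R x j))\<^sup>2 = (\<Sum>(i,j)\<in>{..<n}\<times>{..<n}. z i * z j * ip (x i) (x j))" for z
    unfolding nsq bilinear_sum[OF ip(1)]
    by (intro sum.cong refl) (auto simp: bilinear_lmul[OF ip(1)] bilinear_rmul[OF ip(1)])
  have int: "integrable (gauss n) (\<lambda>z. \<Sum>(i,j)\<in>{..<n}\<times>{..<n}. z i * z j * ip (x i) (x j))"
    using gauss_product_moments(1) by (intro Bochner_Integration.integrable_sum) auto
  have "gauss_sq n x = ennreal (\<integral>z. (\<Sum>(i,j)\<in>{..<n}\<times>{..<n}. z i * z j * ip (x i) (x j)) \<partial>gauss n)"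
    unfolding gauss_sq_def using int by (subst nn_integral_eq_integral[symmetric]) (auto simp: eq[symmetric])
  also have "(\<integral>z. (\<Sum>(i,j)\<in>{..<n}\<times>{..<n}. z i * z j * ip (x i) (x j)) \<partial>gauss n) =
      (\<Sum>(i,j)\<in>{..<n}\<times>{..<n}. (if i = j then 1 else 0) * ip (x i) (x j))"
    using gauss_product_moments
    by (subst Bochner_Integration.integral_sum) (auto simp: case_prod_beta intro!: sum.cong)
  also have "\<dots> = (\<Sum>i<n. (norm (x i))\<^sup>2)"
    by (simp add: sum.cartesian_product[symmetric] nsq if_distrib[where f = "\<lambda>c. c * _"] cong: if_cong)
  finally show ?thesis .
qed

section \<open>Square integrable functions: simple approximation and translation\<close>

abbreviation nsq :: "'b::real_normed_vector \<Rightarrow> ennreal" where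
  "nsq x \<equiv> ennreal ((norm x)\<^sup>2)"

lemma nsq_triangle: "nsq (x - z) \<le> 2 * nsq (x - y) + 2 * nsq (y - z)"
proof -
  have "norm (x - z) \<le> norm (x - y) + norm (y - z)"
    using norm_triangle_ineq[of "x - y" "y - z"] by simp
  then have "(norm (x - z))\<^sup>2 \<le> (norm (x - y) + norm (y - z))\<^sup>2" by (intro power_mono) auto
  also have "\<dots> \<le> 2 * (norm (x - y))\<^sup>2 + 2 * (norm (y - z))\<^sup>2"
    using sum_squares_bound[of "norm (x - y)" "norm (y - z)"] by (simp add: power2_sum)
  finally have "nsq (x - z) \<le> ennreal (2 * (norm (x - y))\<^sup>2 + 2 * (norm (y - z))\<^sup>2)"
    by (rule ennreal_leI)
  then show ?thesis by (simp add: ennreal_plus ennreal_mult)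
qed

lemma nsq_diff: "nsq (x - y) \<le> 2 * nsq x + 2 * nsq y"
  using nsq_triangle[of x y 0] by simp

lemma nn_integral_nsq_triangle:
  fixes f g h :: "'a \<Rightarrow> 'b::{real_normed_vector, second_countable_topology}"
  assumes [measurable]: "f \<in> borel_measurable M" "g \<in> borel_measurable M" "h \<in> borel_measurable M"
  shows "(\<integral>\<^sup>+x. nsq (f x - h x) \<partial>M) \<le> 2 * (\<integral>\<^sup>+x. nsq (f x - g x) \<partial>M) + 2 * (\<integral>\<^sup>+x. nsq (g x - h x) \<partial>M)"
proof -
  have "(\<integral>\<^sup>+x. nsq (f x - h x) \<partial>M) \<le> (\<integral>\<^sup>+x. 2 * nsq (f x - g x) + 2 * nsq (g x - h x) \<partial>M)"
    by (intro nn_integral_mono nsq_triangle)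
  also have "\<dots> = 2 * (\<integral>\<^sup>+x. nsq (f x - g x) \<partial>M) + 2 * (\<integral>\<^sup>+x. nsq (g x - h x) \<partial>M)"
    by (simp add: nn_integral_add nn_integral_cmult)
  finally show ?thesis .
qed

lemma nn_integral_nsq_finite:
  fixes f g :: "'a \<Rightarrow> 'b::{real_normed_vector, second_countable_topology}"
  assumes [measurable]: "f \<in> borel_measurable M" "g \<in> borel_measurable M"
    and "(\<integral>\<^sup>+x. nsq (f x) \<partial>M) < \<infinity>" "(\<integral>\<^sup>+x. nsq (g x) \<partial>M) < \<infinity>"
  shows "(\<integral>\<^sup>+x. nsq (f x - g x) \<partial>M) < \<infinity>"
proof -
  have "(\<integral>\<^sup>+x. nsq (f x - g x) \<partial>M) \<le> 2 * (\<integral>\<^sup>+x. nsq (f x - 0) \<partial>M) + 2 * (\<integral>\<^sup>+x. nsq (0 - g x) \<partial>M)"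
    by (rule nn_integral_nsq_triangle) measurable
  also have "\<dots> = 2 * (\<integral>\<^sup>+x. nsq (f x) \<partial>M) + 2 * (\<integral>\<^sup>+x. nsq (g x) \<partial>M)" by simp
  also have "\<dots> < \<infinity>"
    using assms(3,4) by (simp only: infinity_ennreal_def ennreal_add_less_top ennreal_mult_less_top) simp
  finally show ?thesis .
qed

lemma ennreal_tendsto_zeroI:
  fixes f :: "'a \<Rightarrow> ennreal"
  assumes "\<And>e::real. e > 0 \<Longrightarrow> eventually (\<lambda>x. f x \<le> ennreal e) F"
  shows "(f \<longlongrightarrow> 0) F"
proof (rule order_tendstoI)
  fix a :: ennreal assume "0 < a"
  then obtain b where b: "0 < b" "b < a" using dense by blast
  then have "b < top" using less_top by (meson not_less order_less_le_trans top_greatest)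
  then obtain e where e: "b = ennreal e" "e > 0"
    using b(1) by (metis ennreal_cases ennreal_less_zero_iff less_irrefl)
  show "eventually (\<lambda>x. f x < a) F"
    using assms[OF e(2)] b(2) unfolding e(1) by (auto elim: eventually_mono)
qed auto

lemma ennreal_tendsto_zeroD:
  fixes f :: "'a \<Rightarrow> ennreal"
  assumes "(f \<longlongrightarrow> 0) F" "e > (0::real)"
  shows "eventually (\<lambda>x. f x < ennreal e) F"
  using order_tendstoD(2)[OF assms(1), of "ennreal e"] assms(2) by simp

text \<open>The approximations can be chosen measurable with respect to the \<open>\<sigma>\<close>-algebra of \<open>f\<close>, even if the
  integral is taken over a larger one.\<close>

lemma L2_simple_approximation:
  fixes f :: "'a \<Rightarrow> 'b::{real_normed_vector, second_countable_topology}"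
  assumes f: "f \<in> borel_measurable F" and sub: "space F = space N" "sets F \<subseteq> sets N"
    and fin: "(\<integral>\<^sup>+x. nsq (f x) \<partial>N) < \<infinity>" and e: "e > (0::real)"
  shows "\<exists>s. simple_function F s \<and> (\<forall>x\<in>space N. norm (s x) \<le> 2 * norm (f x)) \<and>
     (\<integral>\<^sup>+x. nsq (f x - s x) \<partial>N) < ennreal e"
proof -
  have subalg: "subalgebra N F" using sub by (simp add: subalgebra_def)
  have fN[measurable]: "f \<in> borel_measurable N" using f by (rule measurable_from_subalg[OF subalg])
  obtain s where s0: "\<forall>i. simple_function F (s i)" "\<forall>x\<in>space F. (\<lambda>i. s i x) \<longlonglongrightarrow> f x"
    "\<forall>i. \<forall>x\<in>space F. dist (s i x) 0 \<le> 2 * dist (f x) 0"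
    using borel_measurable_implies_sequence_metric[OF f, of 0] by blast
  have s: "simple_function F (s i)" "x \<in> space F \<Longrightarrow> (\<lambda>i. s i x) \<longlonglongrightarrow> f x"
    "x \<in> space F \<Longrightarrow> norm (s i x) \<le> 2 * norm (f x)" for i x
    using s0 unfolding dist_0_norm by auto
  have sm[measurable]: "s i \<in> borel_measurable N" for i
    using measurable_from_subalg[OF subalg borel_measurable_simple_function[OF s(1)]] .
  have "(\<lambda>i. \<integral>\<^sup>+x. nsq (f x - s i x) \<partial>N) \<longlonglongrightarrow> (\<integral>\<^sup>+x. 0 \<partial>N)"
  proof (rule nn_integral_dominated_convergence)
    show "AE x in N. nsq (f x - s i x) \<le> 10 * nsq (f x)" for i
    proof (rule AE_I2)
      fix x assume x: "x \<in> space N"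
      have "(norm (s i x))\<^sup>2 \<le> (2 * norm (f x))\<^sup>2" using s(3)[of x i] x sub by (intro power_mono) auto
      then have "nsq (s i x) \<le> ennreal (4 * (norm (f x))\<^sup>2)" by (intro ennreal_leI) (simp add: power_mult_distrib)
      then have "2 * nsq (f x) + 2 * nsq (s i x) \<le> 2 * nsq (f x) + 2 * (4 * nsq (f x))"
        by (intro add_left_mono mult_left_mono) (auto simp: ennreal_mult)
      also have "\<dots> = 10 * nsq (f x)"
        by (simp add: mult.assoc[symmetric] distrib_right[symmetric])
      finally show "nsq (f x - s i x) \<le> 10 * nsq (f x)" using nsq_diff order_trans by blast
    qed
    show "(\<integral>\<^sup>+x. 10 * nsq (f x) \<partial>N) < \<infinity>"
      using fin by (simp add: nn_integral_cmult ennreal_mult_less_top)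
    show "AE x in N. (\<lambda>i. nsq (f x - s i x)) \<longlonglongrightarrow> 0"
    proof (rule AE_I2)
      fix x assume "x \<in> space N"
      then have "(\<lambda>i. f x - s i x) \<longlonglongrightarrow> f x - f x" using s(2)[of x] sub by (intro tendsto_intros) auto
      then have "(\<lambda>i. (norm (f x - s i x))\<^sup>2) \<longlonglongrightarrow> (norm (0::'b))\<^sup>2" by (intro tendsto_intros) simp
      then show "(\<lambda>i. nsq (f x - s i x)) \<longlonglongrightarrow> 0"
        using tendsto_ennrealI by fastforce
    qed
  qed auto
  then have "eventually (\<lambda>i. (\<integral>\<^sup>+x. nsq (f x - s i x) \<partial>N) < ennreal e) sequentially"
    using e by (intro ennreal_tendsto_zeroD) auto
  then obtain i where "(\<integral>\<^sup>+x. nsq (f x - s i x) \<partial>N) < ennreal e"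
    by (auto simp: eventually_sequentially)
  then show ?thesis using s sub by (intro exI[of _ "s i"]) auto
qed

lemma nn_integral_translation:
  fixes f :: "real \<Rightarrow> ennreal"
  assumes "f \<in> borel_measurable borel"
  shows "(\<integral>\<^sup>+u. f (u + r) \<partial>lborel) = (\<integral>\<^sup>+u. f u \<partial>lborel)"
  using nn_integral_real_affine[OF assms, of 1 r] by (simp add: add.commute)

text \<open>Regularity of Lebesgue measure: \<open>E\<close> lies between a compact \<open>K\<close> and an open \<open>U\<close> of almost the
  same measure, and a translation by less than the distance of \<open>K\<close> to the complement of \<open>U\<close> moves
  no point of \<open>K\<close> out of \<open>U\<close>.\<close>

lemma translation_indicator:
  fixes E :: "real set" and e :: real
  assumes E: "E \<in> sets borel" "bounded E" and e: "e > 0"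
  shows "\<exists>d>0. \<forall>r. \<bar>r\<bar> < d \<longrightarrow>
    (\<integral>\<^sup>+u. ennreal \<bar>indicator E (u + r) - indicator E u :: real\<bar> \<partial>lborel) \<le> ennreal e"
proof -
  have EL: "E \<in> sets lebesgue" using E(1) by simp
  have e4: "e / 4 > 0" using e by simp
  obtain K where K: "closed K" "K \<subseteq> E" "E - K \<in> lmeasurable" "emeasure lebesgue (E - K) < ennreal (e / 4)"
    by (rule sets_lebesgue_inner_closed[OF EL e4])
  obtain U where U: "open U" "E \<subseteq> U" "U - E \<in> lmeasurable" "emeasure lebesgue (U - E) < ennreal (e / 4)"
    by (rule sets_lebesgue_outer_open[OF EL e4])
  have [measurable]: "K \<in> sets borel" "U \<in> sets borel" "E \<in> sets borel" using K U E by auto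
  have me: "emeasure lborel (E - K) \<le> ennreal (e / 4)" "emeasure lborel (U - E) \<le> ennreal (e / 4)"
    using K(4) U(4) by simp_all
  have "compact K" using K(1,2) E(2) bounded_subset compact_eq_bounded_closed by blast
  moreover have "closed (- U)" "K \<inter> (- U) = {}" using K(2) U(1,2) by auto
  ultimately obtain d where d: "d > 0" "\<And>x y. x \<in> K \<Longrightarrow> y \<in> - U \<Longrightarrow> d \<le> dist x y"
    using separate_compact_closed[of K "- U"] by blast
  show ?thesis
  proof (intro exI[of _ d] conjI allI impI d(1))
    fix r :: real assume r: "\<bar>r\<bar> < d"
    have pt: "ennreal \<bar>indicator E (u + r) - indicator E u :: real\<bar> \<le>
        (indicator (E - K) (u + r) + indicator (U - E) (u + r)) + (indicator (E - K) u + indicator (U - E) u)" for u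
    proof -
      have "u \<in> U" if "u + r \<in> K" using d(2)[OF that, of u] r by (auto simp: dist_real_def)
      moreover have "u + r \<in> U" if "u \<in> K" using d(2)[OF that, of "u + r"] r by (auto simp: dist_real_def)
      ultimately show ?thesis by (auto split: split_indicator)
    qed
    have "(\<integral>\<^sup>+u. ennreal \<bar>indicator E (u + r) - indicator E u :: real\<bar> \<partial>lborel) \<le>
      (\<integral>\<^sup>+u. (indicator (E - K) (u + r) + indicator (U - E) (u + r)) +
        (indicator (E - K) u + indicator (U - E) u) \<partial>lborel)"
      by (rule nn_integral_mono) (rule pt)
    also have "\<dots> = (\<integral>\<^sup>+u. indicator (E - K) (u + r) + indicator (U - E) (u + r) \<partial>lborel) +
       (\<integral>\<^sup>+u. indicator (E - K) u + indicator (U - E) u \<partial>lborel)"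
      by (rule nn_integral_add) measurable
    also have "(\<integral>\<^sup>+u. indicator (E - K) (u + r) + indicator (U - E) (u + r) \<partial>lborel) =
       (\<integral>\<^sup>+u. indicator (E - K) u + indicator (U - E) u \<partial>lborel)"
      by (rule nn_integral_translation) measurable
    also have "(\<integral>\<^sup>+u. indicator (E - K) u + indicator (U - E) u \<partial>lborel) = emeasure lborel (E - K) + emeasure lborel (U - E)"
      by (simp add: nn_integral_add)
    also have "(emeasure lborel (E - K) + emeasure lborel (U - E)) + (emeasure lborel (E - K) + emeasure lborel (U - E))
      \<le> (ennreal (e / 4) + ennreal (e / 4)) + (ennreal (e / 4) + ennreal (e / 4))"
      by (intro add_mono me)
    also have "\<dots> = ennreal e" using e by (simp add: ennreal_plus[symmetric])
    finally show "(\<integral>\<^sup>+u. ennreal \<bar>indicator E (u + r) - indicator E u :: real\<bar> \<partial>lborel) \<le> ennreal e" .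
  qed
qed

text \<open>Between two points at distance \<open>r\<close> a simple function changes only where the indicator of one of
  its level sets changes, which settles simple functions. The general case follows by approximation, since
  translations preserve the norm.\<close>

lemma translation_continuous:
  fixes f :: "real \<Rightarrow> 'b::{real_normed_vector, second_countable_topology}"
  assumes f[measurable]: "f \<in> borel_measurable borel" and supp: "\<And>u. u \<notin> {0..T} \<Longrightarrow> f u = 0"
    and fin: "(\<integral>\<^sup>+u. nsq (f u) \<partial>lborel) < \<infinity>"
  shows "((\<lambda>r. \<integral>\<^sup>+u. nsq (f (u + r) - f u) \<partial>lborel) \<longlongrightarrow> 0) (at 0)"
proof (rule ennreal_tendsto_zeroI)
  fix e :: real assume e: "e > 0"
  obtain s where s: "simple_function lborel s" "\<And>u. norm (s u) \<le> 2 * norm (f u)"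
    "(\<integral>\<^sup>+u. nsq (f u - s u) \<partial>lborel) < ennreal (e / 16)"
    using L2_simple_approximation[of f lborel lborel "e / 16"] fin e by auto
  have [measurable]: "s \<in> borel_measurable borel" using borel_measurable_simple_function[OF s(1)] by simp
  define V where "V = range s - {0}"
  have V: "finite V" using simple_functionD(1)[OF s(1)] by (simp add: V_def)
  define B where "B = Max (insert 1 (norm ` V))"
  have B: "B \<ge> 1" "\<And>u. norm (s u) \<le> B"
  proof -
    show "B \<ge> 1" unfolding B_def using V by (intro Max_ge) auto
    show "norm (s u) \<le> B" for u
    proof (cases "s u = 0")
      case False
      then have "norm (s u) \<in> insert 1 (norm ` V)" by (auto simp: V_def)
      then show ?thesis unfolding B_def using V by (intro Max_ge) auto
    qed (use \<open>B \<ge> 1\<close> in simp)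
  qed
  define E where "E = (\<lambda>y. s -` {y})"
  have Em[measurable]: "E y \<in> sets borel" for y
    using simple_functionD(2)[OF s(1), of "{y}"] by (simp add: E_def)
  have Eb: "bounded (E y)" if "y \<in> V" for y
  proof (rule bounded_subset)
    have "u \<in> {0..T}" if "u \<in> E y" for u
    proof (rule ccontr)
      assume "u \<notin> {0..T}"
      then have "s u = 0" using supp[of u] s(2)[of u] by simp
      then show False using \<open>y \<in> V\<close> that by (auto simp: V_def E_def)
    qed
    then show "E y \<subseteq> {0..T}" by blast
  qed simp
  define c where "c = real (card V) + 1"
  have c: "c > 0" by (simp add: c_def)
  define e' where "e' = e / (32 * B\<^sup>2 * c)"
  have e': "e' > 0" using e B(1) c by (simp add: e'_def)
  have "\<exists>d>0. \<forall>r. \<bar>r\<bar> < d \<longrightarrow>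
    (\<integral>\<^sup>+u. ennreal \<bar>indicator (E y) (u + r) - indicator (E y) u :: real\<bar> \<partial>lborel) \<le> ennreal e'" if "y \<in> V" for y
    using translation_indicator[OF Em Eb[OF that] e'] .
  then obtain d where d: "\<And>y. y \<in> V \<Longrightarrow> d y > 0" "\<And>y r. y \<in> V \<Longrightarrow> \<bar>r\<bar> < d y \<Longrightarrow>
    (\<integral>\<^sup>+u. ennreal \<bar>indicator (E y) (u + r) - indicator (E y) u :: real\<bar> \<partial>lborel) \<le> ennreal e'"
    by metis
  define \<eta> where "\<eta> = Min (insert 1 (d ` V))"
  have \<eta>: "\<eta> > 0" "\<And>y. y \<in> V \<Longrightarrow> \<eta> \<le> d y" using V d(1) by (auto simp: \<eta>_def)
  have sd: "(\<integral>\<^sup>+u. nsq (s (u + r) - s u) \<partial>lborel) \<le> ennreal (e / 8)" if r: "\<bar>r\<bar> < \<eta>" for r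
  proof -
    have pt: "nsq (s (u + r) - s u) \<le>
        ennreal (4 * B\<^sup>2) * (\<Sum>y\<in>V. ennreal \<bar>indicator (E y) (u + r) - indicator (E y) u :: real\<bar>)" for u
    proof (cases "s (u + r) = s u")
      case False
      \<comment> \<open>one of the two distinct values is not \<open>0\<close>, and its level set contains only one of the two points\<close>
      then obtain y where y: "y \<in> V" "\<bar>indicator (E y) (u + r) - indicator (E y) u :: real\<bar> = 1"
      proof (cases "s u = 0")
        case True
        show thesis by (rule that[of "s (u + r)"]) (use True False in \<open>auto simp: V_def E_def\<close>)
      next
        case nz: False
        show thesis by (rule that[of "s u"]) (use nz False in \<open>auto simp: V_def E_def\<close>)
      qed
      have "norm (s (u + r) - s u) \<le> 2 * B"
        using norm_triangle_ineq4[of "s (u + r)" "s u"] B(2)[of "u + r"] B(2)[of u] by linarith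
      then have "(norm (s (u + r) - s u))\<^sup>2 \<le> (2 * B)\<^sup>2" by (rule power_mono) simp
      then have "nsq (s (u + r) - s u) \<le> ennreal (4 * B\<^sup>2) * 1"
        by (simp add: ennreal_leI power_mult_distrib)
      also have "1 \<le> (\<Sum>y\<in>V. ennreal \<bar>indicator (E y) (u + r) - indicator (E y) u :: real\<bar>)"
        using member_le_sum[OF y(1), of "\<lambda>y. ennreal \<bar>indicator (E y) (u + r) - indicator (E y) u :: real\<bar>"] V y(2)
        by simp
      finally show ?thesis by (simp add: mult_left_mono)
    qed simp
    have "(\<integral>\<^sup>+u. nsq (s (u + r) - s u) \<partial>lborel) \<le> (\<integral>\<^sup>+u. ennreal (4 * B\<^sup>2) *
        (\<Sum>y\<in>V. ennreal \<bar>indicator (E y) (u + r) - indicator (E y) u :: real\<bar>) \<partial>lborel)"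
      by (rule nn_integral_mono) (rule pt)
    also have "\<dots> = ennreal (4 * B\<^sup>2) *
        (\<Sum>y\<in>V. \<integral>\<^sup>+u. ennreal \<bar>indicator (E y) (u + r) - indicator (E y) u :: real\<bar> \<partial>lborel)"
      by (simp del: sum_ennreal add: nn_integral_cmult nn_integral_sum)
    also have "\<dots> \<le> ennreal (4 * B\<^sup>2) * (\<Sum>y\<in>V. ennreal e')"
      using r \<eta>(2) by (intro mult_left_mono sum_mono d(2)) force+
    also have "\<dots> = ennreal (4 * B\<^sup>2 * (card V * e'))"
      using e' by (subst ennreal_mult) (auto simp: ennreal_of_nat_eq_real_of_nat ennreal_mult)
    also have "\<dots> \<le> ennreal (e / 8)"
    proof (rule ennreal_leI)
      have "4 * B\<^sup>2 * (card V * e') \<le> 4 * B\<^sup>2 * (c * e')"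
        using e' unfolding c_def by (intro mult_left_mono mult_right_mono) auto
      also have "\<dots> = e / 8" using B(1) c by (simp add: e'_def field_simps)
      finally show "4 * B\<^sup>2 * (card V * e') \<le> e / 8" .
    qed
    finally show ?thesis .
  qed
  have "(\<integral>\<^sup>+u. nsq (f (u + r) - f u) \<partial>lborel) \<le> ennreal e" if r: "\<bar>r\<bar> < \<eta>" for r
  proof -
    have 1: "(\<integral>\<^sup>+u. nsq (f (u + r) - s (u + r)) \<partial>lborel) \<le> ennreal (e / 16)"
      using s(3) nn_integral_translation[of "\<lambda>u. nsq (f u - s u)" r] by simp
    have 2: "(\<integral>\<^sup>+u. nsq (s u - f u) \<partial>lborel) \<le> ennreal (e / 16)"
      using s(3) by (simp add: norm_minus_commute)
    have "(\<integral>\<^sup>+u. nsq (s (u + r) - f u) \<partial>lborel) \<le>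
        2 * (\<integral>\<^sup>+u. nsq (s (u + r) - s u) \<partial>lborel) + 2 * (\<integral>\<^sup>+u. nsq (s u - f u) \<partial>lborel)"
      by (rule nn_integral_nsq_triangle) measurable
    also have "\<dots> \<le> 2 * ennreal (e / 8) + 2 * ennreal (e / 16)"
      using sd[OF r] 2 by (intro add_mono mult_left_mono) auto
    finally have 3: "(\<integral>\<^sup>+u. nsq (s (u + r) - f u) \<partial>lborel) \<le> 2 * ennreal (e / 8) + 2 * ennreal (e / 16)" .
    have "(\<integral>\<^sup>+u. nsq (f (u + r) - f u) \<partial>lborel) \<le>
        2 * (\<integral>\<^sup>+u. nsq (f (u + r) - s (u + r)) \<partial>lborel) + 2 * (\<integral>\<^sup>+u. nsq (s (u + r) - f u) \<partial>lborel)"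
      by (rule nn_integral_nsq_triangle) measurable
    also have "\<dots> \<le> 2 * ennreal (e / 16) + 2 * (2 * ennreal (e / 8) + 2 * ennreal (e / 16))"
      using 1 3 by (intro add_mono mult_left_mono) auto
    also have "\<dots> = ennreal (2 * (e / 16) + 2 * (2 * (e / 8) + 2 * (e / 16)))"
      using e by (simp only: ennreal_plus ennreal_mult ennreal_numeral zero_le_numeral
         less_imp_le add_nonneg_nonneg mult_nonneg_nonneg divide_nonneg_nonneg)
    also have "\<dots> \<le> ennreal e" using e by (intro ennreal_leI) (simp add: field_simps)
    finally show ?thesis .
  qed
  then show "eventually (\<lambda>r. (\<integral>\<^sup>+u. nsq (f (u + r) - f u) \<partial>lborel) \<le> ennreal e) (at 0)"
    unfolding eventually_at using \<eta>(1) by (intro exI[of _ \<eta>]) (auto simp: dist_real_def)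
qed

section \<open>Adapted step processes are dense\<close>

text \<open>Dominated convergence over the sample space, applied to the preceding lemma for each path.
  It needs sequences \<open>X i\<close> of shifts, and the bound comes from the invariance of the
  norm under translations.\<close>

lemma translation_continuous_mean:
  fixes G :: "real \<times> 'a \<Rightarrow> 'b::{real_normed_vector, second_countable_topology}"
  assumes M: "sigma_finite_measure M" and G[measurable]: "G \<in> borel_measurable (borel \<Otimes>\<^sub>M M)"
    and supp: "\<And>u \<omega>. u \<notin> {0..T} \<Longrightarrow> G (u, \<omega>) = 0"
    and fin: "(\<integral>\<^sup>+u. \<integral>\<^sup>+\<omega>. nsq (G (u, \<omega>)) \<partial>M \<partial>lborel) < \<infinity>"
  shows "((\<lambda>r. \<integral>\<^sup>+u. \<integral>\<^sup>+\<omega>. nsq (G (u + r, \<omega>) - G (u, \<omega>)) \<partial>M \<partial>lborel) \<longlongrightarrow> 0) (at 0)"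
proof -
  interpret M: sigma_finite_measure M by fact
  interpret pair_sigma_finite lborel M by unfold_locales
  have swap: "(\<integral>\<^sup>+u. \<integral>\<^sup>+\<omega>. f u \<omega> \<partial>M \<partial>lborel) = (\<integral>\<^sup>+\<omega>. \<integral>\<^sup>+u. f u \<omega> \<partial>lborel \<partial>M)"
    if "case_prod f \<in> borel_measurable (borel \<Otimes>\<^sub>M M)" for f :: "real \<Rightarrow> 'a \<Rightarrow> ennreal"
    using that by (intro Fubini'[symmetric]) simp
  have [measurable]: "(\<lambda>\<omega>. \<integral>\<^sup>+u. nsq (G (u + r, \<omega>) - G (u, \<omega>)) \<partial>lborel) \<in> borel_measurable M" for r
    by measurable
  have fin': "(\<integral>\<^sup>+\<omega>. \<integral>\<^sup>+u. nsq (G (u, \<omega>)) \<partial>lborel \<partial>M) < \<infinity>"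
    using fin by (subst (asm) swap) auto
  have "(\<lambda>i. \<integral>\<^sup>+u. \<integral>\<^sup>+\<omega>. nsq (G (u + X i, \<omega>) - G (u, \<omega>)) \<partial>M \<partial>lborel) \<longlonglongrightarrow> 0"
    if X: "\<And>i. X i \<noteq> 0" "X \<longlonglongrightarrow> 0" for X :: "nat \<Rightarrow> real"
  proof -
    have "(\<lambda>i. \<integral>\<^sup>+\<omega>. \<integral>\<^sup>+u. nsq (G (u + X i, \<omega>) - G (u, \<omega>)) \<partial>lborel \<partial>M) \<longlonglongrightarrow> (\<integral>\<^sup>+\<omega>. 0 \<partial>M)"
    proof (rule nn_integral_dominated_convergence)
      show "(\<integral>\<^sup>+\<omega>. 4 * (\<integral>\<^sup>+u. nsq (G (u, \<omega>)) \<partial>lborel) \<partial>M) < \<infinity>"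
        using fin' by (simp add: nn_integral_cmult ennreal_mult_less_top)
      show "AE \<omega> in M. (\<integral>\<^sup>+u. nsq (G (u + X i, \<omega>) - G (u, \<omega>)) \<partial>lborel) \<le> 4 * (\<integral>\<^sup>+u. nsq (G (u, \<omega>)) \<partial>lborel)" for i
      proof (rule AE_I2)
        fix \<omega> assume [measurable]: "\<omega> \<in> space M"
        have "(\<integral>\<^sup>+u. nsq (G (u + X i, \<omega>) - G (u, \<omega>)) \<partial>lborel) \<le>
            2 * (\<integral>\<^sup>+u. nsq (G (u + X i, \<omega>) - 0) \<partial>lborel) + 2 * (\<integral>\<^sup>+u. nsq (0 - G (u, \<omega>)) \<partial>lborel)"
          by (rule nn_integral_nsq_triangle) measurable
        also have "(\<integral>\<^sup>+u. nsq (G (u + X i, \<omega>) - 0) \<partial>lborel) = (\<integral>\<^sup>+u. nsq (G (u, \<omega>) - 0) \<partial>lborel)"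
          by (rule nn_integral_translation) measurable
        finally show "(\<integral>\<^sup>+u. nsq (G (u + X i, \<omega>) - G (u, \<omega>)) \<partial>lborel) \<le> 4 * (\<integral>\<^sup>+u. nsq (G (u, \<omega>)) \<partial>lborel)"
          by (simp add: distrib_right[symmetric])
      qed
      have "AE \<omega> in M. (\<integral>\<^sup>+u. nsq (G (u, \<omega>)) \<partial>lborel) \<noteq> \<infinity>"
        by (rule nn_integral_PInf_AE) (use fin' in auto)
      then show "AE \<omega> in M. (\<lambda>i. \<integral>\<^sup>+u. nsq (G (u + X i, \<omega>) - G (u, \<omega>)) \<partial>lborel) \<longlonglongrightarrow> 0"
      proof (rule AE_mp[OF _ AE_I2], intro impI)
        fix \<omega> assume [measurable]: "\<omega> \<in> space M" and "(\<integral>\<^sup>+u. nsq (G (u, \<omega>)) \<partial>lborel) \<noteq> \<infinity>"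
        then have "((\<lambda>r. \<integral>\<^sup>+u. nsq (G (u + r, \<omega>) - G (u, \<omega>)) \<partial>lborel) \<longlongrightarrow> 0) (at 0)"
          using supp by (intro translation_continuous[where T = T]) (auto simp: less_top)
        then show "(\<lambda>i. \<integral>\<^sup>+u. nsq (G (u + X i, \<omega>) - G (u, \<omega>)) \<partial>lborel) \<longlonglongrightarrow> 0"
          unfolding tendsto_at_iff_sequentially using X by (auto simp: o_def)
      qed
    qed auto
    then show ?thesis by (subst swap) auto
  qed
  then show ?thesis unfolding tendsto_at_iff_sequentially by (auto simp: o_def)
qed

text \<open>The points \<open>s + (j - 1) * d\<close>, for \<open>s\<close> in \<open>(0, d)\<close> and for all \<open>j\<close>, cover every
  point of the line at most once. Hence the sum over \<open>j\<close>, integrated over \<open>s\<close>, is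
  an integral over the line.\<close>

lemma nn_integral_shifted_grid:
  fixes F :: "real \<Rightarrow> ennreal" and d :: real
  assumes [measurable]: "F \<in> borel_measurable borel" and d: "d > 0"
  shows "(\<integral>\<^sup>+s. indicator {0<..<d} s * (\<Sum>j\<le>N. F (s + (real j - 1) * d)) \<partial>lborel) \<le> (\<integral>\<^sup>+u. F u \<partial>lborel)"
proof -
  have "(\<integral>\<^sup>+s. indicator {0<..<d} s * (\<Sum>j\<le>N. F (s + (real j - 1) * d)) \<partial>lborel) =
      (\<Sum>j\<le>N. \<integral>\<^sup>+s. indicator {0<..<d} s * F (s + (real j - 1) * d) \<partial>lborel)"
    unfolding sum_distrib_left by (rule nn_integral_sum) measurable
  also have "\<dots> = (\<Sum>j\<le>N. \<integral>\<^sup>+u. indicator {0<..<d} (u - (real j - 1) * d) * F u \<partial>lborel)"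
  proof (rule sum.cong[OF refl])
    fix j
    show "(\<integral>\<^sup>+s. indicator {0<..<d} s * F (s + (real j - 1) * d) \<partial>lborel) =
        (\<integral>\<^sup>+u. indicator {0<..<d} (u - (real j - 1) * d) * F u \<partial>lborel)"
      using nn_integral_translation[of "\<lambda>u. indicator {0<..<d} (u - (real j - 1) * d) * F u" "(real j - 1) * d"]
      by simp
  qed
  also have "\<dots> = (\<integral>\<^sup>+u. (\<Sum>j\<le>N. indicator {0<..<d} (u - (real j - 1) * d)) * F u \<partial>lborel)"
    unfolding sum_distrib_right by (rule nn_integral_sum[symmetric]) measurable
  also have "\<dots> \<le> (\<integral>\<^sup>+u. 1 * F u \<partial>lborel)"
  proof (intro nn_integral_mono mult_right_mono)
    fix u
    have uniq: "i = j" if "u - (real i - 1) * d \<in> {0<..<d}" "u - (real j - 1) * d \<in> {0<..<d}" for i j :: nat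
    proof -
      have "(real i - real j) * d < 1 * d" "(real j - real i) * d < 1 * d"
        using that by (auto simp: algebra_simps)
      then have "real i - real j < 1" "real j - real i < 1"
        using d mult_less_cancel_right_pos by blast+
      then show ?thesis by linarith
    qed
    show "(\<Sum>j\<le>N. indicator {0<..<d} (u - (real j - 1) * d)) \<le> (1 :: ennreal)"
    proof (cases "\<exists>i\<le>N. u - (real i - 1) * d \<in> {0<..<d}")
      case True
      then obtain i where i: "i \<le> N" "u - (real i - 1) * d \<in> {0<..<d}" by blast
      have "(\<Sum>j\<le>N. indicator {0<..<d} (u - (real j - 1) * d)) = (\<Sum>j\<le>N. if j = i then 1 else 0 :: ennreal)"
        by (rule sum.cong[OF refl]) (use uniq i in \<open>auto simp: indicator_def\<close>)
      then show ?thesis using i by simp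
    next
      case False
      then have "(\<Sum>j\<le>N. indicator {0<..<d} (u - (real j - 1) * d)) = (0::ennreal)"
        by (intro sum.neutral) (auto simp: indicator_def)
      then show ?thesis by simp
    qed
  qed auto
  finally show ?thesis by simp
qed

text \<open>By the preceding lemma the mean over \<open>s\<close> of the sum of \<open>F\<close> over the grid is at most \<open>e\<close>, so
  the sum cannot exceed \<open>2 * e\<close> for almost all \<open>s\<close>; and for almost all \<open>s\<close> the sum of \<open>m\<close> is finite.\<close>

lemma good_shift_exists:
  fixes F m :: "real \<Rightarrow> ennreal" and d e :: real
  assumes [measurable]: "F \<in> borel_measurable borel" "m \<in> borel_measurable borel"
    and d: "d > 0" and e: "e > 0"
    and F: "(\<integral>\<^sup>+u. F u \<partial>lborel) \<le> ennreal (d * e)" and m: "(\<integral>\<^sup>+u. m u \<partial>lborel) < \<infinity>"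
  shows "\<exists>s\<in>{0<..<d}. (\<Sum>j\<le>N. F (s + (real j - 1) * d)) \<le> ennreal (2 * e) \<and>
    (\<forall>j\<le>N. m (s + (real j - 1) * d) < \<infinity>)"
proof (rule ccontr)
  assume contra: "\<not> ?thesis"
  have "(\<integral>\<^sup>+s. indicator {0<..<d} s * (\<Sum>j\<le>N. m (s + (real j - 1) * d)) \<partial>lborel) \<noteq> \<infinity>"
    by (rule less_imp_neq) (use le_less_trans[OF nn_integral_shifted_grid[OF assms(2) d] m] in blast)
  then have "AE s in lborel. indicator {0<..<d} s * (\<Sum>j\<le>N. m (s + (real j - 1) * d)) \<noteq> \<infinity>"
    by (rule nn_integral_PInf_AE[rotated]) measurable
  then have ae: "AE s in lborel. ennreal (2 * e) * indicator {0<..<d} s \<le>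
      indicator {0<..<d} s * (\<Sum>j\<le>N. F (s + (real j - 1) * d))"
  proof eventually_elim
    case (elim s)
    show ?case
    proof (cases "s \<in> {0<..<d}")
      case True
      then have "(\<Sum>j\<le>N. m (s + (real j - 1) * d)) < \<infinity>" using elim by (simp add: less_top)
      then have "\<forall>j\<le>N. m (s + (real j - 1) * d) < \<infinity>" by simp
      then have "\<not> (\<Sum>j\<le>N. F (s + (real j - 1) * d)) \<le> ennreal (2 * e)" using contra True by blast
      then show ?thesis using True by simp
    qed simp
  qed
  have "ennreal (2 * e * d) = (\<integral>\<^sup>+s. ennreal (2 * e) * indicator {0<..<d} s \<partial>lborel)"
    using d e by (simp add: nn_integral_cmult_indicator ennreal_mult[symmetric])
  also have "\<dots> \<le> (\<integral>\<^sup>+s. indicator {0<..<d} s * (\<Sum>j\<le>N. F (s + (real j - 1) * d)) \<partial>lborel)"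
    by (rule nn_integral_mono_AE) (rule ae)
  also have "\<dots> \<le> (\<integral>\<^sup>+u. F u \<partial>lborel)" by (rule nn_integral_shifted_grid) (use d in auto)
  also have "\<dots> \<le> ennreal (d * e)" by (rule F)
  finally show False using d e by (simp add: ennreal_le_iff mult.commute)
qed

abbreviation time_prod :: "real \<Rightarrow> 'a measure \<Rightarrow> (real \<times> 'a) measure" where
  "time_prod T M \<equiv> time_measure T \<Otimes>\<^sub>M M"

lemma space_time_product [simp]: "space (time_prod T M) = {0..T} \<times> space M"
  by (simp add: space_pair_measure space_restrict_space)

lemma finite_measure_time: "finite_measure (time_measure T)"
proof (rule finite_measureI)
  have "emeasure (time_measure T) {0..T} \<noteq> \<infinity>"
    by (subst emeasure_restrict_space) (simp_all add: emeasure_lborel_Icc_eq)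
  then show "emeasure (time_measure T) (space (time_measure T)) \<noteq> \<infinity>"
    by (simp add: space_restrict_space)
qed

lemma sigma_finite_time: "sigma_finite_measure (time_measure T)"
  using finite_measure_time by (simp add: finite_measure_def)

lemma adapted_sets_subset: "adapted_sets M T Fil \<subseteq> Pow ({0..T} \<times> space M)"
proof
  fix B assume "B \<in> adapted_sets M T Fil"
  then have "B \<in> sets (time_prod T M)" unfolding adapted_sets_def by blast
  from sets.sets_into_space[OF this] show "B \<in> Pow ({0..T} \<times> space M)" by simp
qed

lemma adapted_section_measurable:
  assumes g: "g \<in> borel_measurable (adapted_algebra M T Fil)" and u: "u \<in> {0..T}"
    and sp: "space (Fil u) = space M"
  shows "(\<lambda>\<omega>. g (u, \<omega>)) \<in> borel_measurable (Fil u)"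
proof -
  have "(\<lambda>\<omega>. (u, \<omega>)) \<in> measurable (Fil u) (adapted_algebra M T Fil)"
    unfolding adapted_algebra_def
  proof (rule measurable_measure_of)
    show "adapted_sets M T Fil \<subseteq> Pow ({0..T} \<times> space M)"
      by (rule adapted_sets_subset)
    show "(\<lambda>\<omega>. (u, \<omega>)) \<in> space (Fil u) \<rightarrow> {0..T} \<times> space M" using u sp by auto
  next
    fix B assume "B \<in> adapted_sets M T Fil"
    then have "(\<lambda>\<omega>. indicator B (u, \<omega>) :: real) \<in> borel_measurable (Fil u)"
      using u by (auto simp: adapted_sets_def)
    then have "(\<lambda>\<omega>. indicator B (u, \<omega>) :: real) -` {1} \<inter> space (Fil u) \<in> sets (Fil u)"
      by (rule measurable_sets) simp
    moreover have "(\<lambda>\<omega>. indicator B (u, \<omega>) :: real) -` {1} = (\<lambda>\<omega>. (u, \<omega>)) -` B"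
      by (auto simp: indicator_def split: if_splits)
    ultimately show "(\<lambda>\<omega>. (u, \<omega>)) -` B \<inter> space (Fil u) \<in> sets (Fil u)" by simp
  qed
  from measurable_compose[OF this g] show ?thesis by simp
qed

lemma adapted_product_measurable:
  assumes g: "g \<in> borel_measurable (adapted_algebra M T Fil)"
  shows "g \<in> borel_measurable (time_prod T M)"
proof -
  have "(\<lambda>p. p) \<in> measurable (time_prod T M) (adapted_algebra M T Fil)"
    unfolding adapted_algebra_def
  proof (rule measurable_measure_of)
    show "adapted_sets M T Fil \<subseteq> Pow ({0..T} \<times> space M)"
      by (rule adapted_sets_subset)
  next
    fix B assume "B \<in> adapted_sets M T Fil"
    then have "B \<in> sets (time_prod T M)" by (simp add: adapted_sets_def)
    then show "(\<lambda>p. p) -` B \<inter> space (time_prod T M) \<in> sets (time_prod T M)"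
      by (simp del: space_time_product add: sets.Int_space_eq2)
  qed simp
  from measurable_compose[OF this g] show ?thesis by simp
qed

lemma nn_integral_time_product:
  assumes M: "sigma_finite_measure M" and f[measurable]: "f \<in> borel_measurable (time_prod T M)"
  shows "(\<integral>\<^sup>+p. f p \<partial>time_prod T M) =
    (\<integral>\<^sup>+u. (\<integral>\<^sup>+\<omega>. f (u, \<omega>) \<partial>M) * indicator {0..T} u \<partial>lborel)"
proof -
  interpret sigma_finite_measure M by fact
  show ?thesis by (simp add: nn_integral_fst[symmetric] nn_integral_restrict_space)
qed

lemma extend_time_measurable:
  fixes g :: "real \<times> 'a \<Rightarrow> 'b::{real_normed_vector, second_countable_topology}"
  assumes T: "T > 0" and g[measurable]: "g \<in> borel_measurable (time_prod T M)"
  shows "(\<lambda>p. if fst p \<in> {0..T} then g p else 0) \<in> borel_measurable (borel \<Otimes>\<^sub>M M)"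
proof -
  \<comment> \<open>projecting the time to \<open>[0,T]\<close> makes the extension a composition of measurable maps\<close>
  have [measurable]: "(\<lambda>u. max 0 (min T u)) \<in> measurable borel (time_measure T)"
    using T by (intro measurable_restrict_space2) auto
  have "(\<lambda>p. if fst p \<in> {0..T} then g p else 0) =
      (\<lambda>p. indicator {0..T} (fst p) *\<^sub>R g (max 0 (min T (fst p)), snd p))"
    by (auto simp: fun_eq_iff indicator_def)
  also have "\<dots> \<in> borel_measurable (borel \<Otimes>\<^sub>M M)" by measurable
  finally show ?thesis .
qed

lemma grid_in_interval:
  fixes t :: "nat \<Rightarrow> real"
  assumes "0 \<le> t 0" "\<forall>i\<in>{1..n}. t (i - 1) < t i" "t n \<le> T" "i \<le> n"
  shows "t i \<in> {0..T}"
proof -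
  have step: "t k \<le> t (Suc k)" if "k < n" for k
    using assms(2)[rule_format, of "Suc k"] that by simp
  have "t 0 \<le> t i" using assms(4)
  proof (induction i)
    case (Suc i) then show ?case using step[of i] by simp
  qed simp
  moreover have "t i \<le> t n" using assms(4)
  proof (induction rule: inc_induct)
    case (step k) then show ?case using \<open>\<And>k. k < n \<Longrightarrow> t k \<le> t (Suc k)\<close>[of k] by simp
  qed simp
  ultimately show ?thesis using assms(1,3) by auto
qed

lemma adapted_step_measurableI:
  fixes \<phi> :: "real \<times> 'a \<Rightarrow> 'b::{real_normed_vector, second_countable_topology}"
  assumes \<phi>: "\<phi> \<in> adapted_step T Fil"
    and start: "\<And>A. A \<in> sets (Fil 0) \<Longrightarrow> {0} \<times> A \<in> sets N"
    and rect: "\<And>a b D. 0 \<le> a \<Longrightarrow> a < b \<Longrightarrow> b \<le> T \<Longrightarrow> D \<in> sets (Fil a) \<Longrightarrow> {a<..b} \<times> D \<in> sets N"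
  shows "\<phi> \<in> borel_measurable N"
proof -
  obtain n m :: nat and t :: "nat \<Rightarrow> real" and A D e0 and e :: "nat \<Rightarrow> nat \<Rightarrow> 'b" where
    t: "0 \<le> t 0" "\<forall>i\<in>{1..n}. t (i - 1) < t i" "t n \<le> T" and A: "A \<in> sets (Fil 0)" and
    D: "\<forall>i\<in>{1..n}. (\<forall>j\<in>{1..m}. D j i \<in> sets (Fil (t (i - 1)))) \<and> disjoint_family_on (\<lambda>j. D j i) {1..m}" and
    eq: "\<phi> = (\<lambda>p. indicator ({0} \<times> A) p *\<^sub>R e0 +
               (\<Sum>i=1..n. \<Sum>j=1..m. indicator ({t (i - 1)<..t i} \<times> D j i) p *\<^sub>R e j i))"
    using \<phi> unfolding adapted_step_def by blast
  have "{t (i - 1)<..t i} \<times> D j i \<in> sets N" if "i \<in> {1..n}" "j \<in> {1..m}" for i j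
    using grid_in_interval[OF t, of "i - 1"] grid_in_interval[OF t, of i] t(2) D that
    by (intro rect) auto
  then show ?thesis unfolding eq using start[OF A]
    by (intro borel_measurable_add borel_measurable_sum borel_measurable_scaleR borel_measurable_const
        borel_measurable_indicator) auto
qed

lemma sets_time_measure: "S \<in> sets borel \<Longrightarrow> S \<subseteq> {0..T} \<Longrightarrow> S \<in> sets (time_measure T)"
  by (simp add: sets_restrict_space_iff)

lemma adapted_step_product_measurable:
  fixes \<phi> :: "real \<times> 'a \<Rightarrow> 'b::{real_normed_vector, second_countable_topology}"
  assumes \<phi>: "\<phi> \<in> adapted_step T Fil" and T: "T > 0"
    and Fil: "\<And>u. u \<in> {0..T} \<Longrightarrow> sets (Fil u) \<subseteq> sets M"
  shows "\<phi> \<in> borel_measurable (time_prod T M)"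
proof (rule adapted_step_measurableI[OF \<phi>])
  fix A assume "A \<in> sets (Fil 0)"
  then show "{0} \<times> A \<in> sets (time_prod T M)"
    using Fil[of 0] T by (intro pair_measureI sets_time_measure) auto
next
  fix a b :: real and D assume "0 \<le> a" "a < b" "b \<le> T" "D \<in> sets (Fil a)"
  then show "{a<..b} \<times> D \<in> sets (time_prod T M)"
    using Fil[of a] by (intro pair_measureI sets_time_measure) auto
qed

text \<open>An event \<open>D\<close> known at time \<open>a\<close> is known at all later times, so \<open>S \<times> D\<close> is adapted as soon as \<open>S\<close>
  contains no time before \<open>a\<close>.\<close>

lemma adapted_step_adapted_measurable:
  fixes \<phi> :: "real \<times> 'a \<Rightarrow> 'b::{real_normed_vector, second_countable_topology}"
  assumes \<phi>: "\<phi> \<in> adapted_step T Fil" and T: "T > 0"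
    and Fil: "\<And>u. u \<in> {0..T} \<Longrightarrow> sets (Fil u) \<subseteq> sets M"
    and mono: "\<And>u v. 0 \<le> u \<Longrightarrow> u \<le> v \<Longrightarrow> v \<le> T \<Longrightarrow> sets (Fil u) \<subseteq> sets (Fil v)"
  shows "\<phi> \<in> borel_measurable (adapted_algebra M T Fil)"
proof -
  have adaptedI: "S \<times> D \<in> sets (adapted_algebra M T Fil)"
    if S: "S \<in> sets (time_measure T)" "S \<subseteq> {a..}" and a: "0 \<le> a" "a \<le> T" and D: "D \<in> sets (Fil a)" for S D a
  proof -
    have "S \<subseteq> {0..T}" using sets.sets_into_space[OF S(1)] by (simp add: space_restrict_space)
    have "(\<lambda>\<omega>. indicator (S \<times> D) (u, \<omega>) :: real) \<in> borel_measurable (Fil u)" if u: "u \<in> {0..T}" for u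
    proof (cases "u \<in> S")
      case True
      then have "D \<in> sets (Fil u)" using mono[of a u] S(2) a u D by auto
      then show ?thesis using True by (simp add: indicator_times)
    qed (simp add: indicator_times)
    moreover have "S \<times> D \<in> sets (time_prod T M)" using S D Fil[of a] a by (intro pair_measureI) auto
    ultimately have "S \<times> D \<in> adapted_sets M T Fil" unfolding adapted_sets_def by blast
    then show ?thesis
      unfolding adapted_algebra_def sets_measure_of[OF adapted_sets_subset] by (rule sigma_sets.Basic)
  qed
  show ?thesis
  proof (rule adapted_step_measurableI[OF \<phi>])
    fix A assume "A \<in> sets (Fil 0)"
    then show "{0} \<times> A \<in> sets (adapted_algebra M T Fil)"
      using T by (intro adaptedI[of _ 0] sets_time_measure) auto
  next
    fix a b :: real and D assume "0 \<le> a" "a < b" "b \<le> T" "D \<in> sets (Fil a)"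
    then show "{a<..b} \<times> D \<in> sets (adapted_algebra M T Fil)"
      by (intro adaptedI[of _ a] sets_time_measure) auto
  qed
qed

lemma adapted_step_bounded:
  fixes \<phi> :: "real \<times> 'a \<Rightarrow> 'b::real_normed_vector"
  assumes "\<phi> \<in> adapted_step T Fil"
  shows "\<exists>B. \<forall>p. norm (\<phi> p) \<le> B"
proof -
  obtain n m :: nat and t :: "nat \<Rightarrow> real" and A D e0 and e :: "nat \<Rightarrow> nat \<Rightarrow> 'b" where
    eq: "\<phi> = (\<lambda>p. indicator ({0} \<times> A) p *\<^sub>R e0 +
               (\<Sum>i=1..n. \<Sum>j=1..m. indicator ({t (i - 1)<..t i} \<times> D j i) p *\<^sub>R e j i))"
    using assms unfolding adapted_step_def by blast
  have "norm (\<phi> p) \<le> norm e0 + (\<Sum>i=1..n. \<Sum>j=1..m. norm (e j i))" for p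
    unfolding eq
  proof (intro order_trans[OF norm_triangle_ineq] add_mono order_trans[OF norm_sum] sum_mono)
  qed (auto simp: indicator_def)
  then show ?thesis by blast
qed

text \<open>The section at \<open>\<omega>\<close> depends only on which of the finitely many events \<open>A\<close>, \<open>D j i\<close> contain
  \<open>\<omega>\<close>. Hence every function of the section, in particular the operator that it represents, is a
  simple function of \<open>\<omega>\<close>.\<close>

lemma adapted_step_finitely_many_sections:
  fixes \<phi> :: "real \<times> 'a \<Rightarrow> 'b::real_normed_vector"
  assumes "\<phi> \<in> adapted_step T Fil" and T: "T > 0"
    and Fil: "\<And>u. u \<in> {0..T} \<Longrightarrow> sets (Fil u) \<subseteq> sets M"
  shows "simple_function M (\<lambda>\<omega> u. \<phi> (u, \<omega>))"
proof -
  obtain n m :: nat and t :: "nat \<Rightarrow> real" and A D e0 and e :: "nat \<Rightarrow> nat \<Rightarrow> 'b" where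
    t: "0 \<le> t 0" "\<forall>i\<in>{1..n}. t (i - 1) < t i" "t n \<le> T" and A: "A \<in> sets (Fil 0)" and
    D: "\<forall>i\<in>{1..n}. (\<forall>j\<in>{1..m}. D j i \<in> sets (Fil (t (i - 1)))) \<and> disjoint_family_on (\<lambda>j. D j i) {1..m}" and
    eq: "\<phi> = (\<lambda>p. indicator ({0} \<times> A) p *\<^sub>R e0 +
               (\<Sum>i=1..n. \<Sum>j=1..m. indicator ({t (i - 1)<..t i} \<times> D j i) p *\<^sub>R e j i))"
    using assms(1) unfolding adapted_step_def by blast
  define K where "K = {1..m} \<times> {1..n}"
  have K: "finite K" by (simp add: K_def)
  have DM: "D j i \<in> sets M" if "(j, i) \<in> K" for j i
  proof -
    have ij: "i \<in> {1..n}" "j \<in> {1..m}" using that by (auto simp: K_def)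
    then have "D j i \<in> sets (Fil (t (i - 1)))" using D by blast
    moreover have "i - 1 \<le> n" using ij by auto
    ultimately show ?thesis using Fil[OF grid_in_interval[OF t]] by blast
  qed
  have AM: "A \<in> sets M" using A Fil[of 0] T by auto
  define E where "E = (\<lambda>k. D (fst k) (snd k))"
  define code where "code = (\<lambda>\<omega>. (\<omega> \<in> A, {k \<in> K. \<omega> \<in> E k}))"
  define dec where "dec = (\<lambda>(a, k) u. (if u = 0 \<and> a then e0 else 0) +
     (\<Sum>i=1..n. \<Sum>j=1..m. (if u \<in> {t (i - 1)<..t i} \<and> (j, i) \<in> k then e j i else 0)))"
  have "simple_function M code"
  proof -
    have "simple_function M (\<lambda>\<omega>. \<omega> \<in> A)"
    proof -
      have "(\<lambda>x::real. x = 1) \<circ> indicator A = (\<lambda>\<omega>. \<omega> \<in> A)" by (auto simp: fun_eq_iff indicator_def)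
      then show ?thesis
        using simple_function_compose[OF simple_function_indicator[OF AM], of "\<lambda>x::real. x = 1"] by simp
    qed
    moreover have "simple_function M (\<lambda>\<omega>. {k \<in> K. \<omega> \<in> E k})"
      unfolding simple_function_def
    proof (intro conjI ballI)
      show "finite ((\<lambda>\<omega>. {k \<in> K. \<omega> \<in> E k}) ` space M)"
        by (rule finite_subset[of _ "Pow K"]) (use K in auto)
      fix J assume "J \<in> (\<lambda>\<omega>. {k \<in> K. \<omega> \<in> E k}) ` space M"
      then have J: "J \<subseteq> K" by auto
      have "(\<lambda>\<omega>. {k \<in> K. \<omega> \<in> E k}) -` {J} \<inter> space M =
        {\<omega> \<in> space M. \<forall>k\<in>K. \<omega> \<in> E k \<longleftrightarrow> k \<in> J}"
        using J by blast
      also have "\<dots> \<in> sets M"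
      proof (rule sets.sets_Collect_finite_All[OF _ K])
        fix k assume "k \<in> K"
        then have m: "E k \<in> sets M" using DM[of "fst k" "snd k"] by (simp add: E_def)
        show "{\<omega> \<in> space M. \<omega> \<in> E k \<longleftrightarrow> k \<in> J} \<in> sets M"
          using m by (cases "k \<in> J") (auto simp: set_diff_eq[symmetric] Collect_conj_eq sets.Int_space_eq1)
      qed
      finally show "(\<lambda>\<omega>. {k \<in> K. \<omega> \<in> E k}) -` {J} \<inter> space M \<in> sets M" .
    qed
    ultimately show ?thesis unfolding code_def by (rule simple_function_Pair)
  qed
  then have "simple_function M (dec \<circ> code)" by (rule simple_function_compose)
  also have "dec \<circ> code = (\<lambda>\<omega> u. \<phi> (u, \<omega>))"
  proof (intro ext)
    fix \<omega> u
    have "(\<Sum>i=1..n. \<Sum>j=1..m. (if u \<in> {t (i - 1)<..t i} \<and> (j, i) \<in> {k \<in> K. \<omega> \<in> E k} then e j i else 0)) =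
       (\<Sum>i=1..n. \<Sum>j=1..m. indicator ({t (i - 1)<..t i} \<times> D j i) (u, \<omega>) *\<^sub>R e j i)"
      by (intro sum.cong refl) (auto simp: K_def E_def indicator_def)
    then show "(dec \<circ> code) \<omega> u = \<phi> (u, \<omega>)"
      unfolding eq by (simp add: dec_def code_def)
  qed
  finally show ?thesis .
qed

text \<open>A process which is only measurable and adapted need not stay adapted when it is averaged
  over the past. It is therefore sampled instead, on the grid
  \<open>s + i * d\<close>, and the step process takes the value at the left end of each interval. For a
  fixed \<open>s\<close> the samples may be atypical, but averaged over \<open>s\<close> in \<open>(0, d)\<close> the error is bounded
  by the mean translation error over shifts in \<open>(0, d]\<close>.\<close>

theorem adapted_step_dense:
  fixes g :: "real \<times> 'a \<Rightarrow> 'b::{banach, second_countable_topology}"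
  assumes T: "T > 0" and M: "sigma_finite_measure M"
    and Fil: "\<And>u. u \<in> {0..T} \<Longrightarrow> space (Fil u) = space M \<and> sets (Fil u) \<subseteq> sets M"
    and g: "g \<in> borel_measurable (adapted_algebra M T Fil)"
    and fin: "(\<integral>\<^sup>+p. nsq (g p) \<partial>time_prod T M) < \<infinity>" and e: "e > (0::real)"
  shows "\<exists>\<phi>\<in>adapted_step T Fil. (\<integral>\<^sup>+p. nsq (g p - \<phi> p) \<partial>time_prod T M) < ennreal e"
proof -
  interpret M: sigma_finite_measure M by fact
  interpret pair_sigma_finite lborel M by unfold_locales
  have gm[measurable]: "g \<in> borel_measurable (time_prod T M)"
    by (rule adapted_product_measurable[OF g])
  define G where "G = (\<lambda>p. if fst p \<in> {0..T} then g p else 0)"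
  have Gm[measurable]: "G \<in> borel_measurable (borel \<Otimes>\<^sub>M M)"
    unfolding G_def by (rule extend_time_measurable[OF T gm])
  have G0: "G (u, \<omega>) = 0" if "u \<notin> {0..T}" for u \<omega> using that by (auto simp: G_def)
  have Gg: "G (u, \<omega>) = g (u, \<omega>)" if "u \<in> {0..T}" for u \<omega> using that by (auto simp: G_def)
  define m0 where "m0 = (\<lambda>u. \<integral>\<^sup>+\<omega>. nsq (G (u, \<omega>)) \<partial>M)"
  define m where "m = (\<lambda>u r. \<integral>\<^sup>+\<omega>. nsq (G (u + r, \<omega>) - G (u, \<omega>)) \<partial>M)"
  have [measurable]: "m0 \<in> borel_measurable borel" unfolding m0_def by measurable
  have mm[measurable]: "case_prod m \<in> borel_measurable (borel \<Otimes>\<^sub>M borel)" unfolding m_def by measurable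
  have m0_fin: "(\<integral>\<^sup>+u. m0 u \<partial>lborel) < \<infinity>"
  proof -
    have "(\<integral>\<^sup>+u. m0 u \<partial>lborel) = (\<integral>\<^sup>+u. (\<integral>\<^sup>+\<omega>. nsq (g (u, \<omega>)) \<partial>M) * indicator {0..T} u \<partial>lborel)"
      by (intro nn_integral_cong) (auto simp: m0_def G_def indicator_def)
    also have "\<dots> = (\<integral>\<^sup>+p. nsq (g p) \<partial>time_prod T M)"
      by (rule nn_integral_time_product[OF M, symmetric]) measurable
    finally show ?thesis using fin by simp
  qed
  have "((\<lambda>r. \<integral>\<^sup>+u. m u r \<partial>lborel) \<longlongrightarrow> 0) (at 0)"
    unfolding m_def using m0_fin
    by (intro translation_continuous_mean[OF M Gm G0]) (simp_all add: m0_def)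
  then have "eventually (\<lambda>r. (\<integral>\<^sup>+u. m u r \<partial>lborel) < ennreal (e / 16)) (at 0)"
    using e by (intro ennreal_tendsto_zeroD) auto
  then obtain \<eta> where \<eta>: "\<eta> > 0" "\<And>r. r \<noteq> 0 \<Longrightarrow> \<bar>r\<bar> < \<eta> \<Longrightarrow> (\<integral>\<^sup>+u. m u r \<partial>lborel) < ennreal (e / 16)"
    unfolding eventually_at by (auto simp: dist_real_def)
  obtain N :: nat where N: "T / \<eta> < real N" using reals_Archimedean2 by blast
  then have "real N > 0" using T \<eta>(1) by (smt (verit) divide_pos_pos)
  then have N0: "N \<ge> 1" by simp
  define d where "d = T / N"
  have d: "d > 0" "d < \<eta>" "real N * d = T"
    using T \<eta>(1) N \<open>real N > 0\<close> by (auto simp: d_def field_simps)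
  \<comment> \<open>\<open>F u\<close> is the error on \<open>(u, u + d]\<close> if the process is frozen at time \<open>u\<close>\<close>
  define F where "F = (\<lambda>u. \<integral>\<^sup>+r. indicator {0<..d} r * m u r \<partial>lborel)"
  have [measurable]: "F \<in> borel_measurable borel" unfolding F_def by measurable
  have "(\<integral>\<^sup>+u. F u \<partial>lborel) = (\<integral>\<^sup>+r. \<integral>\<^sup>+u. indicator {0<..d} r * m u r \<partial>lborel \<partial>lborel)"
    unfolding F_def by (rule lborel_pair.Fubini'[symmetric]) measurable
  also have "\<dots> = (\<integral>\<^sup>+r. indicator {0<..d} r * (\<integral>\<^sup>+u. m u r \<partial>lborel) \<partial>lborel)"
    by (intro nn_integral_cong nn_integral_cmult) measurable
  also have "\<dots> \<le> (\<integral>\<^sup>+r. ennreal (e / 16) * indicator {0<..d} r \<partial>lborel)"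
    using d \<eta>(2) by (intro nn_integral_mono) (auto simp: indicator_def intro!: less_imp_le)
  also have "\<dots> = ennreal (d * (e / 16))"
    using d(1) e by (subst nn_integral_cmult_indicator) (simp_all add: ennreal_mult[symmetric] mult.commute)
  finally have Fint: "(\<integral>\<^sup>+u. F u \<partial>lborel) \<le> ennreal (d * (e / 16))" .
  obtain s where s: "s \<in> {0<..<d}" "(\<Sum>j\<le>N. F (s + (real j - 1) * d)) \<le> ennreal (2 * (e / 16))"
    "\<And>j. j \<le> N \<Longrightarrow> m0 (s + (real j - 1) * d) < \<infinity>"
    using good_shift_exists[of F m0 d "e / 16" N] Fint m0_fin d(1) e by auto
  define u where "u = (\<lambda>j::nat. s + (real j - 1) * d)"
  \<comment> \<open>the grid points \<open>u 1 = s, \<dots>, u N\<close>, closed by \<open>T\<close>; \<open>u 0 < 0\<close> serves the interval \<open>[0, s]\<close>\<close>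
  define t where "t = (\<lambda>i::nat. if i < N then u (Suc i) else T)"
  have u_step: "u (Suc j) = u j + d" for j by (simp add: u_def algebra_simps)
  have u_mono: "u i \<le> u j" if "i \<le> j" for i j using that d(1) by (simp add: u_def mult_right_mono)
  have u1: "u 1 = s" "u 0 < 0" using s(1) by (auto simp: u_def)
  have uN: "u N < T"
    using s(1) d(3) by (simp add: u_def algebra_simps)
  have u_in: "u j \<in> {0..T}" if "j \<in> {1..N}" for j
    using u_mono[of 1 j] u_mono[of j N] uN u1 s(1) that by auto
  have t_pred: "t (i - 1) = u i" if "i \<in> {1..N}" for i using that by (auto simp: t_def)
  have t_step: "t i = (if i = N then T else u i + d)" if "i \<in> {1..N}" for i
    using that by (auto simp: t_def u_step)
  \<comment> \<open>the error allowed to each of the \<open>N + 1\<close> values, so that all of them contribute \<open>e / 4\<close>\<close>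
  define e' where "e' = e / (8 * d * (real N + 1))"
  have e': "e' > 0" using e d(1) by (simp add: e'_def)
  have "\<exists>Y. simple_function (Fil (u j)) Y \<and> (\<integral>\<^sup>+\<omega>. nsq (G (u j, \<omega>) - Y \<omega>) \<partial>M) < ennreal e'"
    if j: "j \<in> {1..N}" for j
  proof -
    have "(\<lambda>\<omega>. G (u j, \<omega>)) \<in> borel_measurable (Fil (u j))"
      using adapted_section_measurable[OF g u_in[OF j]] Fil[OF u_in[OF j]] Gg[OF u_in[OF j]] by simp
    moreover have "(\<integral>\<^sup>+\<omega>. nsq (G (u j, \<omega>)) \<partial>M) < \<infinity>"
      using s(3)[of j] j by (simp add: m0_def u_def)
    ultimately show ?thesis
      using L2_simple_approximation[of "\<lambda>\<omega>. G (u j, \<omega>)" "Fil (u j)" M e'] Fil[OF u_in[OF j]] e' by blast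
  qed
  then obtain Y' where Y': "\<And>j. j \<in> {1..N} \<Longrightarrow> simple_function (Fil (u j)) (Y' j)"
    "\<And>j. j \<in> {1..N} \<Longrightarrow> (\<integral>\<^sup>+\<omega>. nsq (G (u j, \<omega>) - Y' j \<omega>) \<partial>M) < ennreal e'"
    by metis
  \<comment> \<open>before the first grid point the step process is \<open>0\<close>, which is the value of \<open>G\<close> at \<open>u 0 < 0\<close>\<close>
  define Y where "Y = (\<lambda>j. if j = 0 then (\<lambda>_. 0) else Y' j)"
  have Y_err: "(\<integral>\<^sup>+\<omega>. nsq (G (u j, \<omega>) - Y j \<omega>) \<partial>M) \<le> ennreal e'" if "j \<le> N" for j
    using that Y'(2)[of j] u1(2) G0[of "u j"] by (cases "j = 0") (auto simp: Y_def intro: less_imp_le)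
  have Y_simple: "simple_function (Fil (u j)) (Y j)" if "j \<in> {1..N}" for j
    using Y'(1)[OF that] that by (simp add: Y_def)
  have Ym[measurable]: "Y j \<in> borel_measurable M" if "j \<le> N" for j
  proof (cases "j = 0")
    case False
    then have j: "j \<in> {1..N}" using that by simp
    have "subalgebra M (Fil (u j))" using Fil[OF u_in[OF j]] by (simp add: subalgebra_def)
    from measurable_from_subalg[OF this borel_measurable_simple_function[OF Y_simple[OF j]]] show ?thesis .
  qed (simp add: Y_def)
  define V where "V = (\<Union>j\<in>{1..N}. Y j ` space M)"
  have V: "finite V" unfolding V_def
  proof (intro finite_UN_I)
    fix j assume j: "j \<in> {1..N}"
    show "finite (Y j ` space M)" using simple_functionD(1)[OF Y_simple[OF j]] Fil[OF u_in[OF j]] by simp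
  qed simp
  obtain c where c: "bij_betw c {1..card V} V" using ex_bij_betw_nat_finite_1[OF V] by blast
  define D where "D = (\<lambda>l i. Y i -` {c l} \<inter> space M)"
  have sumY: "(\<Sum>l=1..card V. indicator (D l i) \<omega> *\<^sub>R c l) = Y i \<omega>" if "i \<in> {1..N}" "\<omega> \<in> space M" for i \<omega>
  proof -
    have "(\<Sum>l=1..card V. indicator (D l i) \<omega> *\<^sub>R c l) = (\<Sum>l=1..card V. (if c l = Y i \<omega> then c l else 0))"
      using that by (intro sum.cong) (auto simp: D_def indicator_def)
    also have "\<dots> = (\<Sum>y\<in>V. if y = Y i \<omega> then y else 0)"
      by (rule sum.reindex_bij_betw[OF c])
    also have "\<dots> = Y i \<omega>" using V that by (auto simp: V_def)
    finally show ?thesis .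
  qed
  define \<phi> where "\<phi> = (\<lambda>p. indicator ({0} \<times> {}) p *\<^sub>R (0::'b) +
     (\<Sum>i=1..N. \<Sum>l=1..card V. indicator ({t (i - 1)<..t i} \<times> D l i) p *\<^sub>R c l))"
  have \<phi>_step: "\<phi> \<in> adapted_step T Fil"
    unfolding adapted_step_def
  proof (intro CollectI exI conjI)
    show "\<phi> = (\<lambda>p. indicator ({0} \<times> {}) p *\<^sub>R (0::'b) +
      (\<Sum>i=1..N. \<Sum>l=1..card V. indicator ({t (i - 1)<..t i} \<times> D l i) p *\<^sub>R c l))" by (rule \<phi>_def)
    show "0 \<le> t 0" using N0 u1 s(1) by (simp add: t_def)
    show "t N \<le> T" by (simp add: t_def)
    show "\<forall>i\<in>{1..N}. t (i - 1) < t i"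
    proof
      fix i assume i: "i \<in> {1..N}"
      show "t (i - 1) < t i" unfolding t_pred[OF i] t_step[OF i] using d(1) uN by auto
    qed
    show "\<forall>i\<in>{1..N}. (\<forall>j\<in>{1..card V}. D j i \<in> sets (Fil (t (i - 1)))) \<and> disjoint_family_on (\<lambda>j. D j i) {1..card V}"
    proof (intro ballI conjI)
      fix i j assume i: "i \<in> {1..N}" and "j \<in> {1..card V}"
      show "D j i \<in> sets (Fil (t (i - 1)))"
        unfolding t_pred[OF i] D_def
        using simple_functionD(2)[OF Y_simple[OF i], of "{c j}"] Fil[OF u_in[OF i]] by simp
    next
      fix i
      show "disjoint_family_on (\<lambda>j. D j i) {1..card V}"
        unfolding disjoint_family_on_def
      proof (intro ballI impI)
        fix j k assume "j \<in> {1..card V}" "k \<in> {1..card V}" "j \<noteq> k"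
        then have "c j \<noteq> c k" using inj_onD[OF bij_betw_imp_inj_on[OF c]] by blast
        then show "D j i \<inter> D k i = {}" by (auto simp: D_def)
      qed
    qed
  qed simp
  have \<phi>_val: "\<phi> (v, \<omega>) = (\<Sum>i=1..N. indicator {t (i - 1)<..t i} v *\<^sub>R Y i \<omega>)" if "\<omega> \<in> space M" for v \<omega>
  proof -
    have "\<phi> (v, \<omega>) = (\<Sum>i=1..N. \<Sum>l=1..card V. indicator {t (i - 1)<..t i} v *\<^sub>R (indicator (D l i) \<omega> *\<^sub>R c l))"
      unfolding \<phi>_def scaleR_zero_right add_0_left
      by (intro sum.cong refl) (auto simp: indicator_def)
    also have "\<dots> = (\<Sum>i=1..N. indicator {t (i - 1)<..t i} v *\<^sub>R (\<Sum>l=1..card V. indicator (D l i) \<omega> *\<^sub>R c l))"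
      by (simp only: scaleR_sum_right)
    also have "\<dots> = (\<Sum>i=1..N. indicator {t (i - 1)<..t i} v *\<^sub>R Y i \<omega>)"
      using sumY that by (intro sum.cong) auto
    finally show ?thesis .
  qed
  have locate: "\<exists>j\<le>N. v - u j \<in> {0<..d} \<and> \<phi> (v, \<omega>) = Y j \<omega>" if v: "v \<in> {0..T}" and \<omega>: "\<omega> \<in> space M" for v \<omega>
  proof -
    define k where "k = \<lceil>(v - s) / d\<rceil>"
    have k: "of_int k - 1 < (v - s) / d" "(v - s) / d \<le> of_int k"
      unfolding k_def by linarith+
    have "-1 < (v - s) / d" using v s(1) d(1) by (simp add: pos_less_divide_eq)
    then have k0: "k \<ge> 0" using k(2) by linarith
    have "(v - s) / d < real N" using v s(1) d(1,3) by (simp add: pos_divide_less_eq)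
    then have kN: "k \<le> int N" using k(1) by linarith
    define j where "j = nat k"
    have jk: "real j = of_int k" using k0 by (simp add: j_def)
    have jN: "j \<le> N" using kN by (simp add: j_def)
    have "(real j - 1) * d < v - s" "v - s \<le> real j * d"
      using k d(1) unfolding jk by (simp_all add: pos_less_divide_eq pos_divide_le_eq)
    then have vj: "u j < v" "v \<le> u j + d" by (auto simp: u_def algebra_simps)
    have other: "indicator {t (i - 1)<..t i} v = (if i = j then 1 else 0 :: real)" if i: "i \<in> {1..N}" for i
    proof (cases i j rule: linorder_cases)
      case less
      then have "t i = u (Suc i)" "u (Suc i) \<le> u j" using jN by (auto simp: t_def intro: u_mono)
      then show ?thesis using less vj by auto
    next
      case equal
      then show ?thesis using vj t_pred[OF i] t_step[OF i] v by auto
    next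
      case greater
      then have "u (Suc j) \<le> u i" by (intro u_mono) simp
      then show ?thesis using greater vj t_pred[OF i] u_step[of j] by auto
    qed
    have "\<phi> (v, \<omega>) = (\<Sum>i=1..N. if i = j then Y i \<omega> else 0)"
      unfolding \<phi>_val[OF \<omega>] using other by (intro sum.cong) auto
    also have "\<dots> = Y j \<omega>" using jN by (cases "j = 0") (auto simp: Y_def)
    finally show ?thesis using jN vj by (intro exI[of _ j]) auto
  qed
  have \<phi>m[measurable]: "\<phi> \<in> borel_measurable (time_prod T M)"
    using Fil by (intro adapted_step_product_measurable[OF \<phi>_step T]) blast
  have "(\<integral>\<^sup>+p. nsq (g p - \<phi> p) \<partial>time_prod T M) =
      (\<integral>\<^sup>+v. (\<integral>\<^sup>+\<omega>. nsq (g (v, \<omega>) - \<phi> (v, \<omega>)) \<partial>M) * indicator {0..T} v \<partial>lborel)"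
    using \<phi>m by (intro nn_integral_time_product[OF M]) measurable
  also have "\<dots> \<le> (\<integral>\<^sup>+v. (\<Sum>j\<le>N. indicator {0<..d} (v - u j) *
      (2 * m (u j) (v - u j) + 2 * ennreal e')) \<partial>lborel)"
  proof (rule nn_integral_mono)
    fix v
    show "(\<integral>\<^sup>+\<omega>. nsq (g (v, \<omega>) - \<phi> (v, \<omega>)) \<partial>M) * indicator {0..T} v \<le>
      (\<Sum>j\<le>N. indicator {0<..d} (v - u j) * (2 * m (u j) (v - u j) + 2 * ennreal e'))"
    proof (cases "v \<in> {0..T}")
      case True
      have "(\<integral>\<^sup>+\<omega>. nsq (g (v, \<omega>) - \<phi> (v, \<omega>)) \<partial>M) \<le>
        (\<integral>\<^sup>+\<omega>. (\<Sum>j\<le>N. indicator {0<..d} (v - u j) *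
          (2 * nsq (G (v, \<omega>) - G (u j, \<omega>)) + 2 * nsq (G (u j, \<omega>) - Y j \<omega>))) \<partial>M)"
      proof (rule nn_integral_mono)
        fix \<omega> assume \<omega>: "\<omega> \<in> space M"
        obtain j where j: "j \<le> N" "v - u j \<in> {0<..d}" "\<phi> (v, \<omega>) = Y j \<omega>"
          using locate[OF True \<omega>] by blast
        have "nsq (g (v, \<omega>) - \<phi> (v, \<omega>)) \<le> 2 * nsq (G (v, \<omega>) - G (u j, \<omega>)) + 2 * nsq (G (u j, \<omega>) - Y j \<omega>)"
          unfolding j(3) Gg[OF True, symmetric] by (rule nsq_triangle)
        also have "\<dots> = indicator {0<..d} (v - u j) *
          (2 * nsq (G (v, \<omega>) - G (u j, \<omega>)) + 2 * nsq (G (u j, \<omega>) - Y j \<omega>))" using j(2) by simp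
        also have "\<dots> \<le> (\<Sum>j\<le>N. indicator {0<..d} (v - u j) *
          (2 * nsq (G (v, \<omega>) - G (u j, \<omega>)) + 2 * nsq (G (u j, \<omega>) - Y j \<omega>)))"
          by (rule member_le_sum[of j "{..N}" "\<lambda>j. indicator {0<..d} (v - u j) *
          (2 * nsq (G (v, \<omega>) - G (u j, \<omega>)) + 2 * nsq (G (u j, \<omega>) - Y j \<omega>))"]) (use j(1) in auto)
        finally show "nsq (g (v, \<omega>) - \<phi> (v, \<omega>)) \<le> (\<Sum>j\<le>N. indicator {0<..d} (v - u j) *
          (2 * nsq (G (v, \<omega>) - G (u j, \<omega>)) + 2 * nsq (G (u j, \<omega>) - Y j \<omega>)))" .
      qed
      also have "\<dots> = (\<Sum>j\<le>N. \<integral>\<^sup>+\<omega>. indicator {0<..d} (v - u j) *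
          (2 * nsq (G (v, \<omega>) - G (u j, \<omega>)) + 2 * nsq (G (u j, \<omega>) - Y j \<omega>)) \<partial>M)"
        by (rule nn_integral_sum) (use Ym in measurable)
      also have "\<dots> \<le> (\<Sum>j\<le>N. indicator {0<..d} (v - u j) * (2 * m (u j) (v - u j) + 2 * ennreal e'))"
      proof (rule sum_mono)
        fix j assume "j \<in> {..N}"
        then have jN: "j \<le> N" by simp
        note [measurable] = Ym[OF jN]
        have "(\<integral>\<^sup>+\<omega>. indicator {0<..d} (v - u j) *
          (2 * nsq (G (v, \<omega>) - G (u j, \<omega>)) + 2 * nsq (G (u j, \<omega>) - Y j \<omega>)) \<partial>M) =
          indicator {0<..d} (v - u j) * (2 * m (u j) (v - u j) + 2 * (\<integral>\<^sup>+\<omega>. nsq (G (u j, \<omega>) - Y j \<omega>) \<partial>M))"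
          by (simp add: nn_integral_cmult nn_integral_add m_def)
        also have "\<dots> \<le> indicator {0<..d} (v - u j) * (2 * m (u j) (v - u j) + 2 * ennreal e')"
          by (intro mult_left_mono add_left_mono Y_err jN) auto
        finally show "(\<integral>\<^sup>+\<omega>. indicator {0<..d} (v - u j) *
          (2 * nsq (G (v, \<omega>) - G (u j, \<omega>)) + 2 * nsq (G (u j, \<omega>) - Y j \<omega>)) \<partial>M) \<le>
          indicator {0<..d} (v - u j) * (2 * m (u j) (v - u j) + 2 * ennreal e')" .
      qed
      finally show ?thesis using True by simp
    qed simp
  qed
  also have "\<dots> = (\<Sum>j\<le>N. \<integral>\<^sup>+v. indicator {0<..d} (v - u j) * (2 * m (u j) (v - u j) + 2 * ennreal e') \<partial>lborel)"
    by (rule nn_integral_sum) measurable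
  also have "\<dots> = (\<Sum>j\<le>N. 2 * F (u j) + 2 * ennreal e' * ennreal d)"
  proof (rule sum.cong[OF refl])
    fix j
    have "(\<integral>\<^sup>+v. indicator {0<..d} (v - u j) * (2 * m (u j) (v - u j) + 2 * ennreal e') \<partial>lborel) =
        (\<integral>\<^sup>+r. indicator {0<..d} r * (2 * m (u j) r + 2 * ennreal e') \<partial>lborel)"
      using nn_integral_translation[of "\<lambda>r. indicator {0<..d} r * (2 * m (u j) r + 2 * ennreal e')" "- u j"]
      by simp
    also have "\<dots> = (\<integral>\<^sup>+r. 2 * (indicator {0<..d} r * m (u j) r) + (2 * ennreal e') * indicator {0<..d} r \<partial>lborel)"
      by (intro nn_integral_cong) (simp add: distrib_left ac_simps)
    also have "\<dots> = (\<integral>\<^sup>+r. 2 * (indicator {0<..d} r * m (u j) r) \<partial>lborel) + (\<integral>\<^sup>+r. (2 * ennreal e') * indicator {0<..d} r \<partial>lborel)"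
      by (rule nn_integral_add) measurable
    also have "(\<integral>\<^sup>+r. 2 * (indicator {0<..d} r * m (u j) r) \<partial>lborel) = 2 * F (u j)"
      unfolding F_def by (rule nn_integral_cmult) measurable
    also have "(\<integral>\<^sup>+r. (2 * ennreal e') * indicator {0<..d} r \<partial>lborel) = 2 * ennreal e' * ennreal d"
      using d(1) by (subst nn_integral_cmult_indicator) simp_all
    finally show "(\<integral>\<^sup>+v. indicator {0<..d} (v - u j) * (2 * m (u j) (v - u j) + 2 * ennreal e') \<partial>lborel) =
      2 * F (u j) + 2 * ennreal e' * ennreal d" .
  qed
  also have "\<dots> = 2 * (\<Sum>j\<le>N. F (u j)) + of_nat (N + 1) * (2 * ennreal e' * ennreal d)"
    by (simp add: sum.distrib sum_distrib_left)
  also have "\<dots> \<le> 2 * ennreal (2 * (e / 16)) + of_nat (N + 1) * (2 * ennreal e' * ennreal d)"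
    using s(2) by (intro add_right_mono mult_left_mono) (auto simp: u_def)
  also have "of_nat (N + 1) * (2 * ennreal e' * ennreal d) = ennreal (real (N + 1) * (2 * e' * d))"
    using e' d(1) by (simp only: ennreal_mult ennreal_of_nat_eq_real_of_nat[symmetric] ennreal_numeral
      mult_nonneg_nonneg less_imp_le zero_le_numeral of_nat_0_le_iff)
  also have "real (N + 1) * (2 * e' * d) = e / 4"
  proof -
    define c where "c = real N + 1"
    have "c > 0" by (simp add: c_def)
    have "real (N + 1) * (2 * e' * d) = c * (2 * (e / (8 * d * c)) * d)" by (simp add: e'_def c_def)
    also have "\<dots> = e / 4" using d(1) \<open>c > 0\<close> by (simp add: field_simps)
    finally show ?thesis .
  qed
  also have "2 * ennreal (2 * (e / 16)) + ennreal (e / 4) = ennreal (2 * (2 * (e / 16)) + e / 4)"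
    using e by (simp only: ennreal_plus ennreal_mult ennreal_numeral zero_le_numeral
      less_imp_le mult_nonneg_nonneg divide_nonneg_nonneg)
  also have "\<dots> < ennreal e" using e by (intro ennreal_lessI) auto
  finally show ?thesis using \<phi>_step by blast
qed

section \<open>Operators represented by functions\<close>

lemma space_time [simp]: "space (time_measure T) = {0..T}"
  by (simp add: space_restrict_space)

lemma L2_measurable: "h \<in> L2 T \<Longrightarrow> h \<in> borel_measurable (time_measure T)"
  by (simp add: L2_def)

lemma L2_integrable: "h \<in> L2 T \<Longrightarrow> integrable (time_measure T) (\<lambda>u. (h u)\<^sup>2)"
  by (simp add: L2_def)

lemma integrable_nsq_iff:
  fixes f :: "'a \<Rightarrow> 'b::{banach, second_countable_topology}"
  assumes "f \<in> borel_measurable M"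
  shows "integrable M (\<lambda>u. (norm (f u))\<^sup>2) \<longleftrightarrow> (\<integral>\<^sup>+u. nsq (f u) \<partial>M) < \<infinity>"
  using assms by (simp add: integrable_iff_bounded)

lemma L2_iff: "h \<in> L2 T \<longleftrightarrow> h \<in> borel_measurable (time_measure T) \<and> (\<integral>\<^sup>+u. nsq (h u) \<partial>time_measure T) < \<infinity>"
  using integrable_nsq_iff[of h "time_measure T"] unfolding L2_def by (auto simp only: real_norm_def power2_abs mem_Collect_eq)

lemma integrable_scaleR_L2:
  fixes f :: "real \<Rightarrow> 'b::{banach, second_countable_topology}"
  assumes h: "h \<in> L2 T" and f: "f \<in> borel_measurable (time_measure T)"
    and fin: "(\<integral>\<^sup>+u. nsq (f u) \<partial>time_measure T) < \<infinity>"
  shows "integrable (time_measure T) (\<lambda>u. h u *\<^sub>R f u)"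
proof (rule Bochner_Integration.integrable_bound)
  show "integrable (time_measure T) (\<lambda>u. (h u)\<^sup>2 + (norm (f u))\<^sup>2)"
    using L2_integrable[OF h] fin f by (intro Bochner_Integration.integrable_add) (simp_all add: integrable_nsq_iff)
  show "(\<lambda>u. h u *\<^sub>R f u) \<in> borel_measurable (time_measure T)"
    using L2_measurable[OF h] f by (rule borel_measurable_scaleR)
  have "\<bar>a\<bar> * b \<le> a\<^sup>2 + b\<^sup>2" if "b \<ge> 0" for a b :: real
  proof -
    have "2 * \<bar>a\<bar> * b \<le> a\<^sup>2 + b\<^sup>2" using sum_squares_bound[of "\<bar>a\<bar>" b] by simp
    moreover have "0 \<le> \<bar>a\<bar> * b" using that by simp
    ultimately show ?thesis by linarith
  qed
  then show "AE u in time_measure T. norm (h u *\<^sub>R f u) \<le> norm ((h u)\<^sup>2 + (norm (f u))\<^sup>2)"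
    by (intro AE_I2) simp
qed

lemma L2_integrable_mult:
  "h \<in> L2 T \<Longrightarrow> k \<in> L2 T \<Longrightarrow> integrable (time_measure T) (\<lambda>u. h u * k u)"
  using integrable_scaleR_L2[of h T k] by (simp add: L2_iff)

lemma L2_add: "h \<in> L2 T \<Longrightarrow> k \<in> L2 T \<Longrightarrow> (\<lambda>u. h u + k u) \<in> L2 T"
  and L2_scale: "h \<in> L2 T \<Longrightarrow> (\<lambda>u. c * h u) \<in> L2 T"
proof -
  assume h: "h \<in> L2 T"
  show "(\<lambda>u. c * h u) \<in> L2 T"
    using L2_measurable[OF h] L2_integrable[OF h] by (simp add: L2_def power_mult_distrib)
  assume k: "k \<in> L2 T"
  have "integrable (time_measure T) (\<lambda>u. (h u)\<^sup>2 + (k u)\<^sup>2 + 2 * (h u * k u))"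
    using L2_integrable[OF h] L2_integrable[OF k] L2_integrable_mult[OF h k]
    by (intro Bochner_Integration.integrable_add integrable_mult_right)
  then show "(\<lambda>u. h u + k u) \<in> L2 T"
    using L2_measurable[OF h] L2_measurable[OF k] by (simp add: L2_def power2_sum mult.assoc)
qed

lemma L2_diff: "h \<in> L2 T \<Longrightarrow> k \<in> L2 T \<Longrightarrow> (\<lambda>u. h u - k u) \<in> L2 T"
  using L2_add[of h T "\<lambda>u. - 1 * k u"] L2_scale[of k T "-1"] by simp

lemma L2_abs:
  assumes "h \<in> L2 T" shows "(\<lambda>u. \<bar>h u\<bar>) \<in> L2 T"
  using borel_measurable_abs[OF L2_measurable[OF assms]] L2_integrable[OF assms] by (simp add: L2_def)

lemma L2_sum: "(\<And>i. i \<in> I \<Longrightarrow> h i \<in> L2 T) \<Longrightarrow> (\<lambda>u. \<Sum>i\<in>I. h i u) \<in> L2 T"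
proof (induction I rule: infinite_finite_induct)
  case (insert i I)
  then show ?case using L2_add[of "h i" T "\<lambda>u. \<Sum>i\<in>I. h i u"] by simp
qed (simp_all add: L2_def)

lemma L2_bounded:
  assumes h: "h \<in> borel_measurable (time_measure T)" and B: "\<And>u. u \<in> {0..T} \<Longrightarrow> \<bar>h u\<bar> \<le> B"
  shows "h \<in> L2 T"
proof -
  interpret finite_measure "time_measure T" by (rule finite_measure_time)
  have "integrable (time_measure T) (\<lambda>u. (h u)\<^sup>2)"
  proof (rule integrable_const_bound[of _ "B\<^sup>2"])
    show "AE u in time_measure T. norm ((h u)\<^sup>2) \<le> B\<^sup>2"
    proof (rule AE_I2)
      fix u assume "u \<in> space (time_measure T)"
      then have "\<bar>h u\<bar>\<^sup>2 \<le> B\<^sup>2" using B by (intro power_mono) auto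
      then show "norm ((h u)\<^sup>2) \<le> B\<^sup>2" by simp
    qed
  qed (use h in simp)
  then show ?thesis using h by (simp add: L2_def)
qed

lemma L2_indicator: "A \<in> sets (time_measure T) \<Longrightarrow> indicator A \<in> L2 T"
  by (intro L2_bounded[of _ _ 1]) (auto simp: indicator_def)

lemma L2_inner_self: "h \<in> L2 T \<Longrightarrow> ennreal (L2_inner T h h) = (\<integral>\<^sup>+u. nsq (h u) \<partial>time_measure T)"
  using L2_integrable[of h T] unfolding L2_inner_def
  by (subst nn_integral_eq_integral) (simp_all add: power2_eq_square)

lemma L2_inner_nonneg: "0 \<le> L2_inner T h h"
  unfolding L2_inner_def by (rule Bochner_Integration.integral_nonneg) simp

definition rep_op :: "real \<Rightarrow> (real \<Rightarrow> 'b::{banach, second_countable_topology}) \<Rightarrow> 'b op" where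
  "rep_op T f = (\<lambda>h. if h \<in> L2 T then \<integral>u. h u *\<^sub>R f u \<partial>time_measure T else 0)"

lemma norm_integral_scaleR_le:
  fixes f :: "real \<Rightarrow> 'b::{banach, second_countable_topology}"
  assumes h: "h \<in> L2 T" and f[measurable]: "f \<in> borel_measurable (time_measure T)"
    and fin: "(\<integral>\<^sup>+u. nsq (f u) \<partial>time_measure T) < \<infinity>"
  shows "norm (\<integral>u. h u *\<^sub>R f u \<partial>time_measure T) \<le>
    sqrt (enn2real (\<integral>\<^sup>+u. nsq (f u) \<partial>time_measure T)) * sqrt (L2_inner T h h)"
proof -
  have [measurable]: "h \<in> borel_measurable (time_measure T)" by (rule L2_measurable[OF h])
  let ?I = "\<integral>u. h u *\<^sub>R f u \<partial>time_measure T"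
  obtain K where K: "(\<integral>\<^sup>+u. nsq (f u) \<partial>time_measure T) = ennreal K" "K \<ge> 0"
    using fin by (auto simp: less_top_ennreal)
  have "ennreal (norm ?I) \<le> (\<integral>\<^sup>+u. ennreal (norm (h u *\<^sub>R f u)) \<partial>time_measure T)"
    by (rule integral_norm_bound_ennreal[OF integrable_scaleR_L2[OF h f fin]])
  also have "\<dots> = (\<integral>\<^sup>+u. ennreal (norm (h u)) * ennreal (norm (f u)) \<partial>time_measure T)"
    by (simp add: ennreal_mult)
  finally have "(ennreal (norm ?I))\<^sup>2 \<le> (\<integral>\<^sup>+u. ennreal (norm (h u)) * ennreal (norm (f u)) \<partial>time_measure T)\<^sup>2"
    by (rule power_mono) simp
  also have "\<dots> \<le> (\<integral>\<^sup>+u. (ennreal (norm (h u)))\<^sup>2 \<partial>time_measure T) * (\<integral>\<^sup>+u. (ennreal (norm (f u)))\<^sup>2 \<partial>time_measure T)"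
    by (rule Cauchy_Schwarz_nn_integral) measurable
  also have "\<dots> = ennreal (L2_inner T h h) * ennreal K"
    unfolding L2_inner_self[OF h] K(1)[symmetric] by (simp add: ennreal_power)
  also have "\<dots> = ennreal (L2_inner T h h * K)"
    by (rule ennreal_mult[symmetric]) (use K L2_inner_nonneg in auto)
  finally have "(norm ?I)\<^sup>2 \<le> L2_inner T h h * K"
    using K(2) L2_inner_nonneg[of T h] by (simp add: ennreal_power ennreal_le_iff)
  then have "norm ?I \<le> sqrt (L2_inner T h h * K)" by (rule real_le_rsqrt)
  then show ?thesis using K by (simp add: real_sqrt_mult mult.commute)
qed

lemma rep_op_L2_operators:
  fixes f :: "real \<Rightarrow> 'b::{banach, second_countable_topology}"
  assumes f: "f \<in> borel_measurable (time_measure T)" "(\<integral>\<^sup>+u. nsq (f u) \<partial>time_measure T) < \<infinity>"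
  shows "rep_op T f \<in> L2_operators T"
proof -
  note int = integrable_scaleR_L2[OF _ f]
  have "rep_op T f (\<lambda>u. h u + k u) = rep_op T f h + rep_op T f k" if "h \<in> L2 T" "k \<in> L2 T" for h k
    using that int by (simp add: rep_op_def L2_add scaleR_left_distrib)
  moreover have "rep_op T f (\<lambda>u. c * h u) = c *\<^sub>R rep_op T f h" if "h \<in> L2 T" for h c
    using that int by (simp add: rep_op_def L2_scale flip: scaleR_scaleR)
  moreover have "\<exists>C. \<forall>h\<in>L2 T. norm (rep_op T f h) \<le> C * sqrt (L2_inner T h h)"
    using norm_integral_scaleR_le[OF _ f] by (intro exI ballI) (simp add: rep_op_def)
  ultimately show ?thesis unfolding L2_operators_def by (auto simp: rep_op_def)
qed

lemma rep_op_diff: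
  fixes f g :: "real \<Rightarrow> 'b::{banach, second_countable_topology}"
  assumes f: "f \<in> borel_measurable (time_measure T)" "(\<integral>\<^sup>+u. nsq (f u) \<partial>time_measure T) < \<infinity>"
    and g: "g \<in> borel_measurable (time_measure T)" "(\<integral>\<^sup>+u. nsq (g u) \<partial>time_measure T) < \<infinity>"
  shows "op_diff (rep_op T f) (rep_op T g) = rep_op T (\<lambda>u. f u - g u)"
proof
  fix h
  show "op_diff (rep_op T f) (rep_op T g) h = rep_op T (\<lambda>u. f u - g u) h"
  proof (cases "h \<in> L2 T")
    case True
    then show ?thesis using integrable_scaleR_L2[OF True f] integrable_scaleR_L2[OF True g]
      by (simp add: rep_op_def op_diff_def scaleR_diff_right)
  qed (simp add: rep_op_def op_diff_def)
qed

lemma L2_operatorsD: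
  assumes "R \<in> L2_operators T"
  shows "h \<in> L2 T \<Longrightarrow> k \<in> L2 T \<Longrightarrow> R (\<lambda>u. h u + k u) = R h + R k"
    "h \<in> L2 T \<Longrightarrow> R (\<lambda>u. c * h u) = c *\<^sub>R R h" "h \<notin> L2 T \<Longrightarrow> R h = 0"
    "\<exists>C\<ge>0. \<forall>h\<in>L2 T. norm (R h) \<le> C * sqrt (L2_inner T h h)"
proof -
  show "h \<in> L2 T \<Longrightarrow> k \<in> L2 T \<Longrightarrow> R (\<lambda>u. h u + k u) = R h + R k"
    "h \<in> L2 T \<Longrightarrow> R (\<lambda>u. c * h u) = c *\<^sub>R R h" "h \<notin> L2 T \<Longrightarrow> R h = 0"
    using assms by (auto simp: L2_operators_def)
  obtain C where C: "\<forall>h\<in>L2 T. norm (R h) \<le> C * sqrt (L2_inner T h h)"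
    using assms unfolding L2_operators_def by blast
  have "norm (R h) \<le> max 0 C * sqrt (L2_inner T h h)" if "h \<in> L2 T" for h
    using C that by (intro order_trans[OF C[rule_format] mult_right_mono]) (auto simp: L2_inner_nonneg)
  then show "\<exists>C\<ge>0. \<forall>h\<in>L2 T. norm (R h) \<le> C * sqrt (L2_inner T h h)"
    by (intro exI[of _ "max 0 C"]) auto
qed

lemma op_diff_L2_operators:
  assumes R: "R \<in> L2_operators T" and S: "S \<in> L2_operators T"
  shows "op_diff R S \<in> L2_operators T"
proof -
  obtain C D where C: "\<forall>h\<in>L2 T. norm (R h) \<le> C * sqrt (L2_inner T h h)"
    and D: "\<forall>h\<in>L2 T. norm (S h) \<le> D * sqrt (L2_inner T h h)"
    using L2_operatorsD(4)[OF R] L2_operatorsD(4)[OF S] by blast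
  have "norm (R h - S h) \<le> (C + D) * sqrt (L2_inner T h h)" if "h \<in> L2 T" for h
    using norm_triangle_ineq4[of "R h" "S h"] C D that by (auto simp: distrib_right intro: order_trans)
       (smt (verit))
  then have "\<exists>C. \<forall>h\<in>L2 T. norm (R h - S h) \<le> C * sqrt (L2_inner T h h)" by blast
  then show ?thesis
    using L2_operatorsD(1-3)[OF R] L2_operatorsD(1-3)[OF S]
    unfolding L2_operators_def op_diff_def by (simp add: scaleR_diff_right)
qed

text \<open>A bounded linear functional on \<open>L2 T\<close> is determined by its values on the countably many functions
  \<open>indicator {..q}\<close>, \<open>q\<close> rational. Therefore the null sets on which a representing formula
  fails can be united.\<close>

lemma L2_functional_zero:
  fixes l :: "(real \<Rightarrow> real) \<Rightarrow> real"
  assumes add: "\<And>h k. h \<in> L2 T \<Longrightarrow> k \<in> L2 T \<Longrightarrow> l (\<lambda>u. h u + k u) = l h + l k"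
    and scale: "\<And>c h. h \<in> L2 T \<Longrightarrow> l (\<lambda>u. c * h u) = c * l h"
    and bound: "\<And>h. h \<in> L2 T \<Longrightarrow> \<bar>l h\<bar> \<le> K * sqrt (L2_inner T h h)"
    and rat: "\<And>q. q \<in> \<rat> \<Longrightarrow> l (indicator {..q}) = 0" and h: "h \<in> L2 T"
  shows "l h = 0"
proof -
  have limit: "l k = 0" if k: "k \<in> L2 T" and g: "g \<in> L2 T" and f: "\<And>n. f n \<in> L2 T" and f0: "\<And>n. l (f n) = 0"
    and lim: "\<And>u. u \<in> {0..T} \<Longrightarrow> (\<lambda>n. f n u) \<longlonglongrightarrow> k u" and dom: "\<And>n u. u \<in> {0..T} \<Longrightarrow> \<bar>f n u\<bar> \<le> g u"
    for k g :: "real \<Rightarrow> real" and f :: "nat \<Rightarrow> real \<Rightarrow> real"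
  proof -
    note [measurable] = L2_measurable[OF k] L2_measurable[OF f] L2_measurable[OF g]
    have kd: "(\<lambda>u. k u - f n u) \<in> L2 T" for n by (rule L2_diff[OF k f])
    have le: "\<bar>k u\<bar> \<le> g u" if "u \<in> {0..T}" for u
      by (rule tendsto_upperbound[OF tendsto_rabs[OF lim[OF that]]]) (use dom that in auto)
    have "(\<lambda>n. \<integral>u. (k u - f n u)\<^sup>2 \<partial>time_measure T) \<longlonglongrightarrow> (\<integral>u. 0 \<partial>time_measure T)"
    proof (rule integral_dominated_convergence[where w = "\<lambda>u. 4 * (g u)\<^sup>2"])
      show "AE u in time_measure T. (\<lambda>n. (k u - f n u)\<^sup>2) \<longlonglongrightarrow> 0"
      proof (rule AE_I2)
        fix u assume "u \<in> space (time_measure T)"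
        then have "(\<lambda>n. (k u - f n u)\<^sup>2) \<longlonglongrightarrow> (k u - k u)\<^sup>2" using lim by (intro tendsto_intros) auto
        then show "(\<lambda>n. (k u - f n u)\<^sup>2) \<longlonglongrightarrow> 0" by simp
      qed
      show "AE u in time_measure T. norm ((k u - f n u)\<^sup>2) \<le> 4 * (g u)\<^sup>2" for n
      proof (rule AE_I2)
        fix u assume "u \<in> space (time_measure T)"
        then have "\<bar>k u - f n u\<bar> \<le> 2 * g u" using le[of u] dom[of u n] by auto
        then have "\<bar>k u - f n u\<bar>\<^sup>2 \<le> (2 * g u)\<^sup>2" by (rule power_mono) simp
        then show "norm ((k u - f n u)\<^sup>2) \<le> 4 * (g u)\<^sup>2" by (simp add: power_mult_distrib)
      qed
    qed (use L2_integrable[OF g] in auto)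
    then have "(\<lambda>n. K * sqrt (L2_inner T (\<lambda>u. k u - f n u) (\<lambda>u. k u - f n u))) \<longlonglongrightarrow> K * sqrt 0"
      unfolding L2_inner_def by (intro tendsto_intros) (simp add: power2_eq_square)
    moreover have "norm (l k) \<le> K * sqrt (L2_inner T (\<lambda>u. k u - f n u) (\<lambda>u. k u - f n u))" for n
    proof -
      have "l k = l (\<lambda>u. k u - f n u)"
        using add[OF kd f[of n], of n] f0[of n] by simp
      then show ?thesis using bound[OF kd] by simp
    qed
    ultimately have "norm (l k) \<le> K * sqrt 0" by (intro tendsto_lowerbound) auto
    then show ?thesis by simp
  qed
  have one: "(\<lambda>_. 1) \<in> L2 T" by (rule L2_bounded[of _ _ 1]) auto
  have sets_time: "B \<inter> {0..T} \<in> sets (time_measure T)" if "B \<in> sets borel" for B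
    using that by (simp add: sets_restrict_space_iff)
  have ind: "indicator B \<in> L2 T" if "B \<in> sets borel" for B :: "real set"
    using that by (intro L2_bounded[of _ _ 1]) (auto simp: indicator_def intro!: measurable_restrict_space1)
  have atMost: "l (indicator {..r}) = 0" for r
  proof -
    have "\<exists>q\<in>\<rat>. r < q \<and> q < r + 1 / Suc n" for n using Rats_dense_in_real[of r "r + 1 / Suc n"] by auto
    then obtain q where q: "\<And>n. q n \<in> \<rat>" "\<And>n. r < q n" "\<And>n. q n < r + 1 / Suc n" by metis
    show ?thesis
    proof (rule limit[OF ind one, of _ "\<lambda>n. indicator {..q n}"])
      fix u :: real
      show "(\<lambda>n. indicator {..q n} u :: real) \<longlonglongrightarrow> indicator {..r} u"
      proof (cases "u \<le> r")
        case True
        then have "indicator {..q n} u = (1::real)" for n using q(2)[of n] by simp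
        then show ?thesis using True by simp
      next
        case False
        then have "u - r > 0" by simp
        then obtain N where N: "1 / Suc N < u - r" using nat_approx_posE by blast
        have "indicator {..q n} u = (0::real)" if "n \<ge> N" for n
        proof -
          have "1 / real (Suc n) \<le> 1 / real (Suc N)" using that by (intro divide_left_mono) auto
          then show ?thesis using q(3)[of n] N by simp
        qed
        then have "eventually (\<lambda>n. indicator {..q n} u = (0::real)) sequentially"
          by (auto simp: eventually_sequentially)
        then show ?thesis using False by (simp add: tendsto_eventually)
      qed
    qed (use q(1) rat ind in \<open>auto simp: indicator_def\<close>)
  qed
  have zero: "l (\<lambda>_. 0) = 0" using scale[OF one, of 0] by simp
  have uni: "l (indicator UNIV) = 0"
  proof (rule limit[OF ind one, of _ "\<lambda>_. indicator {..T}"])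
    show "l (indicator {..T}) = 0" by (rule atMost)
  qed (use ind in \<open>auto simp: indicator_def\<close>)
  have sets: "l (indicator B) = 0" if "B \<in> sets borel" for B
  proof -
    have "Int_stable (range (\<lambda>r::real. {..r}))"
      by (auto simp: Int_stable_def Int_atMost)
    moreover have "range (\<lambda>r::real. {..r}) \<subseteq> Pow UNIV" by simp
    moreover have "B \<in> sigma_sets UNIV (range (\<lambda>r::real. {..r}))"
      using that unfolding borel_eq_atMost by simp
    ultimately show ?thesis
    proof (induction rule: sigma_sets_induct_disjoint)
      case (basic A) then show ?case using atMost by auto
    next
      case empty then show ?case using zero by simp
    next
      case (compl A)
      then have A: "A \<in> sets borel" unfolding borel_eq_atMost by simp
      have "l (indicator UNIV) = l (indicator (UNIV - A)) + l (indicator A)"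
      proof -
        have "indicator UNIV = (\<lambda>u. indicator (UNIV - A) u + indicator A u :: real)"
          by (auto simp: indicator_def fun_eq_iff)
        moreover have "indicator A \<in> L2 T" by (rule ind[OF A])
        moreover have "indicator (UNIV - A) \<in> L2 T" by (rule ind) (use A in simp)
        ultimately show ?thesis using add[of "indicator (UNIV - A)" "indicator A"] by simp
      qed
      then show ?case using uni compl by simp
    next
      case (union A)
      then have A: "A i \<in> sets borel" for i unfolding borel_eq_atMost by auto
      have fin: "l (\<lambda>u. \<Sum>i<n. indicator (A i) u) = 0" for n
      proof (induction n)
        case (Suc n)
        have "l (\<lambda>u. (\<Sum>i<n. indicator (A i) u) + indicator (A n) u) = 0"
          using Suc union.IH[of n] by (subst add) (auto intro!: L2_sum ind A)
        then show ?case by simp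
      qed (simp add: zero)
      show ?case
      proof (rule limit[OF ind one, of _ "\<lambda>n u. \<Sum>i<n. indicator (A i) u"])
        show "(\<Union>i. A i) \<in> sets borel" using A by auto
        fix u :: real
        have eq: "(\<Sum>i<n. indicator (A i) u :: real) = indicator (\<Union>i<n. A i) u" for n
          using union.hyps(1) by (intro indicator_UN_disjoint[symmetric])
            (auto simp: disjoint_family_on_def)
        show "(\<lambda>n. \<Sum>i<n. indicator (A i) u :: real) \<longlonglongrightarrow> indicator (\<Union>i. A i) u"
          unfolding eq by (rule LIMSEQ_indicator_UN)
        show "\<bar>\<Sum>i<n. indicator (A i) u :: real\<bar> \<le> 1" for n unfolding eq by (simp add: indicator_def)
        show "(\<lambda>u. \<Sum>i<n. indicator (A i) u) \<in> L2 T" for n by (rule L2_sum) (rule ind[OF A])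
      qed (rule fin)
    qed
  qed
  obtain s where s: "\<forall>i. simple_function (time_measure T) (s i)" "\<forall>x\<in>space (time_measure T). (\<lambda>i. s i x) \<longlonglongrightarrow> h x"
    "\<forall>i. \<forall>x\<in>space (time_measure T). dist (s i x) 0 \<le> 2 * dist (h x) 0"
    using borel_measurable_implies_sequence_metric[OF L2_measurable[OF h], of 0] by blast
  show ?thesis
  proof (rule limit[OF h, of "\<lambda>u. 2 * \<bar>h u\<bar>" s])
    show "(\<lambda>u. 2 * \<bar>h u\<bar>) \<in> L2 T" by (intro L2_scale L2_abs h)
    fix n
    have fin: "finite (s n ` {0..T})" using simple_functionD(1)[of "time_measure T" "s n"] s(1) by simp
    have lev: "s n -` {y} \<inter> {0..T} \<in> sets borel" for y
      using simple_functionD(2)[of "time_measure T" "s n" "{y}"] s(1) by (simp add: sets_restrict_space_iff)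
    define k where "k = (\<lambda>u. \<Sum>y\<in>s n ` {0..T}. y * indicator (s n -` {y} \<inter> {0..T}) u)"
    have kL: "k \<in> L2 T" unfolding k_def by (intro L2_sum L2_scale ind lev)
    have eq: "s n u = k u" if "u \<in> {0..T}" for u
    proof -
      have "k u = (\<Sum>y\<in>s n ` {0..T}. if y = s n u then y else 0)"
        unfolding k_def using that by (intro sum.cong) (auto simp: indicator_def)
      then show ?thesis using that fin by simp
    qed
    define p where "p = (\<lambda>y u. y * indicator (s n -` {y} \<inter> {0..T}) u :: real)"
    have pL: "p y \<in> L2 T" for y unfolding p_def by (rule L2_scale[OF ind[OF lev]])
    have p0: "l (p y) = 0" for y unfolding p_def using scale[OF ind[OF lev], of y y] sets[OF lev[of y]] by simp
    have "l (\<lambda>u. \<Sum>y\<in>V. p y u) = 0" if "finite V" for V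
      using that
    proof induction
      case (insert y V)
      then show ?case using add[OF pL[of y] L2_sum[of V p], OF pL] p0[of y] by simp
    qed (simp add: zero)
    then have k0: "l k = 0" unfolding k_def p_def using fin by blast
    show sL: "s n \<in> L2 T"
    proof -
      have "integrable (time_measure T) (\<lambda>u. (s n u)\<^sup>2) \<longleftrightarrow> integrable (time_measure T) (\<lambda>u. (k u)\<^sup>2)"
        by (rule Bochner_Integration.integrable_cong) (use eq in auto)
      then show ?thesis
        using L2_integrable[OF kL] borel_measurable_simple_function s(1) unfolding L2_def by blast
    qed
    show "l (s n) = 0"
      by (rule limit[OF sL L2_abs[OF kL], of "\<lambda>_. k"]) (use kL k0 eq in auto)
  qed (use s in auto)
qed

text \<open>The conclusions of \<open>defines_rv\<close> at a single sample point, for the functionals in \<open>D\<close> only.\<close>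

definition weakly_represents ::
  "real \<Rightarrow> ('b::real_normed_vector \<Rightarrow>\<^sub>L real) set \<Rightarrow> (real \<Rightarrow> 'b) \<Rightarrow> 'b op \<Rightarrow> bool" where
  "weakly_represents T D f R \<longleftrightarrow> (\<forall>x\<in>D. (\<lambda>u. blinfun_apply x (f u)) \<in> L2 T \<and>
     (\<forall>h\<in>L2 T. blinfun_apply x (R h) = (\<integral>u. h u * blinfun_apply x (f u) \<partial>time_measure T)))"

lemma weakly_represents_diff:
  assumes R: "weakly_represents T D f R" and S: "weakly_represents T D g S"
  shows "weakly_represents T D (\<lambda>u. f u - g u) (op_diff R S)"
  unfolding weakly_represents_def
proof (intro ballI conjI)
  fix x assume "x \<in> D"
  then have f: "(\<lambda>u. blinfun_apply x (f u)) \<in> L2 T" and g: "(\<lambda>u. blinfun_apply x (g u)) \<in> L2 T"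
    and r: "\<And>h. h \<in> L2 T \<Longrightarrow> blinfun_apply x (R h) = (\<integral>u. h u * blinfun_apply x (f u) \<partial>time_measure T)"
      "\<And>h. h \<in> L2 T \<Longrightarrow> blinfun_apply x (S h) = (\<integral>u. h u * blinfun_apply x (g u) \<partial>time_measure T)"
    using R S unfolding weakly_represents_def by blast+
  show "(\<lambda>u. blinfun_apply x (f u - g u)) \<in> L2 T" using L2_diff[OF f g] by (simp add: blinfun.diff_right)
  fix h assume h: "h \<in> L2 T"
  show "blinfun_apply x (op_diff R S h) = (\<integral>u. h u * blinfun_apply x (f u - g u) \<partial>time_measure T)"
    using L2_integrable_mult[OF h f] L2_integrable_mult[OF h g] r[OF h]
    by (simp add: op_diff_def blinfun.diff_right right_diff_distrib)
qed

text \<open>The two sides of the defining equation are bounded linear functionals of the test function, and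
  almost surely they agree for all functionals in \<open>D\<close> and all rational step functions. So their difference
  vanishes by \<open>L2_functional_zero\<close>.\<close>

lemma defines_rv_weakly_represents:
  fixes X :: "'a \<Rightarrow> 'b::{banach, second_countable_topology} op"
  assumes def: "defines_rv M T \<phi> X" and X: "\<And>\<omega>. \<omega> \<in> space M \<Longrightarrow> X \<omega> \<in> L2_operators T" and D: "countable D"
  shows "AE \<omega> in M. weakly_represents T D (\<lambda>u. \<phi> (u, \<omega>)) (X \<omega>)"
proof -
  have ind: "indicator {..q} \<in> L2 T" for q :: real
    by (intro L2_bounded[of _ _ 1]) (auto simp: indicator_def intro!: measurable_restrict_space1)
  have "AE \<omega> in M. \<forall>x\<in>D. (\<lambda>u. blinfun_apply x (\<phi> (u, \<omega>))) \<in> L2 T"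
    using def D by (intro AE_ball_countable') (auto simp: defines_rv_def)
  moreover have "AE \<omega> in M. \<forall>x\<in>D. \<forall>q\<in>\<rat>. blinfun_apply x (X \<omega> (indicator {..q})) =
      (\<integral>u. indicator {..q} u * blinfun_apply x (\<phi> (u, \<omega>)) \<partial>time_measure T)"
    using def D countable_rat ind by (intro AE_ball_countable') (auto simp: defines_rv_def)
  ultimately show ?thesis using AE_space
  proof eventually_elim
    case (elim \<omega>)
    have op: "X \<omega> \<in> L2_operators T" by (rule X[OF elim(3)])
    show ?case unfolding weakly_represents_def
    proof (intro ballI conjI)
      fix x assume x: "x \<in> D"
      show k: "(\<lambda>u. blinfun_apply x (\<phi> (u, \<omega>))) \<in> L2 T" using elim(1) x by blast
      define k where "k = (\<lambda>u. blinfun_apply x (\<phi> (u, \<omega>)))"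
      have kL: "k \<in> L2 T" using k by (simp add: k_def)
      note km = L2_measurable[OF kL] and kf = kL[unfolded L2_iff, THEN conjunct2]
      define l where "l = (\<lambda>h. blinfun_apply x (X \<omega> h) - rep_op T k h)"
      obtain C where C: "C \<ge> 0" "\<And>h. h \<in> L2 T \<Longrightarrow> norm (X \<omega> h) \<le> C * sqrt (L2_inner T h h)"
        using L2_operatorsD(4)[OF op] by blast
      obtain C' where C': "C' \<ge> 0" "\<And>h. h \<in> L2 T \<Longrightarrow> norm (rep_op T k h) \<le> C' * sqrt (L2_inner T h h)"
        using L2_operatorsD(4)[OF rep_op_L2_operators[OF km kf]] by blast
      fix h assume h: "h \<in> L2 T"
      have "l h = 0"
      proof (rule L2_functional_zero[OF _ _ _ _ h, of l "norm x * C + C'"])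
        show "l (\<lambda>u. h u + k u) = l h + l k" if "h \<in> L2 T" "k \<in> L2 T" for h k
          using that L2_operatorsD(1)[OF op that] L2_operatorsD(1)[OF rep_op_L2_operators[OF km kf] that]
          by (simp add: l_def blinfun.add_right)
        show "l (\<lambda>u. c * h u) = c * l h" if "h \<in> L2 T" for h c
          using that L2_operatorsD(2)[OF op that] L2_operatorsD(2)[OF rep_op_L2_operators[OF km kf] that]
          by (simp add: l_def blinfun.scaleR_right right_diff_distrib)
        show "\<bar>l h\<bar> \<le> (norm x * C + C') * sqrt (L2_inner T h h)" if h: "h \<in> L2 T" for h
        proof -
          have "\<bar>blinfun_apply x (X \<omega> h)\<bar> \<le> norm x * norm (X \<omega> h)"
            using norm_blinfun[of x "X \<omega> h"] by simp
          also have "\<dots> \<le> norm x * (C * sqrt (L2_inner T h h))" by (rule mult_left_mono[OF C(2)[OF h]]) simp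
          finally show ?thesis using C'(2)[OF h] by (simp add: l_def distrib_right mult.assoc)
        qed
        show "l (indicator {..q}) = 0" if "q \<in> \<rat>" for q
          using elim(2) x that ind[of q] by (simp add: l_def rep_op_def k_def)
      qed
      then show "blinfun_apply x (X \<omega> h) = (\<integral>u. h u * blinfun_apply x (\<phi> (u, \<omega>)) \<partial>time_measure T)"
        using h by (simp add: l_def rep_op_def k_def)
    qed
  qed
qed

lemma weakly_represents_integral:
  fixes f :: "real \<Rightarrow> 'b::{banach, second_countable_topology}"
  assumes sep: "separating D" and w: "weakly_represents T D f R" and h: "h \<in> L2 T"
    and int: "integrable (time_measure T) (\<lambda>u. h u *\<^sub>R f u)"
  shows "R h = (\<integral>u. h u *\<^sub>R f u \<partial>time_measure T)"
proof -
  have "blinfun_apply x (R h) = blinfun_apply x (\<integral>u. h u *\<^sub>R f u \<partial>time_measure T)" if "x \<in> D" for x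
    using w h that
    by (simp add: weakly_represents_def integral_bounded_linear[OF blinfun.bounded_linear_right int, symmetric]
        blinfun.scaleR_right)
  then show ?thesis using sep unfolding separating_def by blast
qed

lemma weakly_represents_rep_op:
  fixes f :: "real \<Rightarrow> 'b::{banach, second_countable_topology}"
  assumes sep: "separating D" and w: "weakly_represents T D f R" and R: "R \<in> L2_operators T"
    and f: "f \<in> borel_measurable (time_measure T)" "(\<integral>\<^sup>+u. nsq (f u) \<partial>time_measure T) < \<infinity>"
  shows "R = rep_op T f"
proof
  fix h show "R h = rep_op T f h"
    using weakly_represents_integral[OF sep w _ integrable_scaleR_L2[OF _ f]] L2_operatorsD(3)[OF R]
    by (cases "h \<in> L2 T") (simp_all add: rep_op_def)
qed

text \<open>Integrability of \<open>f\<close> is a consequence of the embedding below and is not known in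
  advance. For this reason only sets on which \<open>f\<close> is bounded are tested.\<close>

definition represents :: "real \<Rightarrow> (real \<Rightarrow> 'b::{banach, second_countable_topology}) \<Rightarrow> 'b op \<Rightarrow> bool" where
  "represents T f R \<longleftrightarrow> (\<forall>A\<in>sets (time_measure T). \<forall>B. (\<forall>u\<in>A. norm (f u) \<le> B) \<longrightarrow>
     R (indicator A) = (\<integral>u. indicator A u *\<^sub>R f u \<partial>time_measure T))"

lemma weakly_represents_imp_represents:
  fixes f :: "real \<Rightarrow> 'b::{banach, second_countable_topology}"
  assumes sep: "separating D" and w: "weakly_represents T D f R"
    and f[measurable]: "f \<in> borel_measurable (time_measure T)"
  shows "represents T f R"
  unfolding represents_def
proof (intro ballI allI impI)
  fix A B assume A[measurable]: "A \<in> sets (time_measure T)" and B: "\<forall>u\<in>A. norm (f u) \<le> B"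
  interpret finite_measure "time_measure T" by (rule finite_measure_time)
  have "integrable (time_measure T) (\<lambda>u. indicator A u *\<^sub>R f u)"
    by (rule integrable_const_bound[of _ "max 0 B"]) (use B in \<open>auto simp: indicator_def intro!: AE_I2\<close>)
  then show "R (indicator A) = (\<integral>u. indicator A u *\<^sub>R f u \<partial>time_measure T)"
    by (rule weakly_represents_integral[OF sep w L2_indicator[OF A]])
qed

section \<open>The norm of an operator and the norm of its function\<close>

lemma gamma_norm_sq_alt: "gamma_norm_sq T R = (SUP (n, h) \<in> orthonormal_systems T. gauss_sq n (\<lambda>j. R (h j)))"
  by (simp add: gamma_norm_sq_def gauss_sq_def)

lemma gauss_sq_le_gamma_norm_sq:
  "(n, h) \<in> orthonormal_systems T \<Longrightarrow> gauss_sq n (\<lambda>j. R (h j)) \<le> gamma_norm_sq T R"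
  unfolding gamma_norm_sq_alt by (rule SUP_upper2[of "(n, h)"]) auto

text \<open>Normalized indicators of disjoint sets are orthonormal, so the squared norms of the averages of
  \<open>f\<close> over the sets, weighted by the measures of the sets, are controlled by the norm of \<open>R\<close>.\<close>

lemma averages_le_gamma_norm_sq:
  fixes R :: "'b::{banach, second_countable_topology} op"
  assumes C: "gauss_cotype_2 TYPE('b) C" and R: "R \<in> L2_operators T"
    and A: "\<And>i. i \<in> I \<Longrightarrow> A i \<in> sets (time_measure T)" "\<And>i. i \<in> I \<Longrightarrow> measure (time_measure T) (A i) > 0"
    and dis: "disjoint_family_on A I" and I: "finite I"
  shows "ennreal (\<Sum>i\<in>I. (norm (R (indicator (A i))))\<^sup>2 / measure (time_measure T) (A i)) \<le>
    ennreal C * gamma_norm_sq T R"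
proof -
  define \<mu> where "\<mu> = (\<lambda>i. measure (time_measure T) (A i))"
  interpret finite_measure "time_measure T" by (rule finite_measure_time)
  define h where "h = (\<lambda>i u. 1 / sqrt (\<mu> i) * indicator (A i) u :: real)"
  have \<mu>: "\<mu> i > 0" if "i \<in> I" for i using A(2)[OF that] by (simp add: \<mu>_def)
  have hL: "h i \<in> L2 T" if "i \<in> I" for i
    unfolding h_def by (intro L2_scale L2_indicator A that)
  have inner: "L2_inner T (h i) (h j) = (if i = j then 1 else 0)" if ij: "i \<in> I" "j \<in> I" for i j
  proof (cases "i = j")
    case True
    have "L2_inner T (h i) (h i) = (\<integral>u. 1 / \<mu> i * indicator (A i) u \<partial>time_measure T)"
      unfolding L2_inner_def h_def using \<mu>[OF ij(1)]
      by (intro Bochner_Integration.integral_cong) (auto simp: indicator_def)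
    also have "\<dots> = 1" using \<mu>[OF ij(1)] sets.Int_space_eq2[OF A(1)[OF ij(1)]] by (simp add: \<mu>_def)
    finally show ?thesis using True by simp
  next
    case False
    then have "A i \<inter> A j = {}" using dis ij by (auto simp: disjoint_family_on_def)
    then have "h i u * h j u = 0" for u by (auto simp: h_def indicator_def)
    then have "L2_inner T (h i) (h j) = 0" unfolding L2_inner_def by (simp only: Bochner_Integration.integral_zero)
    then show ?thesis using False by simp
  qed
  obtain b where b: "bij_betw b {..<card I} I" using ex_bij_betw_nat_finite[OF I] by (auto simp: lessThan_atLeast0)
  have bI: "b j \<in> I" if "j < card I" for j using b that by (auto simp: bij_betw_def)
  have binj: "b i = b j \<longleftrightarrow> i = j" if "i < card I" "j < card I" for i j
    using b that by (auto simp: bij_betw_def inj_on_def)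
  have on: "(card I, \<lambda>j. h (b j)) \<in> orthonormal_systems T"
    unfolding orthonormal_systems_def using hL bI inner binj by auto
  have Rh: "(norm (R (h i)))\<^sup>2 = (norm (R (indicator (A i))))\<^sup>2 / \<mu> i" if "i \<in> I" for i
    unfolding h_def L2_operatorsD(2)[OF R L2_indicator[OF A(1)[OF that]]]
    using \<mu>[OF that] by (simp add: power_mult_distrib power_divide)
  have "(\<Sum>i\<in>I. (norm (R (indicator (A i))))\<^sup>2 / \<mu> i) = (\<Sum>j<card I. (norm (R (h (b j))))\<^sup>2)"
    using Rh by (subst sum.reindex_bij_betw[OF b, symmetric]) (auto intro!: sum.cong simp: bI)
  also have "ennreal \<dots> \<le> ennreal C * gauss_sq (card I) (\<lambda>j. R (h (b j)))"
    using C[unfolded gauss_cotype_2_def, THEN conjunct2, rule_format, of "\<lambda>j. R (h (b j))" "card I"] .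
  also have "\<dots> \<le> ennreal C * gamma_norm_sq T R"
    by (intro mult_left_mono gauss_sq_le_gamma_norm_sq on) auto
  finally show ?thesis by (simp add: \<mu>_def)
qed

text \<open>The level sets \<open>A i\<close> on which \<open>f\<close> stays \<open>e\<close>-close to a point \<open>c i\<close> of a dense
  sequence are disjoint and cover \<open>[0,T]\<close>; on \<open>A i\<close> the norm of \<open>f\<close> exceeds the norm of its average
  by at most \<open>2 * e\<close>.\<close>

lemma cotype_embedding_approx:
  fixes f :: "real \<Rightarrow> 'b::{banach, second_countable_topology}"
  assumes C: "gauss_cotype_2 TYPE('b) C" and R: "R \<in> L2_operators T"
    and f[measurable]: "f \<in> borel_measurable (time_measure T)" and rep: "represents T f R" and e: "e > 0"
  shows "(\<integral>\<^sup>+u. ennreal ((max 0 (norm (f u) - 2 * e))\<^sup>2) \<partial>time_measure T) \<le> ennreal C * gamma_norm_sq T R"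
proof -
  interpret finite_measure "time_measure T" by (rule finite_measure_time)
  obtain B :: "'b set" where B: "countable B" "\<And>U. open U \<Longrightarrow> U \<noteq> {} \<Longrightarrow> \<exists>d\<in>B. d \<in> U"
    using countable_dense_exists by metis
  have "B \<noteq> {}" using B(2)[of UNIV] by auto
  define c where "c = from_nat_into B"
  have dense: "\<exists>i. dist x (c i) < e" for x
  proof -
    obtain d where "d \<in> B" "d \<in> ball x e" using B(2)[of "ball x e"] e by auto
    then obtain i where "c i = d" using from_nat_into_surj[OF B(1)] unfolding c_def by blast
    then show ?thesis using \<open>d \<in> ball x e\<close> by (auto simp: ball_def)
  qed
  define P where "P = disjointed (\<lambda>i. ball (c i) e)"
  define A where "A = (\<lambda>i. f -` P i \<inter> {0..T})"
  have Pm: "P i \<in> sets borel" for i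
    unfolding P_def by (rule subsetD[OF sets.range_disjointed_sets[of "\<lambda>i. ball (c i) e"]]) auto
  have Am[measurable]: "A i \<in> sets (time_measure T)" for i
    using measurable_sets[OF f Pm[of i]] by (simp add: A_def)
  have dis: "disjoint_family A"
    using disjoint_family_disjointed[of "\<lambda>i. ball (c i) e"]
    unfolding A_def P_def disjoint_family_on_def by blast
  have close: "norm (f u - c i) \<le> e" if "u \<in> A i" for u i
    using that disjointed_subset[of "\<lambda>i. ball (c i) e" i]
    by (auto simp: A_def P_def dist_norm norm_minus_commute intro!: less_imp_le)
  have cover: "(\<Union>i. A i) = {0..T}"
  proof -
    have "(\<Union>i. P i) = UNIV" unfolding P_def UN_disjointed_eq using dense by (auto simp: dist_commute)
    then show ?thesis unfolding A_def by blast
  qed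
  define q where "q = (\<lambda>u. (max 0 (norm (f u) - 2 * e))\<^sup>2)"
  have [measurable]: "q \<in> borel_measurable (time_measure T)" unfolding q_def by measurable
  have piece: "(\<integral>\<^sup>+u. ennreal (q u) * indicator (A i) u \<partial>time_measure T) \<le>
      ennreal ((norm (R (indicator (A i))))\<^sup>2 / measure (time_measure T) (A i))"
    if pos: "measure (time_measure T) (A i) > 0" for i
  proof -
    define \<mu> where "\<mu> = measure (time_measure T) (A i)"
    have bd: "\<forall>u\<in>A i. norm (f u) \<le> norm (c i) + e"
    proof
      fix u assume "u \<in> A i"
      then show "norm (f u) \<le> norm (c i) + e"
        using close[of u i] norm_triangle_ineq[of "f u - c i" "c i"] by simp
    qed
    have int: "integrable (time_measure T) (\<lambda>u. indicator (A i) u *\<^sub>R f u)"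
      by (rule integrable_const_bound[of _ "norm (c i) + e"])
        (use bd e in \<open>auto simp: indicator_def intro!: AE_I2 add_nonneg_nonneg less_imp_le\<close>)
    have intc: "integrable (time_measure T) (\<lambda>u. indicator (A i) u *\<^sub>R c i)"
      by (intro integrable_scaleR_left impI integrable_real_indicator Am) (simp add: emeasure_eq_measure)
    have "R (indicator (A i)) - \<mu> *\<^sub>R c i = (\<integral>u. indicator (A i) u *\<^sub>R f u - indicator (A i) u *\<^sub>R c i \<partial>time_measure T)"
    proof -
      have "R (indicator (A i)) = (\<integral>u. indicator (A i) u *\<^sub>R f u \<partial>time_measure T)"
        using rep bd Am[of i] unfolding represents_def by blast
      moreover have "(\<integral>u. indicator (A i) u *\<^sub>R c i \<partial>time_measure T) = \<mu> *\<^sub>R c i"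
        using sets.Int_space_eq2[OF Am[of i]] by (subst integral_scaleR_left)
          (auto simp: \<mu>_def emeasure_eq_measure intro!: integrable_real_indicator)
      ultimately show ?thesis by (simp only: Bochner_Integration.integral_diff[OF int intc])
    qed
    also have "norm \<dots> \<le> (\<integral>u. norm (indicator (A i) u *\<^sub>R f u - indicator (A i) u *\<^sub>R c i) \<partial>time_measure T)"
      by (rule integral_norm_bound)
    also have "\<dots> \<le> (\<integral>u. e * indicator (A i) u \<partial>time_measure T)"
    proof (rule integral_mono)
      show "integrable (time_measure T) (\<lambda>u. norm (indicator (A i) u *\<^sub>R f u - indicator (A i) u *\<^sub>R c i))"
        by (intro integrable_norm Bochner_Integration.integrable_diff int intc)
      show "integrable (time_measure T) (\<lambda>u. e * indicator (A i) u)"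
        by (intro integrable_mult_right integrable_real_indicator Am) (simp add: emeasure_eq_measure)
      fix u show "norm (indicator (A i) u *\<^sub>R f u - indicator (A i) u *\<^sub>R c i) \<le> e * indicator (A i) u"
        using close[of u i] by (cases "u \<in> A i") simp_all
    qed
    also have "\<dots> = e * \<mu>" using sets.Int_space_eq2[OF Am[of i]] by (simp add: \<mu>_def)
    finally have near: "norm (R (indicator (A i)) - \<mu> *\<^sub>R c i) \<le> e * \<mu>" .
    have mpos: "\<mu> > 0" using pos by (simp add: \<mu>_def)
    have low: "\<mu> * (norm (c i) - e) \<le> norm (R (indicator (A i)))"
      using near norm_triangle_ineq2[of "\<mu> *\<^sub>R c i" "R (indicator (A i))"] mpos
      by (simp add: norm_minus_commute algebra_simps)
    have "q u \<le> (norm (R (indicator (A i))) / \<mu>)\<^sup>2" if "u \<in> A i" for u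
    proof -
      have "norm (f u) \<le> norm (c i) + e" using bd that by blast
      then have "norm (f u) - 2 * e \<le> norm (c i) - e" by simp
      also have "\<dots> \<le> norm (R (indicator (A i))) / \<mu>" using low mpos by (simp add: field_simps)
      finally show ?thesis unfolding q_def using mpos by (intro power_mono) auto
    qed
    then have "(\<integral>\<^sup>+u. ennreal (q u) * indicator (A i) u \<partial>time_measure T) \<le>
        (\<integral>\<^sup>+u. ennreal ((norm (R (indicator (A i))) / \<mu>)\<^sup>2) * indicator (A i) u \<partial>time_measure T)"
      by (intro nn_integral_mono) (auto simp: indicator_def intro!: ennreal_leI)
    also have "\<dots> = ennreal ((norm (R (indicator (A i))) / \<mu>)\<^sup>2 * \<mu>)"
      by (subst nn_integral_cmult_indicator) (simp_all add: \<mu>_def emeasure_eq_measure ennreal_mult)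
    also have "(norm (R (indicator (A i))) / \<mu>)\<^sup>2 * \<mu> = (norm (R (indicator (A i))))\<^sup>2 / \<mu>"
      using mpos by (simp add: power2_eq_square field_simps)
    finally show ?thesis by (simp add: \<mu>_def)
  qed
  have fin: "(\<Sum>i<n. \<integral>\<^sup>+u. ennreal (q u) * indicator (A i) u \<partial>time_measure T) \<le> ennreal C * gamma_norm_sq T R" for n
  proof -
    define I where "I = {i. i < n \<and> measure (time_measure T) (A i) > 0}"
    have I: "I \<subseteq> {..<n}" "finite I" by (auto simp: I_def)
    have null: "(\<integral>\<^sup>+u. ennreal (q u) * indicator (A i) u \<partial>time_measure T) = 0" if "i \<in> {..<n} - I" for i
    proof -
      have "measure (time_measure T) (A i) = 0" using that measure_nonneg[of "time_measure T" "A i"]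
        unfolding I_def by (simp add: order.order_iff_strict)
      then have "A i \<in> null_sets (time_measure T)" by (intro null_setsI) (auto simp: emeasure_eq_measure)
      then show ?thesis by (rule nn_integral_null_set)
    qed
    have "(\<Sum>i<n. \<integral>\<^sup>+u. ennreal (q u) * indicator (A i) u \<partial>time_measure T) =
        (\<Sum>i\<in>I. \<integral>\<^sup>+u. ennreal (q u) * indicator (A i) u \<partial>time_measure T)"
      by (rule sum.mono_neutral_right) (use I null in auto)
    also have "\<dots> \<le> (\<Sum>i\<in>I. ennreal ((norm (R (indicator (A i))))\<^sup>2 / measure (time_measure T) (A i)))"
      by (intro sum_mono piece) (auto simp: I_def)
    also have "\<dots> = ennreal (\<Sum>i\<in>I. (norm (R (indicator (A i))))\<^sup>2 / measure (time_measure T) (A i))"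
      by (rule sum_ennreal) simp
    also have "\<dots> \<le> ennreal C * gamma_norm_sq T R"
    proof (rule averages_le_gamma_norm_sq[OF C R])
      show "disjoint_family_on A I" using dis by (rule disjoint_family_on_mono[rotated]) simp
    qed (auto simp: I_def)
    finally show ?thesis .
  qed
  have "(\<integral>\<^sup>+u. ennreal (q u) \<partial>time_measure T) = (\<integral>\<^sup>+u. (\<Sum>i. ennreal (q u) * indicator (A i) u) \<partial>time_measure T)"
  proof (rule nn_integral_cong)
    fix u assume "u \<in> space (time_measure T)"
    then have "(\<Sum>i. indicator (A i) u) = (1 :: ennreal)"
      using suminf_indicator[OF dis, of u] cover by simp
    then show "ennreal (q u) = (\<Sum>i. ennreal (q u) * indicator (A i) u)" by simp
  qed
  also have "\<dots> = (\<Sum>i. \<integral>\<^sup>+u. ennreal (q u) * indicator (A i) u \<partial>time_measure T)"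
    by (rule nn_integral_suminf) measurable
  also have "\<dots> \<le> ennreal C * gamma_norm_sq T R"
    using fin by (intro suminf_le_const) auto
  finally show ?thesis by (simp add: q_def)
qed

text \<open>Fatou's lemma, as the error \<open>e\<close> of the preceding lemma tends to \<open>0\<close>.\<close>

lemma cotype_embedding:
  fixes f :: "real \<Rightarrow> 'b::{banach, second_countable_topology}"
  assumes C: "gauss_cotype_2 TYPE('b) C" and R: "R \<in> L2_operators T"
    and f[measurable]: "f \<in> borel_measurable (time_measure T)" and rep: "represents T f R"
  shows "(\<integral>\<^sup>+u. nsq (f u) \<partial>time_measure T) \<le> ennreal C * gamma_norm_sq T R"
proof -
  define q where "q = (\<lambda>k u. ennreal ((max 0 (norm (f u) - 2 * (1 / real (Suc k))))\<^sup>2))"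
  have lim: "(\<lambda>k. q k u) \<longlonglongrightarrow> nsq (f u)" for u
  proof -
    have "(\<lambda>k. (max 0 (norm (f u) - 2 * (1 / real (Suc k))))\<^sup>2) \<longlonglongrightarrow> (max 0 (norm (f u) - 2 * 0))\<^sup>2"
      by (intro tendsto_intros LIMSEQ_Suc[OF lim_1_over_n])
    then show ?thesis unfolding q_def by (intro tendsto_ennrealI) simp
  qed
  have "(\<integral>\<^sup>+u. nsq (f u) \<partial>time_measure T) = (\<integral>\<^sup>+u. liminf (\<lambda>k. q k u) \<partial>time_measure T)"
    using lim by (intro nn_integral_cong lim_imp_Liminf[symmetric]) auto
  also have "\<dots> \<le> liminf (\<lambda>k. \<integral>\<^sup>+u. q k u \<partial>time_measure T)"
    by (rule nn_integral_liminf) (simp add: q_def)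
  also have "\<dots> \<le> ennreal C * gamma_norm_sq T R"
  proof (rule Liminf_le)
    show "eventually (\<lambda>k. (\<integral>\<^sup>+u. q k u \<partial>time_measure T) \<le> ennreal C * gamma_norm_sq T R) sequentially"
      unfolding q_def by (intro always_eventually allI cotype_embedding_approx[OF C R f rep]) simp
  qed simp
  finally show ?thesis .
qed

lemma hilbert_gauss_cotype_2: "hilbert_space TYPE('b::banach) \<Longrightarrow> gauss_cotype_2 TYPE('b) 1"
  by (simp add: gauss_cotype_2_def hilbert_gauss_sq)

text \<open>Boundedness of the inner product is the Cauchy--Schwarz inequality: for unit vectors it follows
  from the nonnegativity of the squared norms of \<open>x + y\<close> and \<open>x - y\<close>.\<close>

lemma hilbert_inner_product:
  assumes "hilbert_space TYPE('b::banach)"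
  shows "\<exists>ip :: 'b::banach \<Rightarrow> 'b \<Rightarrow> real. bilinear ip \<and> (\<forall>x y. ip x y = ip y x) \<and>
    (\<forall>x. ip x x = (norm x)\<^sup>2) \<and> (\<forall>a. bounded_linear (\<lambda>x. ip x a))"
proof -
  obtain ip :: "'b \<Rightarrow> 'b \<Rightarrow> real" where ip: "bilinear ip" "\<And>x y. ip x y = ip y x" "\<And>x. norm x = sqrt (ip x x)"
    using assms unfolding hilbert_space_def by blast
  have nsq: "ip x x = (norm x)\<^sup>2" for x
    using ip(3)[of x] norm_ge_zero[of x] by (metis real_sqrt_ge_0_iff real_sqrt_pow2)
  have unit: "\<bar>ip x y\<bar> \<le> 1" if "norm x = 1" "norm y = 1" for x y
  proof -
    have "ip (x + y) (x + y) = ip x x + 2 * ip x y + ip y y"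
      by (simp add: bilinear_ladd[OF ip(1)] bilinear_radd[OF ip(1)] ip(2)[of y x])
    moreover have "ip (x - y) (x - y) = ip x x - 2 * ip x y + ip y y"
      by (simp add: bilinear_lsub[OF ip(1)] bilinear_rsub[OF ip(1)] ip(2)[of y x])
    moreover have "ip (x + y) (x + y) \<ge> 0" "ip (x - y) (x - y) \<ge> 0" by (simp_all add: nsq)
    ultimately show ?thesis using that by (simp add: nsq)
  qed
  have bl: "bounded_linear (\<lambda>x. ip x a)" for a
  proof (intro bounded_linear.intro bounded_linear_axioms.intro exI[of _ "norm a"] allI)
    show "linear (\<lambda>x. ip x a)" using ip(1) by (simp add: bilinear_def)
    show "norm (ip x a) \<le> norm x * norm a" for x
    proof (cases "x = 0 \<or> a = 0")
      case True
      then show ?thesis by (auto simp: bilinear_lzero[OF ip(1)] bilinear_rzero[OF ip(1)])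
    next
      case False
      have "ip x a = norm x * norm a * ip (x /\<^sub>R norm x) (a /\<^sub>R norm a)"
        unfolding bilinear_lmul[OF ip(1)] bilinear_rmul[OF ip(1)] using False by (simp add: field_simps)
      also have "\<bar>\<dots>\<bar> \<le> norm x * norm a * 1"
      proof -
        have "\<bar>ip (x /\<^sub>R norm x) (a /\<^sub>R norm a)\<bar> \<le> 1" by (rule unit) (use False in simp_all)
        then show ?thesis by (simp add: abs_mult mult_left_le)
      qed
      finally show ?thesis by simp
    qed
  qed
  show ?thesis using ip(1,2) nsq bl by (intro exI[of _ ip] conjI allI)
qed

text \<open>Bessel's inequality with vector coefficients \<open>a j = \<integral> h j f\<close>: the squared distance of \<open>f\<close>
  to \<open>\<Sum> h j a j\<close> integrates to the difference of the two sides.\<close>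

lemma bessel_inequality:
  fixes f :: "real \<Rightarrow> 'b::{banach, second_countable_topology}"
  assumes H: "hilbert_space TYPE('b)" and on: "(n, h) \<in> orthonormal_systems T"
    and f: "f \<in> borel_measurable (time_measure T)" "(\<integral>\<^sup>+u. nsq (f u) \<partial>time_measure T) < \<infinity>"
  shows "ennreal (\<Sum>j<n. (norm (rep_op T f (h j)))\<^sup>2) \<le> (\<integral>\<^sup>+u. nsq (f u) \<partial>time_measure T)"
proof -
  obtain ip :: "'b \<Rightarrow> 'b \<Rightarrow> real" where ip': "bilinear ip \<and> (\<forall>x y. ip x y = ip y x) \<and>
      (\<forall>x. ip x x = (norm x)\<^sup>2) \<and> (\<forall>a. bounded_linear (\<lambda>x. ip x a))"
    using hilbert_inner_product[OF H] ..
  have ip: "bilinear ip" "ip x y = ip y x" "ip x x = (norm x)\<^sup>2" "bounded_linear (\<lambda>x. ip x a)" for x y a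
    using ip' by simp_all
  have hL: "h j \<in> L2 T" if "j < n" for j using on that by (simp add: orthonormal_systems_def)
  have orth: "(\<integral>u. h i u * h j u \<partial>time_measure T) = (if i = j then 1 else 0)" if "i < n" "j < n" for i j
    using on that by (simp add: orthonormal_systems_def L2_inner_def)
  define a where "a = (\<lambda>j. rep_op T f (h j))"
  note int = integrable_scaleR_L2[OF hL f]
  have cross: "integrable (time_measure T) (\<lambda>u. h j u * ip (f u) (a j))"
    "(\<integral>u. h j u * ip (f u) (a j) \<partial>time_measure T) = (norm (a j))\<^sup>2" if j: "j < n" for j
  proof -
    have eq: "h j u * ip (f u) (a j) = ip (h j u *\<^sub>R f u) (a j)" for u
      by (simp add: bilinear_lmul[OF ip(1)])
    show "integrable (time_measure T) (\<lambda>u. h j u * ip (f u) (a j))"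
      unfolding eq by (rule integrable_bounded_linear[OF ip(4) int[OF j]])
    show "(\<integral>u. h j u * ip (f u) (a j) \<partial>time_measure T) = (norm (a j))\<^sup>2"
      unfolding eq integral_bounded_linear[OF ip(4) int[OF j]] ip(3)[symmetric]
      by (simp add: a_def rep_op_def hL[OF j])
  qed
  have quad: "integrable (time_measure T) (\<lambda>u. h i u * h j u * ip (a i) (a j))"
    "(\<integral>u. h i u * h j u * ip (a i) (a j) \<partial>time_measure T) = (if i = j then ip (a i) (a j) else 0)"
    if "i < n" "j < n" for i j
    using L2_integrable_mult[OF hL hL] that orth[OF that] by simp_all
  have f2: "integrable (time_measure T) (\<lambda>u. (norm (f u))\<^sup>2)" using f by (simp add: integrable_nsq_iff)
  have expand: "(norm (f u - (\<Sum>j<n. h j u *\<^sub>R a j)))\<^sup>2 = (norm (f u))\<^sup>2 -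
      2 * (\<Sum>j<n. h j u * ip (f u) (a j)) + (\<Sum>i<n. \<Sum>j<n. h i u * h j u * ip (a i) (a j))" for u
  proof -
    define G where "G = (\<Sum>j<n. h j u *\<^sub>R a j)"
    have fG: "ip x G = (\<Sum>j<n. h j u * ip x (a j))" for x
      using linear_sum[of "ip x" "\<lambda>j. h j u *\<^sub>R a j" "{..<n}"] ip(1)
      by (simp add: G_def bilinear_def bilinear_rmul[OF ip(1)])
    have GG: "ip G G = (\<Sum>i<n. \<Sum>j<n. h i u * h j u * ip (a i) (a j))"
      unfolding fG[of G] ip(2)[of G] fG
      by (simp add: sum_distrib_left mult.assoc ip(2))
    have "(norm (f u - G))\<^sup>2 = ip (f u) (f u) - 2 * ip (f u) G + ip G G"
      unfolding ip(3)[symmetric] by (simp add: bilinear_lsub[OF ip(1)] bilinear_rsub[OF ip(1)] ip(2)[of G "f u"])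
    then show ?thesis unfolding GG fG[of "f u"] by (simp add: G_def ip(3))
  qed
  have "0 \<le> (\<integral>u. (norm (f u - (\<Sum>j<n. h j u *\<^sub>R a j)))\<^sup>2 \<partial>time_measure T)"
    by (rule Bochner_Integration.integral_nonneg) simp
  also have "\<dots> = (\<integral>u. (norm (f u))\<^sup>2 \<partial>time_measure T) -
      2 * (\<Sum>j<n. (norm (a j))\<^sup>2) + (\<Sum>i<n. \<Sum>j<n. if i = j then ip (a i) (a j) else 0)"
  proof -
    have 1: "integrable (time_measure T) (\<lambda>u. 2 * (\<Sum>j<n. h j u * ip (f u) (a j)))"
      by (intro integrable_mult_right Bochner_Integration.integrable_sum cross(1)) simp
    have 2: "integrable (time_measure T) (\<lambda>u. \<Sum>i<n. \<Sum>j<n. h i u * h j u * ip (a i) (a j))"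
      by (intro Bochner_Integration.integrable_sum quad(1)) simp_all
    have 3: "(\<integral>u. 2 * (\<Sum>j<n. h j u * ip (f u) (a j)) \<partial>time_measure T) = 2 * (\<Sum>j<n. (norm (a j))\<^sup>2)"
    proof -
      have "(\<integral>u. (\<Sum>j<n. h j u * ip (f u) (a j)) \<partial>time_measure T) = (\<Sum>j<n. \<integral>u. h j u * ip (f u) (a j) \<partial>time_measure T)"
        by (rule Bochner_Integration.integral_sum) (use cross(1) in blast)
      also have "\<dots> = (\<Sum>j<n. (norm (a j))\<^sup>2)" by (rule sum.cong[OF refl], rule cross(2)) simp
      finally show ?thesis by simp
    qed
    have 4: "(\<integral>u. (\<Sum>i<n. \<Sum>j<n. h i u * h j u * ip (a i) (a j)) \<partial>time_measure T) =
        (\<Sum>i<n. \<Sum>j<n. if i = j then ip (a i) (a j) else 0)"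
    proof -
      have "(\<integral>u. (\<Sum>i<n. \<Sum>j<n. h i u * h j u * ip (a i) (a j)) \<partial>time_measure T) =
          (\<Sum>i<n. \<integral>u. (\<Sum>j<n. h i u * h j u * ip (a i) (a j)) \<partial>time_measure T)"
        by (intro Bochner_Integration.integral_sum Bochner_Integration.integrable_sum quad(1)) simp_all
      also have "\<dots> = (\<Sum>i<n. \<Sum>j<n. \<integral>u. h i u * h j u * ip (a i) (a j) \<partial>time_measure T)"
        by (intro sum.cong[OF refl] Bochner_Integration.integral_sum quad(1)) simp_all
      also have "\<dots> = (\<Sum>i<n. \<Sum>j<n. if i = j then ip (a i) (a j) else 0)"
        by (intro sum.cong[OF refl] quad(2)) simp_all
      finally show ?thesis .
    qed
    show ?thesis unfolding expand
      by (subst Bochner_Integration.integral_add[OF Bochner_Integration.integrable_diff[OF f2 1] 2],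
          subst Bochner_Integration.integral_diff[OF f2 1]) (simp only: 3 4)
  qed
  also have "(\<Sum>i<n. \<Sum>j<n. if i = j then ip (a i) (a j) else 0) = (\<Sum>j<n. (norm (a j))\<^sup>2)"
    by (simp add: ip(3))
  finally have "(\<Sum>j<n. (norm (a j))\<^sup>2) \<le> (\<integral>u. (norm (f u))\<^sup>2 \<partial>time_measure T)" by simp
  then have "ennreal (\<Sum>j<n. (norm (a j))\<^sup>2) \<le> ennreal (\<integral>u. (norm (f u))\<^sup>2 \<partial>time_measure T)"
    by (rule ennreal_leI)
  also have "\<dots> = (\<integral>\<^sup>+u. nsq (f u) \<partial>time_measure T)"
    by (rule nn_integral_eq_integral[symmetric]) (use f2 in auto)
  finally show ?thesis by (simp add: a_def)
qed

lemma rep_op_represents: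
  fixes f :: "real \<Rightarrow> 'b::{banach, second_countable_topology}"
  shows "represents T f (rep_op T f)"
  by (simp add: represents_def rep_op_def L2_indicator)

text \<open>The norm of an operator on a Hilbert space is its Hilbert--Schmidt norm. One
  inequality is the cotype embedding with constant \<open>1\<close>, the other one is Bessel's.\<close>

theorem hilbert_gamma_norm_sq:
  fixes f :: "real \<Rightarrow> 'b::{banach, second_countable_topology}"
  assumes H: "hilbert_space TYPE('b)"
    and f: "f \<in> borel_measurable (time_measure T)" "(\<integral>\<^sup>+u. nsq (f u) \<partial>time_measure T) < \<infinity>"
  shows "gamma_norm_sq T (rep_op T f) = (\<integral>\<^sup>+u. nsq (f u) \<partial>time_measure T)"
proof (rule antisym)
  show "(\<integral>\<^sup>+u. nsq (f u) \<partial>time_measure T) \<le> gamma_norm_sq T (rep_op T f)"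
    using cotype_embedding[OF hilbert_gauss_cotype_2[OF H] rep_op_L2_operators[OF f] f(1) rep_op_represents] by simp
  show "gamma_norm_sq T (rep_op T f) \<le> (\<integral>\<^sup>+u. nsq (f u) \<partial>time_measure T)"
    unfolding gamma_norm_sq_alt
    using bessel_inequality[OF H _ f] by (intro SUP_least) (auto simp: hilbert_gauss_sq[OF H])
qed

lemma rep_op_simple_finite_rank:
  fixes s :: "real \<Rightarrow> 'b::{banach, second_countable_topology}"
  assumes s: "simple_function (time_measure T) s" and fin: "(\<integral>\<^sup>+u. nsq (s u) \<partial>time_measure T) < \<infinity>"
  shows "rep_op T s \<in> finite_rank T"
proof -
  have V: "finite (s ` {0..T})" using simple_functionD(1)[OF s] by simp
  have lev: "s -` {y} \<inter> {0..T} \<in> sets (time_measure T)" for y using simple_functionD(2)[OF s, of "{y}"] by simp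
  have "rep_op T s h \<in> span (s ` {0..T})" if h: "h \<in> L2 T" for h
  proof -
    have int: "integrable (time_measure T) (\<lambda>u. (h u * indicator (s -` {y} \<inter> {0..T}) u) *\<^sub>R y)" for y
      by (intro integrable_scaleR_left L2_integrable_mult[OF h L2_indicator[OF lev]])
    have "rep_op T s h = (\<integral>u. (\<Sum>y\<in>s ` {0..T}. (h u * indicator (s -` {y} \<inter> {0..T}) u) *\<^sub>R y) \<partial>time_measure T)"
    proof -
      have "h u *\<^sub>R s u = (\<Sum>y\<in>s ` {0..T}. (h u * indicator (s -` {y} \<inter> {0..T}) u) *\<^sub>R y)"
        if u: "u \<in> space (time_measure T)" for u
      proof -
        have "(\<Sum>y\<in>s ` {0..T}. (h u * indicator (s -` {y} \<inter> {0..T}) u) *\<^sub>R y) =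
            (\<Sum>y\<in>s ` {0..T}. if y = s u then h u *\<^sub>R y else 0)"
          using u by (intro sum.cong) (auto simp: indicator_def)
        also have "\<dots> = h u *\<^sub>R s u" using u V by simp
        finally show ?thesis ..
      qed
      then show ?thesis
        unfolding rep_op_def if_P[OF h] by (rule Bochner_Integration.integral_cong[OF refl])
    qed
    also have "\<dots> = (\<Sum>y\<in>s ` {0..T}. \<integral>u. (h u * indicator (s -` {y} \<inter> {0..T}) u) *\<^sub>R y \<partial>time_measure T)"
      by (rule Bochner_Integration.integral_sum) (rule int)
    also have "\<dots> = (\<Sum>y\<in>s ` {0..T}. (\<integral>u. h u * indicator (s -` {y} \<inter> {0..T}) u \<partial>time_measure T) *\<^sub>R y)"
      using L2_integrable_mult[OF h L2_indicator[OF lev]] by (intro sum.cong refl integral_scaleR_left) simp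
    also have "\<dots> \<in> span (s ` {0..T})" by (intro span_sum span_scale span_base)
    finally show ?thesis .
  qed
  then show ?thesis unfolding finite_rank_def
    using V rep_op_L2_operators[OF borel_measurable_simple_function[OF s] fin]
    by (intro CollectI conjI exI[of _ "s ` {0..T}"]) auto
qed

text \<open>By the isometry, simple functions near \<open>f\<close> give finite rank operators near the operator of \<open>f\<close>.\<close>

lemma hilbert_rep_op_gamma_space:
  fixes f :: "real \<Rightarrow> 'b::{banach, second_countable_topology}"
  assumes H: "hilbert_space TYPE('b)"
    and f: "f \<in> borel_measurable (time_measure T)" "(\<integral>\<^sup>+u. nsq (f u) \<partial>time_measure T) < \<infinity>"
  shows "rep_op T f \<in> gamma_space T"
proof -
  have "\<exists>S\<in>finite_rank T. gamma_norm T (op_diff (rep_op T f) S) < e" if e: "e > 0" for e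
  proof -
    obtain s where s: "simple_function (time_measure T) s"
      "(\<integral>\<^sup>+u. nsq (f u - s u) \<partial>time_measure T) < ennreal (e\<^sup>2)"
      using L2_simple_approximation[OF f(1) refl order_refl f(2), of "e\<^sup>2"] e by auto
    have sm: "s \<in> borel_measurable (time_measure T)" by (rule borel_measurable_simple_function[OF s(1)])
    have fs: "(\<lambda>u. f u - s u) \<in> borel_measurable (time_measure T)" using f(1) sm by simp
    have fsfin: "(\<integral>\<^sup>+u. nsq (f u - s u) \<partial>time_measure T) < \<infinity>"
      using s(2) by (rule order_less_trans) simp
    have sfin: "(\<integral>\<^sup>+u. nsq (s u) \<partial>time_measure T) < \<infinity>"
      using nn_integral_nsq_finite[OF f(1) fs f(2) fsfin] by simp
    have "gamma_norm_sq T (op_diff (rep_op T f) (rep_op T s)) < ennreal (e\<^sup>2)"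
      unfolding rep_op_diff[OF f sm sfin] hilbert_gamma_norm_sq[OF H fs fsfin] by (rule s(2))
    then have "enn2real (gamma_norm_sq T (op_diff (rep_op T f) (rep_op T s))) < e\<^sup>2"
      by (cases "gamma_norm_sq T (op_diff (rep_op T f) (rep_op T s))") (simp_all add: ennreal_less_iff)
    then have "gamma_norm T (op_diff (rep_op T f) (rep_op T s)) < e"
      unfolding gamma_norm_def using e by (intro real_less_lsqrt) auto
    then show ?thesis using rep_op_simple_finite_rank[OF s(1) sfin] by blast
  qed
  then show ?thesis unfolding gamma_space_def
    using rep_op_L2_operators[OF f] hilbert_gamma_norm_sq[OF H f] f(2) by simp
qed

section \<open>Measurability of the norm\<close>

text \<open>Young's inequality. The weights will give the triangle inequality for \<open>gamma_norm\<close>, which is a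
  supremum of \<open>L\<^sup>2\<close>-norms, without a triangle inequality for each of them.\<close>

lemma nsq_diff_weighted:
  fixes x y :: "'b::real_normed_vector" and t :: real
  assumes t: "t > 0"
  shows "nsq (x - y) \<le> ennreal (1 + t) * nsq x + ennreal (1 + 1 / t) * nsq y"
proof -
  have "(norm (x - y))\<^sup>2 \<le> (norm x + norm y)\<^sup>2" by (intro power_mono norm_triangle_ineq4) simp
  also have "\<dots> = (norm x)\<^sup>2 + (norm y)\<^sup>2 + 2 * (sqrt t * norm x) * (norm y / sqrt t)"
    using t by (simp add: power2_sum)
  also have "2 * (sqrt t * norm x) * (norm y / sqrt t) \<le> (sqrt t * norm x)\<^sup>2 + (norm y / sqrt t)\<^sup>2"
    by (rule sum_squares_bound)
  also have "(norm x)\<^sup>2 + (norm y)\<^sup>2 + ((sqrt t * norm x)\<^sup>2 + (norm y / sqrt t)\<^sup>2) =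
      (1 + t) * (norm x)\<^sup>2 + (1 + 1 / t) * (norm y)\<^sup>2"
    using t by (simp add: power_mult_distrib power_divide algebra_simps)
  finally have "nsq (x - y) \<le> ennreal ((1 + t) * (norm x)\<^sup>2 + (1 + 1 / t) * (norm y)\<^sup>2)"
    by (intro ennreal_leI) simp
  then show ?thesis using t by (simp add: ennreal_plus ennreal_mult)
qed

lemma gamma_norm_sq_diff_weighted:
  fixes R S :: "'b::{real_normed_vector, second_countable_topology} op"
  assumes t: "t > 0"
  shows "gamma_norm_sq T (op_diff R S) \<le> ennreal (1 + t) * gamma_norm_sq T R + ennreal (1 + 1 / t) * gamma_norm_sq T S"
proof -
  have "gauss_sq n (\<lambda>j. op_diff R S (h j)) \<le>
      ennreal (1 + t) * gamma_norm_sq T R + ennreal (1 + 1 / t) * gamma_norm_sq T S"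
    if "(n, h) \<in> orthonormal_systems T" for n h
  proof -
    have "gauss_sq n (\<lambda>j. op_diff R S (h j)) \<le>
      (\<integral>\<^sup>+z. ennreal (1 + t) * nsq (\<Sum>j<n. z j *\<^sub>R R (h j)) + ennreal (1 + 1 / t) * nsq (\<Sum>j<n. z j *\<^sub>R S (h j)) \<partial>gauss n)"
      unfolding gauss_sq_def op_diff_def scaleR_diff_right sum_subtractf
      by (intro nn_integral_mono nsq_diff_weighted t)
    also have "\<dots> = (\<integral>\<^sup>+z. ennreal (1 + t) * nsq (\<Sum>j<n. z j *\<^sub>R R (h j)) \<partial>gauss n) +
        (\<integral>\<^sup>+z. ennreal (1 + 1 / t) * nsq (\<Sum>j<n. z j *\<^sub>R S (h j)) \<partial>gauss n)"
      by (rule nn_integral_add) measurable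
    also have "\<dots> = ennreal (1 + t) * gauss_sq n (\<lambda>j. R (h j)) + ennreal (1 + 1 / t) * gauss_sq n (\<lambda>j. S (h j))"
      unfolding gauss_sq_def by (intro arg_cong2[where f = "(+)"] nn_integral_cmult) measurable
    also have "\<dots> \<le> ennreal (1 + t) * gamma_norm_sq T R + ennreal (1 + 1 / t) * gamma_norm_sq T S"
      by (intro add_mono mult_left_mono gauss_sq_le_gamma_norm_sq that) auto
    finally show ?thesis .
  qed
  then show ?thesis unfolding gamma_norm_sq_alt[of T "op_diff R S"] by (intro SUP_least) auto
qed

lemma gamma_norm_sq_diff_finite:
  fixes R S :: "'b::{real_normed_vector, second_countable_topology} op"
  assumes "gamma_norm_sq T R < \<infinity>" "gamma_norm_sq T S < \<infinity>"
  shows "gamma_norm_sq T (op_diff R S) < \<infinity>"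
proof -
  have "gamma_norm_sq T (op_diff R S) \<le> ennreal (1 + 1) * gamma_norm_sq T R + ennreal (1 + 1 / 1) * gamma_norm_sq T S"
    by (rule gamma_norm_sq_diff_weighted) simp
  also have "\<dots> < \<infinity>" using assms
    by (simp only: infinity_ennreal_def ennreal_add_less_top ennreal_mult_less_top) simp
  finally show ?thesis .
qed

lemma gamma_norm_power2: "gamma_norm_sq T R < \<infinity> \<Longrightarrow> gamma_norm_sq T R = ennreal ((gamma_norm T R)\<^sup>2)"
  by (simp add: gamma_norm_def)

lemma gamma_norm_nonneg: "0 \<le> gamma_norm T R"
  by (simp add: gamma_norm_def)

text \<open>The weighted inequality is optimized at the ratio of the two norms; \<open>e\<close> avoids division by \<open>0\<close>.\<close>

lemma gamma_norm_diff_le: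
  fixes R S :: "'b::{real_normed_vector, second_countable_topology} op"
  assumes fin: "gamma_norm_sq T R < \<infinity>" "gamma_norm_sq T S < \<infinity>"
  shows "gamma_norm T (op_diff R S) \<le> gamma_norm T R + gamma_norm T S"
proof (rule field_le_epsilon)
  fix e :: real assume e: "e > 0"
  define b c where "b = gamma_norm T R + e / 2" and "c = gamma_norm T S + e / 2"
  have b: "b > 0" "gamma_norm T R \<le> b" and c: "c > 0" "gamma_norm T S \<le> c"
    using e gamma_norm_nonneg[of T R] gamma_norm_nonneg[of T S] by (simp_all add: b_def c_def)
  have "ennreal ((gamma_norm T (op_diff R S))\<^sup>2) \<le>
      ennreal (1 + c / b) * ennreal ((gamma_norm T R)\<^sup>2) + ennreal (1 + 1 / (c / b)) * ennreal ((gamma_norm T S)\<^sup>2)"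
    unfolding gamma_norm_power2[OF fin(1), symmetric] gamma_norm_power2[OF fin(2), symmetric]
      gamma_norm_power2[OF gamma_norm_sq_diff_finite[OF fin], symmetric]
    by (rule gamma_norm_sq_diff_weighted) (use b c in simp)
  also have "\<dots> \<le> ennreal (1 + c / b) * ennreal (b\<^sup>2) + ennreal (1 + 1 / (c / b)) * ennreal (c\<^sup>2)"
    using b c gamma_norm_nonneg by (intro add_mono mult_left_mono ennreal_leI power_mono) auto
  also have "\<dots> = ennreal ((1 + c / b) * b\<^sup>2 + (1 + 1 / (c / b)) * c\<^sup>2)"
    using b c by (simp add: ennreal_mult ennreal_plus)
  also have "(1 + c / b) * b\<^sup>2 + (1 + 1 / (c / b)) * c\<^sup>2 = (b + c)\<^sup>2"
    using b(1) c(1) by (simp add: field_simps power2_eq_square)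
  finally have "(gamma_norm T (op_diff R S))\<^sup>2 \<le> (b + c)\<^sup>2" by (simp add: ennreal_le_iff)
  then have "gamma_norm T (op_diff R S) \<le> b + c" by (rule power2_le_imp_le) (use b(1) c(1) in simp)
  then show "gamma_norm T (op_diff R S) \<le> gamma_norm T R + gamma_norm T S + e" by (simp add: b_def c_def)
qed

lemma gamma_norm_op_diff_commute: "gamma_norm T (op_diff R S) = gamma_norm T (op_diff S R)"
proof -
  have "gauss_sq n (\<lambda>j. R (h j) - S (h j)) = gauss_sq n (\<lambda>j. S (h j) - R (h j))" for n h
    unfolding gauss_sq_def scaleR_diff_right sum_subtractf by (simp add: norm_minus_commute)
  then show ?thesis by (simp add: gamma_norm_def gamma_norm_sq_alt op_diff_def)
qed

lemma gamma_norm_diff_lipschitz: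
  fixes R S :: "'b::{real_normed_vector, second_countable_topology} op"
  assumes fin: "gamma_norm_sq T R < \<infinity>" "gamma_norm_sq T S < \<infinity>"
  shows "\<bar>gamma_norm T R - gamma_norm T S\<bar> \<le> gamma_norm T (op_diff R S)"
proof -
  have le: "gamma_norm T R \<le> gamma_norm T (op_diff R S) + gamma_norm T S"
    if "gamma_norm_sq T R < \<infinity>" "gamma_norm_sq T S < \<infinity>" for R S :: "'b op"
  proof -
    let ?z = "\<lambda>_. 0 :: 'b"
    have "gamma_norm_sq T ?z \<le> 0"
      unfolding gamma_norm_sq_alt by (intro SUP_least) (auto simp: gauss_sq_def)
    then have z: "gamma_norm_sq T ?z < \<infinity>" by simp
    have "R = op_diff (op_diff R S) (op_diff ?z S)" by (simp add: op_diff_def)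
    then have "gamma_norm T R \<le> gamma_norm T (op_diff R S) + gamma_norm T (op_diff ?z S)"
      using gamma_norm_diff_le[OF gamma_norm_sq_diff_finite[OF that] gamma_norm_sq_diff_finite[OF z that(2)]] by simp
    also have "gamma_norm T (op_diff ?z S) = gamma_norm T S"
      unfolding gamma_norm_op_diff_commute[of T ?z] by (simp add: op_diff_def)
    finally show ?thesis .
  qed
  show ?thesis using le[OF fin] le[OF fin(2,1)] gamma_norm_op_diff_commute[of T R S] by simp
qed

lemma (in complete_measure) borel_measurable_AE_cong:
  fixes f g :: "'a \<Rightarrow> 'b::topological_space"
  assumes f: "f \<in> borel_measurable M" and ae: "AE x in M. f x = g x"
  shows "g \<in> borel_measurable M"
proof (rule measurableI)
  fix S :: "'b set" assume S: "S \<in> sets borel"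
  show "g -` S \<inter> space M \<in> sets M"
  proof (rule in_sets_AE)
    show "AE x in M. (x \<in> f -` S \<inter> space M) = (x \<in> g -` S \<inter> space M)" using ae by eventually_elim auto
    show "f -` S \<inter> space M \<in> sets M" using f S by (rule measurable_sets)
  qed auto
qed auto

text \<open>The norm is a continuous function of the operators, so it is measurable as an almost
  everywhere limit of simple functions; completeness takes care of the exceptional null set.\<close>

lemma gamma_norm_diff_measurable:
  fixes X Y :: "'a \<Rightarrow> 'b::{real_normed_vector, second_countable_topology} op"
  assumes M: "complete_measure M" and X: "gamma_strongly_measurable M T X" and Y: "gamma_strongly_measurable M T Y"
  shows "(\<lambda>\<omega>. gamma_norm T (op_diff (X \<omega>) (Y \<omega>))) \<in> borel_measurable M"
proof -
  interpret complete_measure M by fact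
  have Xg: "\<And>\<omega>. \<omega> \<in> space M \<Longrightarrow> X \<omega> \<in> gamma_space T" and Yg: "\<And>\<omega>. \<omega> \<in> space M \<Longrightarrow> Y \<omega> \<in> gamma_space T"
    using X Y by (auto simp: gamma_strongly_measurable_def)
  obtain s where s: "\<And>n. simple_function M (s n)" "\<And>n. s n ` space M \<subseteq> gamma_space T"
    "AE \<omega> in M. (\<lambda>n. gamma_norm T (op_diff (s n \<omega>) (X \<omega>))) \<longlonglongrightarrow> 0"
    using X unfolding gamma_strongly_measurable_def by blast
  obtain r where r: "\<And>n. simple_function M (r n)" "\<And>n. r n ` space M \<subseteq> gamma_space T"
    "AE \<omega> in M. (\<lambda>n. gamma_norm T (op_diff (r n \<omega>) (Y \<omega>))) \<longlonglongrightarrow> 0"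
    using Y unfolding gamma_strongly_measurable_def by blast
  have fin: "gamma_norm_sq T R < \<infinity>" if "R \<in> gamma_space T" for R :: "'b op"
    using that by (simp add: gamma_space_def)
  define q where "q = (\<lambda>n \<omega>. gamma_norm T (op_diff (s n \<omega>) (r n \<omega>)))"
  have [measurable]: "q n \<in> borel_measurable M" for n
    unfolding q_def by (rule borel_measurable_simple_function[OF simple_function_compose2[OF s(1) r(1)]])
  have "AE \<omega> in M. (\<lambda>n. q n \<omega>) \<longlonglongrightarrow> gamma_norm T (op_diff (X \<omega>) (Y \<omega>))"
    using s(3) r(3) AE_space
  proof eventually_elim
    case (elim \<omega>)
    have f: "gamma_norm_sq T (s n \<omega>) < \<infinity>" "gamma_norm_sq T (r n \<omega>) < \<infinity>" for n
      using s(2)[of n] r(2)[of n] elim(3) fin by blast+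
    have fXY: "gamma_norm_sq T (X \<omega>) < \<infinity>" "gamma_norm_sq T (Y \<omega>) < \<infinity>"
      using Xg Yg elim(3) fin by blast+
    have le: "dist (q n \<omega>) (gamma_norm T (op_diff (X \<omega>) (Y \<omega>))) \<le>
        gamma_norm T (op_diff (s n \<omega>) (X \<omega>)) + gamma_norm T (op_diff (r n \<omega>) (Y \<omega>))" for n
    proof -
      have "dist (q n \<omega>) (gamma_norm T (op_diff (X \<omega>) (Y \<omega>))) \<le>
          gamma_norm T (op_diff (op_diff (s n \<omega>) (r n \<omega>)) (op_diff (X \<omega>) (Y \<omega>)))"
        unfolding q_def dist_real_def
        by (intro gamma_norm_diff_lipschitz gamma_norm_sq_diff_finite f fXY)
      also have "op_diff (op_diff (s n \<omega>) (r n \<omega>)) (op_diff (X \<omega>) (Y \<omega>)) =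
          op_diff (op_diff (s n \<omega>) (X \<omega>)) (op_diff (r n \<omega>) (Y \<omega>))"
        by (simp add: op_diff_def algebra_simps)
      also have "gamma_norm T \<dots> \<le> gamma_norm T (op_diff (s n \<omega>) (X \<omega>)) + gamma_norm T (op_diff (r n \<omega>) (Y \<omega>))"
        by (intro gamma_norm_diff_le gamma_norm_sq_diff_finite f fXY)
      finally show ?thesis .
    qed
    have lim: "(\<lambda>n. gamma_norm T (op_diff (s n \<omega>) (X \<omega>)) + gamma_norm T (op_diff (r n \<omega>) (Y \<omega>))) \<longlonglongrightarrow> 0"
      using tendsto_add[OF elim(1,2)] by simp
    have "(\<lambda>n. dist (q n \<omega>) (gamma_norm T (op_diff (X \<omega>) (Y \<omega>)))) \<longlonglongrightarrow> 0"
    proof (rule tendsto_sandwich[OF _ _ tendsto_const lim])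
      show "eventually (\<lambda>n. 0 \<le> dist (q n \<omega>) (gamma_norm T (op_diff (X \<omega>) (Y \<omega>)))) sequentially"
        by (rule always_eventually) simp
    qed (rule always_eventually, use le in blast)
    then show ?case by (rule tendsto_dist_iff[THEN iffD2])
  qed
  then have "AE \<omega> in M. lim (\<lambda>n. q n \<omega>) = gamma_norm T (op_diff (X \<omega>) (Y \<omega>))"
    by eventually_elim (rule limI)
  then show ?thesis by (rule borel_measurable_AE_cong[rotated]) measurable
qed

section \<open>The augmented filtration\<close>

lemma aug_generators_subset:
  "{W s -` B \<inter> space M | s B. s \<in> {0..t} \<and> B \<in> sets borel} \<union>
    {N. \<exists>N'\<in>null_sets M. N \<subseteq> N'} \<subseteq> Pow (space M)"
  using sets.sets_into_space by (fastforce simp: null_sets_def)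

lemma space_aug_filtration [simp]: "space (aug_filtration M W t) = space M"
  unfolding aug_filtration_def by (rule space_measure_of[OF aug_generators_subset])

lemma sets_aug_filtration: "sets (aug_filtration M W t) = sigma_sets (space M)
   ({W s -` B \<inter> space M | s B. s \<in> {0..t} \<and> B \<in> sets borel} \<union> {N. \<exists>N'\<in>null_sets M. N \<subseteq> N'})"
  unfolding aug_filtration_def by (rule sets_measure_of[OF aug_generators_subset])

lemma aug_filtration_mono:
  assumes "u \<le> v" shows "sets (aug_filtration M W u) \<subseteq> sets (aug_filtration M W v)"
  unfolding sets_aug_filtration
proof (rule sigma_sets_mono', rule Un_mono[OF _ order_refl], rule subsetI)
  fix x assume "x \<in> {W s -` B \<inter> space M | s B. s \<in> {0..u} \<and> B \<in> sets borel}"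
  then obtain s B where "x = W s -` B \<inter> space M" "s \<in> {0..u}" "B \<in> sets borel" by blast
  then show "x \<in> {W s -` B \<inter> space M | s B. s \<in> {0..v} \<and> B \<in> sets borel}"
    using assms by (intro CollectI exI[of _ s] exI[of _ B]) auto
qed

text \<open>All subsets of null sets are among the generators.\<close>

lemma aug_filtration_complete:
  assumes "sets M = sets (aug_filtration M W t)"
  shows "complete_measure M"
proof
  fix A B assume "B \<subseteq> A" "A \<in> null_sets M"
  then have "B \<in> {N. \<exists>N'\<in>null_sets M. N \<subseteq> N'}" by blast
  then show "B \<in> sets M" unfolding assms sets_aug_filtration by (intro sigma_sets.Basic UnI2)
qed

section \<open>Sections of processes\<close>

lemma pair_sigma_finite_time: "prob_space M \<Longrightarrow> pair_sigma_finite (time_measure T) M"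
  by (intro pair_sigma_finite.intro sigma_finite_time finite_measure.sigma_finite_measure prob_space.axioms)
     (simp add: prob_space_def)

text \<open>A set that is null in the product has null sections at almost every sample point, which is the
  second coordinate here.\<close>

lemma AE_time_product_sections:
  assumes M: "prob_space M" and ae: "AE p in time_prod T M. P p"
  shows "AE \<omega> in M. AE u in time_measure T. P (u, \<omega>)"
proof -
  interpret pair_sigma_finite "time_measure T" M by (rule pair_sigma_finite_time[OF M])
  interpret Q: pair_sigma_finite M "time_measure T" by unfold_locales
  have "AE q in M \<Otimes>\<^sub>M time_measure T. P (case q of (x, y) \<Rightarrow> (y, x))"
    by (rule AE_distrD[OF measurable_pair_swap']) (subst distr_pair_swap[symmetric], rule ae)
  from Q.AE_pair[OF this] show ?thesis by simp
qed

lemma nn_integral_time_sections: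
  assumes M: "prob_space M" and f: "f \<in> borel_measurable (time_prod T M)"
  shows "(\<integral>\<^sup>+\<omega>. \<integral>\<^sup>+u. f (u, \<omega>) \<partial>time_measure T \<partial>M) = (\<integral>\<^sup>+p. f p \<partial>time_prod T M)"
proof -
  interpret pair_sigma_finite "time_measure T" M by (rule pair_sigma_finite_time[OF M])
  show ?thesis using nn_integral_snd[OF f] .
qed

lemma section_integral_measurable:
  fixes k :: "real \<times> 'a \<Rightarrow> 'b::{banach, second_countable_topology}"
  assumes k: "k \<in> borel_measurable (time_prod T M)"
  shows "(\<lambda>\<omega>. \<integral>\<^sup>+u. nsq (k (u, \<omega>)) \<partial>time_measure T) \<in> borel_measurable M"
proof -
  interpret sigma_finite_measure "time_measure T" by (rule sigma_finite_time)
  note [measurable] = k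
  show ?thesis by measurable
qed

lemma section_measurable:
  "k \<in> borel_measurable (time_prod T M) \<Longrightarrow> \<omega> \<in> space M \<Longrightarrow>
    (\<lambda>u. k (u, \<omega>)) \<in> borel_measurable (time_measure T)"
  using measurable_compose[OF measurable_Pair2'[of \<omega> M "time_measure T"], of k borel] by simp

text \<open>The sum of the functions has a finite integral, so almost everywhere it is a convergent series.\<close>

lemma AE_tendsto_zero_of_summable:
  fixes a :: "nat \<Rightarrow> 'a \<Rightarrow> ennreal"
  assumes [measurable]: "\<And>n. a n \<in> borel_measurable M" and le: "\<And>n. (\<integral>\<^sup>+x. a n x \<partial>M) \<le> ennreal ((1 / 2) ^ n)"
  shows "AE x in M. (\<lambda>n. a n x) \<longlonglongrightarrow> 0"
proof -
  have "(\<integral>\<^sup>+x. (\<Sum>n. a n x) \<partial>M) = (\<Sum>n. \<integral>\<^sup>+x. a n x \<partial>M)" by (rule nn_integral_suminf) measurable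
  also have "\<dots> \<le> (\<Sum>n. ennreal ((1 / 2) ^ n))" by (intro suminf_le le) auto
  also have "\<dots> = ennreal (\<Sum>n. (1 / 2) ^ n)" by (rule suminf_ennreal2) (auto intro: summable_geometric)
  finally have "(\<integral>\<^sup>+x. (\<Sum>n. a n x) \<partial>M) \<noteq> \<infinity>" by (auto simp: top_unique)
  then have "AE x in M. (\<Sum>n. a n x) \<noteq> \<infinity>" by (rule nn_integral_PInf_AE[rotated]) measurable
  then show ?thesis
  proof eventually_elim
    case (elim x)
    have fin: "a n x \<noteq> \<infinity>" for n
      using ennreal_suminf_lessD[of "\<lambda>n. a n x" top n] elim by (auto simp: less_top)
    define b where "b = (\<lambda>n. enn2real (a n x))"
    have ab: "a n x = ennreal (b n)" for n using fin[of n] by (simp add: b_def less_top)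
    have b0: "0 \<le> b n" for n by (simp add: b_def)
    have "(\<Sum>n. ennreal (b n)) \<noteq> top" using elim unfolding ab by simp
    then have "summable b" by (rule summable_suminf_not_top[OF b0])
    then have "b \<longlonglongrightarrow> 0" by (rule summable_LIMSEQ_zero)
    then have "(\<lambda>n. ennreal (b n)) \<longlonglongrightarrow> ennreal 0" by (rule tendsto_ennrealI)
    then show ?case by (simp add: ab)
  qed
qed

section \<open>From operators to processes\<close>

lemma L2_gammaD:
  assumes "X \<in> L2_gamma M T"
  shows "gamma_strongly_measurable M T X" "integrable M (\<lambda>\<omega>. (gamma_norm T (X \<omega>))\<^sup>2)"
    "\<omega> \<in> space M \<Longrightarrow> X \<omega> \<in> L2_operators T" "\<omega> \<in> space M \<Longrightarrow> gamma_norm_sq T (X \<omega>) < \<infinity>"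
  using assms by (auto simp: L2_gamma_def gamma_strongly_measurable_def gamma_space_def)

lemma L2_gamma_diff_integrable:
  fixes X Y :: "'a \<Rightarrow> 'b::{real_normed_vector, second_countable_topology} op"
  assumes M: "complete_measure M" and X: "X \<in> L2_gamma M T" and Y: "Y \<in> L2_gamma M T"
  shows "integrable M (\<lambda>\<omega>. (gamma_norm T (op_diff (X \<omega>) (Y \<omega>)))\<^sup>2)"
proof (rule Bochner_Integration.integrable_bound)
  show "integrable M (\<lambda>\<omega>. 2 * (gamma_norm T (X \<omega>))\<^sup>2 + 2 * (gamma_norm T (Y \<omega>))\<^sup>2)"
    by (intro Bochner_Integration.integrable_add integrable_mult_right L2_gammaD(2)[OF X] L2_gammaD(2)[OF Y])
  show "(\<lambda>\<omega>. (gamma_norm T (op_diff (X \<omega>) (Y \<omega>)))\<^sup>2) \<in> borel_measurable M"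
    by (intro borel_measurable_power gamma_norm_diff_measurable M L2_gammaD(1)[OF X] L2_gammaD(1)[OF Y])
  show "AE \<omega> in M. norm ((gamma_norm T (op_diff (X \<omega>) (Y \<omega>)))\<^sup>2) \<le>
      norm (2 * (gamma_norm T (X \<omega>))\<^sup>2 + 2 * (gamma_norm T (Y \<omega>))\<^sup>2)"
  proof (rule AE_I2)
    fix \<omega> assume \<omega>: "\<omega> \<in> space M"
    have "(gamma_norm T (op_diff (X \<omega>) (Y \<omega>)))\<^sup>2 \<le> (gamma_norm T (X \<omega>) + gamma_norm T (Y \<omega>))\<^sup>2"
      by (intro power_mono gamma_norm_diff_le L2_gammaD(4)[OF X \<omega>] L2_gammaD(4)[OF Y \<omega>] gamma_norm_nonneg)
    also have "\<dots> \<le> 2 * (gamma_norm T (X \<omega>))\<^sup>2 + 2 * (gamma_norm T (Y \<omega>))\<^sup>2"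
      using sum_squares_bound[of "gamma_norm T (X \<omega>)" "gamma_norm T (Y \<omega>)"] by (simp add: power2_sum)
    finally show "norm ((gamma_norm T (op_diff (X \<omega>) (Y \<omega>)))\<^sup>2) \<le>
      norm (2 * (gamma_norm T (X \<omega>))\<^sup>2 + 2 * (gamma_norm T (Y \<omega>))\<^sup>2)" by simp
  qed
qed

text \<open>The cotype embedding, applied at almost every sample point to the operator \<open>X \<omega> - Y \<omega>\<close>, which is
  represented by the section of \<open>h - \<phi>\<close>, and integrated over the sample points.\<close>

lemma process_distance_le:
  fixes X Y :: "'a \<Rightarrow> 'b::{banach, second_countable_topology} op"
  assumes P: "prob_space M" and M: "complete_measure M" and C: "gauss_cotype_2 TYPE('b) C"
    and X: "X \<in> L2_gamma M T" "defines_rv M T h X" and Y: "Y \<in> L2_gamma M T" "defines_rv M T \<phi> Y"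
  shows "(\<integral>\<^sup>+p. nsq (h p - \<phi> p) \<partial>time_prod T M) \<le>
    ennreal C * ennreal ((L2_gamma_norm M T (\<lambda>\<omega>. op_diff (X \<omega>) (Y \<omega>)))\<^sup>2)"
proof -
  have m[measurable]: "h \<in> borel_measurable (time_prod T M)" "\<phi> \<in> borel_measurable (time_prod T M)"
    using X Y by (auto simp: defines_rv_def)
  obtain D :: "('b \<Rightarrow>\<^sub>L real) set" where D: "countable D" "separating D" using countable_separating_set by blast
  define q where "q = (\<lambda>\<omega>. (gamma_norm T (op_diff (X \<omega>) (Y \<omega>)))\<^sup>2)"
  have q: "integrable M q" unfolding q_def by (rule L2_gamma_diff_integrable[OF M X(1) Y(1)])
  have wX: "AE \<omega> in M. weakly_represents T D (\<lambda>u. h (u, \<omega>)) (X \<omega>)"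
    by (rule defines_rv_weakly_represents[OF X(2) _ D(1)]) (rule L2_gammaD(3)[OF X(1)])
  have wY: "AE \<omega> in M. weakly_represents T D (\<lambda>u. \<phi> (u, \<omega>)) (Y \<omega>)"
    by (rule defines_rv_weakly_represents[OF Y(2) _ D(1)]) (rule L2_gammaD(3)[OF Y(1)])
  have "AE \<omega> in M. (\<integral>\<^sup>+u. nsq (h (u, \<omega>) - \<phi> (u, \<omega>)) \<partial>time_measure T) \<le> ennreal C * ennreal (q \<omega>)"
    using wX wY AE_space
  proof eventually_elim
    case (elim \<omega>)
    have sm: "(\<lambda>u. h (u, \<omega>) - \<phi> (u, \<omega>)) \<in> borel_measurable (time_measure T)"
      by (intro borel_measurable_diff section_measurable[OF _ elim(3)] m)
    have "(\<integral>\<^sup>+u. nsq (h (u, \<omega>) - \<phi> (u, \<omega>)) \<partial>time_measure T) \<le> ennreal C * gamma_norm_sq T (op_diff (X \<omega>) (Y \<omega>))"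
      by (rule cotype_embedding[OF C _ sm weakly_represents_imp_represents[OF D(2) weakly_represents_diff[OF elim(1,2)] sm]])
        (rule op_diff_L2_operators[OF L2_gammaD(3)[OF X(1) elim(3)] L2_gammaD(3)[OF Y(1) elim(3)]])
    also have "gamma_norm_sq T (op_diff (X \<omega>) (Y \<omega>)) = ennreal (q \<omega>)"
      unfolding q_def
      by (rule gamma_norm_power2[OF gamma_norm_sq_diff_finite[OF L2_gammaD(4)[OF X(1) elim(3)] L2_gammaD(4)[OF Y(1) elim(3)]]])
    finally show ?case .
  qed
  then have "(\<integral>\<^sup>+\<omega>. \<integral>\<^sup>+u. nsq (h (u, \<omega>) - \<phi> (u, \<omega>)) \<partial>time_measure T \<partial>M) \<le> (\<integral>\<^sup>+\<omega>. ennreal C * ennreal (q \<omega>) \<partial>M)"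
    by (rule nn_integral_mono_AE)
  also have "(\<integral>\<^sup>+\<omega>. ennreal C * ennreal (q \<omega>) \<partial>M) = ennreal C * (\<integral>\<^sup>+\<omega>. ennreal (q \<omega>) \<partial>M)"
    using q by (intro nn_integral_cmult) auto
  also have "(\<integral>\<^sup>+\<omega>. ennreal (q \<omega>) \<partial>M) = ennreal (\<integral>\<omega>. q \<omega> \<partial>M)"
    using q by (intro nn_integral_eq_integral) (auto simp: q_def)
  also have "(\<integral>\<omega>. q \<omega> \<partial>M) = (L2_gamma_norm M T (\<lambda>\<omega>. op_diff (X \<omega>) (Y \<omega>)))\<^sup>2"
    unfolding L2_gamma_norm_def by (simp add: q_def Bochner_Integration.integral_nonneg)
  also have "(\<integral>\<^sup>+\<omega>. \<integral>\<^sup>+u. nsq (h (u, \<omega>) - \<phi> (u, \<omega>)) \<partial>time_measure T \<partial>M) =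
      (\<integral>\<^sup>+p. nsq (h p - \<phi> p) \<partial>time_prod T M)"
    by (rule nn_integral_time_sections[OF P, where f = "\<lambda>p. nsq (h p - \<phi> p)"]) measurable
  finally show ?thesis .
qed

lemma defines_rv_cong_AE:
  fixes g h :: "real \<times> 'a \<Rightarrow> 'b::{banach, second_countable_topology}"
  assumes P: "prob_space M" and h: "defines_rv M T h X" and g: "g \<in> borel_measurable (time_prod T M)"
    and ae: "AE p in time_prod T M. g p = h p"
  shows "defines_rv M T g X"
proof -
  have hm: "h \<in> borel_measurable (time_prod T M)" using h by (simp add: defines_rv_def)
  have bm: "(\<lambda>u. blinfun_apply f (k (u, \<omega>))) \<in> borel_measurable (time_measure T)"
    if "k \<in> borel_measurable (time_prod T M)" "\<omega> \<in> space M" for f :: "'b \<Rightarrow>\<^sub>L real" and k \<omega>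
    by (intro borel_measurable_continuous_on[OF _ section_measurable[OF that]] continuous_intros
        linear_continuous_on blinfun.bounded_linear_right)
  note sec = AE_time_product_sections[OF P ae]
  show ?thesis unfolding defines_rv_def
  proof (intro conjI g allI ballI)
    fix f :: "'b \<Rightarrow>\<^sub>L real"
    have "AE \<omega> in M. (\<lambda>u. blinfun_apply f (h (u, \<omega>))) \<in> L2 T" using h by (simp add: defines_rv_def)
    then show "AE \<omega> in M. (\<lambda>u. blinfun_apply f (g (u, \<omega>))) \<in> L2 T" using sec AE_space
    proof eventually_elim
      case (elim \<omega>)
      have "(\<integral>\<^sup>+u. nsq (blinfun_apply f (g (u, \<omega>))) \<partial>time_measure T) = (\<integral>\<^sup>+u. nsq (blinfun_apply f (h (u, \<omega>))) \<partial>time_measure T)"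
        by (rule nn_integral_cong_AE) (use elim(2) in \<open>eventually_elim, simp\<close>)
      then show ?case using elim(1) bm[OF g elim(3)] by (simp add: L2_iff)
    qed
    fix k assume k: "k \<in> L2 T"
    have "AE \<omega> in M. blinfun_apply f (X \<omega> k) = (\<integral>u. k u * blinfun_apply f (h (u, \<omega>)) \<partial>time_measure T)"
      using h k by (simp add: defines_rv_def)
    then show "AE \<omega> in M. blinfun_apply f (X \<omega> k) = (\<integral>u. k u * blinfun_apply f (g (u, \<omega>)) \<partial>time_measure T)"
      using sec AE_space
    proof eventually_elim
      case (elim \<omega>)
      have "(\<integral>u. k u * blinfun_apply f (g (u, \<omega>)) \<partial>time_measure T) = (\<integral>u. k u * blinfun_apply f (h (u, \<omega>)) \<partial>time_measure T)"
        by (rule integral_cong_AE) (use elim(2) bm[OF g elim(3)] bm[OF hm elim(3)] L2_measurable[OF k] in \<open>auto elim!: eventually_mono\<close>)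
      then show ?case using elim(1) by simp
    qed
  qed
qed

lemma adapted_step_nsq_finite:
  fixes \<phi> :: "real \<times> 'a \<Rightarrow> 'b::{banach, second_countable_topology}"
  assumes P: "prob_space M" and \<phi>: "\<phi> \<in> adapted_step T Fil"
  shows "(\<integral>\<^sup>+u. nsq (\<phi> (u, \<omega>)) \<partial>time_measure T) < \<infinity>"
    "(\<integral>\<^sup>+p. nsq (\<phi> p) \<partial>time_prod T M) < \<infinity>"
proof -
  interpret M: prob_space M by (rule P)
  interpret t: finite_measure "time_measure T" by (rule finite_measure_time)
  interpret pair_sigma_finite "time_measure T" M by (rule pair_sigma_finite_time[OF P])
  obtain B where B: "\<And>p. norm (\<phi> p) \<le> B" using adapted_step_bounded[OF \<phi>] by blast
  have T_fin: "emeasure (time_measure T) {0..T} < top"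
    by (simp only: t.emeasure_eq_measure ennreal_less_top)
  have le: "nsq (\<phi> p) \<le> ennreal (B\<^sup>2)" for p by (intro ennreal_leI power_mono B) simp
  have "(\<integral>\<^sup>+u. nsq (\<phi> (u, \<omega>)) \<partial>time_measure T) \<le> (\<integral>\<^sup>+u. ennreal (B\<^sup>2) \<partial>time_measure T)"
    by (intro nn_integral_mono le)
  also have "\<dots> < \<infinity>" using T_fin by (simp add: ennreal_mult_less_top)
  finally show "(\<integral>\<^sup>+u. nsq (\<phi> (u, \<omega>)) \<partial>time_measure T) < \<infinity>" .
  have "(\<integral>\<^sup>+p. nsq (\<phi> p) \<partial>time_prod T M) \<le> (\<integral>\<^sup>+p. ennreal (B\<^sup>2) \<partial>time_prod T M)"
    by (intro nn_integral_mono le)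
  also have "\<dots> = ennreal (B\<^sup>2) * (emeasure (time_measure T) {0..T} * emeasure M (space M))"
    using M.emeasure_pair_measure_Times[of "{0..T}" "time_measure T" "space M"] sets.top[of "time_measure T"] by simp
  also have "\<dots> < \<infinity>"
    using T_fin by (simp add: ennreal_mult_less_top M.emeasure_space_1)
  finally show "(\<integral>\<^sup>+p. nsq (\<phi> p) \<partial>time_prod T M) < \<infinity>" .
qed

text \<open>Cotype \<open>2\<close> turns approximation of the operators by adapted steps into \<open>L\<^sup>2\<close>-approximation
  of the process. The limit of the steps is adapted, and it is a version of the given process.\<close>

theorem cotype_2_adapted_version:
  fixes h :: "real \<times> 'a \<Rightarrow> 'b::{banach, second_countable_topology}"
  assumes P: "prob_space M" and M: "complete_measure M" and T: "T > 0"
    and Fil: "\<And>u. u \<in> {0..T} \<Longrightarrow> sets (Fil u) \<subseteq> sets M"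
    and mono: "\<And>u v. 0 \<le> u \<Longrightarrow> u \<le> v \<Longrightarrow> v \<le> T \<Longrightarrow> sets (Fil u) \<subseteq> sets (Fil v)"
    and cot: "cotype_2 TYPE('b)" and X: "X \<in> L2_gamma_adapted M T Fil" and h: "defines_rv M T h X"
  shows "\<exists>g\<in>borel_measurable (adapted_algebra M T Fil).
    (AE p in time_prod T M. g p = h p) \<and> (\<integral>\<^sup>+p. nsq (g p) \<partial>time_prod T M) < \<infinity>"
proof -
  obtain C where C: "gauss_cotype_2 TYPE('b) C" using cotype_2_imp_gauss_cotype_2[OF cot] by blast
  then have C0: "C \<ge> 0" by (simp add: gauss_cotype_2_def)
  have XL: "X \<in> L2_gamma M T" using X by (simp add: L2_gamma_adapted_def)
  have hm[measurable]: "h \<in> borel_measurable (time_prod T M)" using h by (simp add: defines_rv_def)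
  have "\<exists>\<phi>\<in>adapted_step T Fil. (\<integral>\<^sup>+p. nsq (h p - \<phi> p) \<partial>time_prod T M) \<le> ennreal ((1 / 2) ^ n)" for n :: nat
  proof -
    define e where "e = sqrt ((1 / 2) ^ n / (C + 1))"
    have e: "e > 0" using C0 by (simp add: e_def)
    obtain \<phi> Y where \<phi>: "\<phi> \<in> adapted_step T Fil" "Y \<in> L2_gamma M T" "defines_rv M T \<phi> Y"
      "L2_gamma_norm M T (\<lambda>\<omega>. op_diff (X \<omega>) (Y \<omega>)) < e"
      using X e unfolding L2_gamma_adapted_def by blast
    have "0 \<le> L2_gamma_norm M T (\<lambda>\<omega>. op_diff (X \<omega>) (Y \<omega>))"
      by (simp add: L2_gamma_norm_def Bochner_Integration.integral_nonneg)
    then have le: "(L2_gamma_norm M T (\<lambda>\<omega>. op_diff (X \<omega>) (Y \<omega>)))\<^sup>2 \<le> e\<^sup>2"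
      using \<phi>(4) by (intro power_mono) auto
    have "(\<integral>\<^sup>+p. nsq (h p - \<phi> p) \<partial>time_prod T M) \<le>
        ennreal C * ennreal ((L2_gamma_norm M T (\<lambda>\<omega>. op_diff (X \<omega>) (Y \<omega>)))\<^sup>2)"
      by (rule process_distance_le[OF P M C XL h \<phi>(2,3)])
    also have "\<dots> \<le> ennreal C * ennreal (e\<^sup>2)" by (intro mult_left_mono ennreal_leI le) simp
    also have "\<dots> = ennreal (C * e\<^sup>2)" using C0 by (simp add: ennreal_mult)
    also have "\<dots> \<le> ennreal ((1 / 2) ^ n)"
    proof (rule ennreal_leI)
      have "C * e\<^sup>2 = (C / (C + 1)) * (1 / 2) ^ n" using C0 by (simp add: e_def)
      also have "\<dots> \<le> 1 * (1 / 2) ^ n" using C0 by (intro mult_right_mono) auto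
      finally show "C * e\<^sup>2 \<le> (1 / 2) ^ n" by simp
    qed
    finally show ?thesis using \<phi>(1) by blast
  qed
  then have "\<forall>n. \<exists>\<phi>. \<phi> \<in> adapted_step T Fil \<and>
      (\<integral>\<^sup>+p. nsq (h p - \<phi> p) \<partial>time_prod T M) \<le> ennreal ((1 / 2) ^ n)" by (simp only: Bex_def simp_thms)
  from choice[OF this] obtain \<phi> where "\<forall>n. \<phi> n \<in> adapted_step T Fil \<and>
      (\<integral>\<^sup>+p. nsq (h p - \<phi> n p) \<partial>time_prod T M) \<le> ennreal ((1 / 2) ^ n)" ..
  then have \<phi>: "\<phi> n \<in> adapted_step T Fil"
    "(\<integral>\<^sup>+p. nsq (h p - \<phi> n p) \<partial>time_prod T M) \<le> ennreal ((1 / 2) ^ n)" for n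
    by simp_all
  have \<phi>a: "\<phi> n \<in> borel_measurable (adapted_algebra M T Fil)" for n
    by (rule adapted_step_adapted_measurable[OF \<phi>(1) T Fil mono])
  have \<phi>m[measurable]: "\<phi> n \<in> borel_measurable (time_prod T M)" for n
    by (rule adapted_product_measurable[OF \<phi>a])
  define g where "g = (\<lambda>p. lim (\<lambda>n. \<phi> n p))"
  have ga: "g \<in> borel_measurable (adapted_algebra M T Fil)"
    unfolding g_def by (rule borel_measurable_lim_metric[OF \<phi>a])
  have gm[measurable]: "g \<in> borel_measurable (time_prod T M)" by (rule adapted_product_measurable[OF ga])
  have "AE p in time_prod T M. (\<lambda>n. nsq (h p - \<phi> n p)) \<longlonglongrightarrow> 0"
    by (rule AE_tendsto_zero_of_summable[OF _ \<phi>(2)]) measurable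
  then have ae: "AE p in time_prod T M. g p = h p"
  proof eventually_elim
    case (elim p)
    have "(\<lambda>n. (norm (h p - \<phi> n p))\<^sup>2) \<longlonglongrightarrow> 0"
      using tendsto_enn2real[of "\<lambda>n. nsq (h p - \<phi> n p)" 0] elim by simp
    then have "(\<lambda>n. sqrt ((norm (h p - \<phi> n p))\<^sup>2)) \<longlonglongrightarrow> sqrt 0" by (rule tendsto_real_sqrt)
    then have "(\<lambda>n. norm (\<phi> n p - h p)) \<longlonglongrightarrow> 0" by (simp add: norm_minus_commute)
    then have "(\<lambda>n. \<phi> n p) \<longlonglongrightarrow> h p" by (simp only: tendsto_norm_zero_iff LIM_zero_iff)
    then show ?case unfolding g_def by (rule limI)
  qed
  have "(\<integral>\<^sup>+p. nsq (g p) \<partial>time_prod T M) = (\<integral>\<^sup>+p. nsq (\<phi> 0 p - (\<phi> 0 p - h p)) \<partial>time_prod T M)"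
    by (rule nn_integral_cong_AE) (use ae in \<open>eventually_elim, simp\<close>)
  also have "\<dots> < \<infinity>"
  proof (rule nn_integral_nsq_finite)
    show "(\<integral>\<^sup>+p. nsq (\<phi> 0 p - h p) \<partial>time_prod T M) < \<infinity>"
      using \<phi>(2)[of 0] by (simp add: norm_minus_commute) (erule order_le_less_trans, simp)
  qed (use adapted_step_nsq_finite(2)[OF P \<phi>(1)] in auto)
  finally show ?thesis using ga ae by blast
qed

section \<open>From processes to operators\<close>

definition section_op :: "real \<Rightarrow> (real \<times> 'a \<Rightarrow> 'b::{banach, second_countable_topology}) \<Rightarrow> 'a \<Rightarrow> 'b op" where
  "section_op T k = (\<lambda>\<omega>. rep_op T (\<lambda>u. k (u, \<omega>)))"

definition finite_sections :: "'a measure \<Rightarrow> real \<Rightarrow> (real \<times> 'a \<Rightarrow> 'b::real_normed_vector) \<Rightarrow> bool" where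
  "finite_sections M T k \<longleftrightarrow> (\<forall>\<omega>\<in>space M. (\<integral>\<^sup>+u. nsq (k (u, \<omega>)) \<partial>time_measure T) < \<infinity>)"

lemma hilbert_section_op_norm:
  fixes k :: "real \<times> 'a \<Rightarrow> 'b::{banach, second_countable_topology}"
  assumes H: "hilbert_space TYPE('b)" and k: "k \<in> borel_measurable (time_prod T M)"
    and fin: "finite_sections M T k" and \<omega>: "\<omega> \<in> space M"
  shows "(gamma_norm T (section_op T k \<omega>))\<^sup>2 = enn2real (\<integral>\<^sup>+u. nsq (k (u, \<omega>)) \<partial>time_measure T)"
    "section_op T k \<omega> \<in> gamma_space T"
proof -
  have m: "(\<lambda>u. k (u, \<omega>)) \<in> borel_measurable (time_measure T)" by (rule section_measurable[OF k \<omega>])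
  have f: "(\<integral>\<^sup>+u. nsq (k (u, \<omega>)) \<partial>time_measure T) < \<infinity>" using fin \<omega> by (simp add: finite_sections_def)
  show "(gamma_norm T (section_op T k \<omega>))\<^sup>2 = enn2real (\<integral>\<^sup>+u. nsq (k (u, \<omega>)) \<partial>time_measure T)"
    unfolding gamma_norm_def section_op_def hilbert_gamma_norm_sq[OF H m f] by simp
  show "section_op T k \<omega> \<in> gamma_space T"
    unfolding section_op_def by (rule hilbert_rep_op_gamma_space[OF H m f])
qed

lemma process_norm_alt:
  fixes k :: "real \<times> 'a \<Rightarrow> 'b::{banach, second_countable_topology}"
  assumes k[measurable]: "k \<in> borel_measurable (time_prod T M)"
  shows "process_norm M T k = sqrt (enn2real (\<integral>\<^sup>+p. nsq (k p) \<partial>time_prod T M))"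
  unfolding process_norm_def by (subst integral_eq_nn_integral) auto

lemma section_integral_finite_AE:
  fixes k :: "real \<times> 'a \<Rightarrow> 'b::{banach, second_countable_topology}"
  assumes P: "prob_space M" and k[measurable]: "k \<in> borel_measurable (time_prod T M)"
    and fin: "(\<integral>\<^sup>+p. nsq (k p) \<partial>time_prod T M) < \<infinity>"
  shows "AE \<omega> in M. (\<integral>\<^sup>+u. nsq (k (u, \<omega>)) \<partial>time_measure T) \<noteq> \<infinity>"
proof (rule nn_integral_PInf_AE[OF section_integral_measurable[OF k]])
  have "(\<integral>\<^sup>+\<omega>. \<integral>\<^sup>+u. nsq (k (u, \<omega>)) \<partial>time_measure T \<partial>M) = (\<integral>\<^sup>+p. nsq (k p) \<partial>time_prod T M)"
    by (rule nn_integral_time_sections[OF P, where f = "\<lambda>p. nsq (k p)"]) measurable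
  then show "(\<integral>\<^sup>+\<omega>. \<integral>\<^sup>+u. nsq (k (u, \<omega>)) \<partial>time_measure T \<partial>M) \<noteq> \<infinity>" using fin by simp
qed

lemma section_integral_enn2real:
  fixes k :: "real \<times> 'a \<Rightarrow> 'b::{banach, second_countable_topology}"
  assumes P: "prob_space M" and k[measurable]: "k \<in> borel_measurable (time_prod T M)"
    and fin: "(\<integral>\<^sup>+p. nsq (k p) \<partial>time_prod T M) < \<infinity>"
  shows "integrable M (\<lambda>\<omega>. enn2real (\<integral>\<^sup>+u. nsq (k (u, \<omega>)) \<partial>time_measure T))"
    "(\<integral>\<omega>. enn2real (\<integral>\<^sup>+u. nsq (k (u, \<omega>)) \<partial>time_measure T) \<partial>M) =
      enn2real (\<integral>\<^sup>+p. nsq (k p) \<partial>time_prod T M)"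
proof -
  define q where "q = (\<lambda>\<omega>. \<integral>\<^sup>+u. nsq (k (u, \<omega>)) \<partial>time_measure T)"
  have q[measurable]: "q \<in> borel_measurable M" unfolding q_def by (rule section_integral_measurable[OF k])
  have "AE \<omega> in M. q \<omega> \<noteq> \<infinity>" unfolding q_def by (rule section_integral_finite_AE[OF P k fin])
  then have "(\<integral>\<^sup>+\<omega>. ennreal (enn2real (q \<omega>)) \<partial>M) = (\<integral>\<^sup>+\<omega>. q \<omega> \<partial>M)"
    by (intro nn_integral_cong_AE) (auto elim!: eventually_mono simp: less_top)
  also have "\<dots> = (\<integral>\<^sup>+p. nsq (k p) \<partial>time_prod T M)"
    unfolding q_def by (rule nn_integral_time_sections[OF P, where f = "\<lambda>p. nsq (k p)"]) measurable
  finally have eq: "(\<integral>\<^sup>+\<omega>. ennreal (enn2real (q \<omega>)) \<partial>M) = (\<integral>\<^sup>+p. nsq (k p) \<partial>time_prod T M)" .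
  have "integrable M (\<lambda>\<omega>. enn2real (q \<omega>))" unfolding integrable_iff_bounded using eq fin by simp
  then show "integrable M (\<lambda>\<omega>. enn2real (\<integral>\<^sup>+u. nsq (k (u, \<omega>)) \<partial>time_measure T))"
    by (simp only: q_def)
  show "(\<integral>\<omega>. enn2real (\<integral>\<^sup>+u. nsq (k (u, \<omega>)) \<partial>time_measure T) \<partial>M) =
      enn2real (\<integral>\<^sup>+p. nsq (k p) \<partial>time_prod T M)"
  proof -
    have "(\<integral>\<omega>. enn2real (q \<omega>) \<partial>M) = enn2real (\<integral>\<^sup>+\<omega>. ennreal (enn2real (q \<omega>)) \<partial>M)"
      by (rule integral_eq_nn_integral) auto
    then show ?thesis unfolding eq by (simp only: q_def)
  qed
qed

lemma hilbert_L2_gamma_norm: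
  fixes k :: "real \<times> 'a \<Rightarrow> 'b::{banach, second_countable_topology}"
  assumes H: "hilbert_space TYPE('b)" and P: "prob_space M"
    and k: "k \<in> borel_measurable (time_prod T M)" and fs: "finite_sections M T k"
    and fin: "(\<integral>\<^sup>+p. nsq (k p) \<partial>time_prod T M) < \<infinity>"
  shows "integrable M (\<lambda>\<omega>. (gamma_norm T (section_op T k \<omega>))\<^sup>2)"
    "L2_gamma_norm M T (section_op T k) = process_norm M T k"
proof -
  have eq: "(gamma_norm T (section_op T k \<omega>))\<^sup>2 = enn2real (\<integral>\<^sup>+u. nsq (k (u, \<omega>)) \<partial>time_measure T)"
    if "\<omega> \<in> space M" for \<omega> by (rule hilbert_section_op_norm(1)[OF H k fs that])
  show "integrable M (\<lambda>\<omega>. (gamma_norm T (section_op T k \<omega>))\<^sup>2)"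
    using section_integral_enn2real(1)[OF P k fin]
    by (rule Bochner_Integration.integrable_cong[OF refl, THEN iffD2, rotated]) (rule eq)
  have "(\<integral>\<omega>. (gamma_norm T (section_op T k \<omega>))\<^sup>2 \<partial>M) = (\<integral>\<omega>. enn2real (\<integral>\<^sup>+u. nsq (k (u, \<omega>)) \<partial>time_measure T) \<partial>M)"
    by (rule Bochner_Integration.integral_cong[OF refl]) (rule eq)
  then show "L2_gamma_norm M T (section_op T k) = process_norm M T k"
    unfolding L2_gamma_norm_def process_norm_alt[OF k] section_integral_enn2real(2)[OF P k fin] by simp
qed

lemma section_op_diff:
  fixes k l :: "real \<times> 'a \<Rightarrow> 'b::{banach, second_countable_topology}"
  assumes k: "k \<in> borel_measurable (time_prod T M)" "finite_sections M T k"
    and l: "l \<in> borel_measurable (time_prod T M)" "finite_sections M T l"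
    and \<omega>: "\<omega> \<in> space M"
  shows "op_diff (section_op T k \<omega>) (section_op T l \<omega>) = section_op T (\<lambda>p. k p - l p) \<omega>"
  unfolding section_op_def
  by (rule rep_op_diff) (use k l \<omega> section_measurable in \<open>auto simp: finite_sections_def\<close>)

lemma finite_sections_diff:
  fixes k l :: "real \<times> 'a \<Rightarrow> 'b::{banach, second_countable_topology}"
  assumes k: "k \<in> borel_measurable (time_prod T M)" "finite_sections M T k"
    and l: "l \<in> borel_measurable (time_prod T M)" "finite_sections M T l"
  shows "finite_sections M T (\<lambda>p. k p - l p)"
  unfolding finite_sections_def
proof
  fix \<omega> assume \<omega>: "\<omega> \<in> space M"
  show "(\<integral>\<^sup>+u. nsq (k (u, \<omega>) - l (u, \<omega>)) \<partial>time_measure T) < \<infinity>"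
    by (rule nn_integral_nsq_finite[OF section_measurable[OF k(1) \<omega>] section_measurable[OF l(1) \<omega>]])
      (use k(2) l(2) \<omega> in \<open>auto simp: finite_sections_def\<close>)
qed

lemma section_op_defines_rv:
  fixes k :: "real \<times> 'a \<Rightarrow> 'b::{banach, second_countable_topology}"
  assumes k: "k \<in> borel_measurable (time_prod T M)" and fs: "finite_sections M T k"
  shows "defines_rv M T k (section_op T k)"
  unfolding defines_rv_def
proof (intro conjI k allI ballI)
  fix f :: "'b \<Rightarrow>\<^sub>L real"
  have m: "(\<lambda>u. k (u, \<omega>)) \<in> borel_measurable (time_measure T)" and fin: "(\<integral>\<^sup>+u. nsq (k (u, \<omega>)) \<partial>time_measure T) < \<infinity>"
    if "\<omega> \<in> space M" for \<omega>
    using section_measurable[OF k that] fs that by (auto simp: finite_sections_def)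
  show "AE \<omega> in M. (\<lambda>u. blinfun_apply f (k (u, \<omega>))) \<in> L2 T"
  proof (rule AE_I2)
    fix \<omega> assume \<omega>: "\<omega> \<in> space M"
    have bm: "(\<lambda>u. blinfun_apply f (k (u, \<omega>))) \<in> borel_measurable (time_measure T)"
      by (intro borel_measurable_continuous_on[OF _ m[OF \<omega>]] continuous_intros
        linear_continuous_on blinfun.bounded_linear_right)
    have "(\<integral>\<^sup>+u. nsq (blinfun_apply f (k (u, \<omega>))) \<partial>time_measure T) \<le>
        (\<integral>\<^sup>+u. ennreal ((norm f)\<^sup>2) * nsq (k (u, \<omega>)) \<partial>time_measure T)"
    proof (rule nn_integral_mono)
      fix u
      have "(norm (blinfun_apply f (k (u, \<omega>))))\<^sup>2 \<le> (norm f * norm (k (u, \<omega>)))\<^sup>2"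
        by (intro power_mono norm_blinfun) simp
      then show "nsq (blinfun_apply f (k (u, \<omega>))) \<le> ennreal ((norm f)\<^sup>2) * nsq (k (u, \<omega>))"
        by (simp add: ennreal_mult[symmetric] power_mult_distrib ennreal_leI)
    qed
    also have "\<dots> = ennreal ((norm f)\<^sup>2) * (\<integral>\<^sup>+u. nsq (k (u, \<omega>)) \<partial>time_measure T)"
      using m[OF \<omega>] by (intro nn_integral_cmult) simp
    also have "\<dots> < \<infinity>" using fin[OF \<omega>] by (simp add: ennreal_mult_less_top)
    finally show "(\<lambda>u. blinfun_apply f (k (u, \<omega>))) \<in> L2 T" using bm by (simp only: L2_iff)
  qed
  fix h assume h: "h \<in> L2 T"
  show "AE \<omega> in M. blinfun_apply f (section_op T k \<omega> h) = (\<integral>u. h u * blinfun_apply f (k (u, \<omega>)) \<partial>time_measure T)"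
  proof (rule AE_I2)
    fix \<omega> assume \<omega>: "\<omega> \<in> space M"
    show "blinfun_apply f (section_op T k \<omega> h) = (\<integral>u. h u * blinfun_apply f (k (u, \<omega>)) \<partial>time_measure T)"
      using h integral_bounded_linear[OF blinfun.bounded_linear_right integrable_scaleR_L2[OF h m[OF \<omega>] fin[OF \<omega>]], of f]
      by (simp add: section_op_def rep_op_def blinfun.scaleR_right)
  qed
qed

text \<open>The operators of the step processes are simple functions of the sample point. They
  approximate in the pathwise \<open>L\<^sup>2\<close>-norm, hence in the norm of operators, and the geometric rate
  gives almost sure convergence.\<close>

lemma hilbert_section_op_L2_gamma:
  fixes k :: "real \<times> 'a \<Rightarrow> 'b::{banach, second_countable_topology}"
  assumes H: "hilbert_space TYPE('b)" and P: "prob_space M" and T: "T > 0"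
    and Fil: "\<And>u. u \<in> {0..T} \<Longrightarrow> sets (Fil u) \<subseteq> sets M"
    and k: "k \<in> borel_measurable (time_prod T M)" and fs: "finite_sections M T k"
    and fin: "(\<integral>\<^sup>+p. nsq (k p) \<partial>time_prod T M) < \<infinity>"
    and \<phi>: "\<And>n. \<phi> n \<in> adapted_step T Fil"
      "\<And>n. (\<integral>\<^sup>+p. nsq (k p - \<phi> n p) \<partial>time_prod T M) \<le> ennreal ((1 / 2) ^ n)"
  shows "section_op T k \<in> L2_gamma M T"
proof -
  have \<phi>m: "\<phi> n \<in> borel_measurable (time_prod T M)" for n
    by (rule adapted_step_product_measurable[OF \<phi>(1) T Fil])
  have \<phi>fs: "finite_sections M T (\<phi> n)" for n
    using adapted_step_nsq_finite(1)[OF P \<phi>(1)] by (simp add: finite_sections_def)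
  have diffm: "(\<lambda>p. k p - \<phi> n p) \<in> borel_measurable (time_prod T M)" for n
    using k \<phi>m[of n] by simp
  have "AE \<omega> in M. (\<lambda>n. \<integral>\<^sup>+u. nsq (k (u, \<omega>) - \<phi> n (u, \<omega>)) \<partial>time_measure T) \<longlonglongrightarrow> 0"
  proof (rule AE_tendsto_zero_of_summable)
    fix n
    show "(\<lambda>\<omega>. \<integral>\<^sup>+u. nsq (k (u, \<omega>) - \<phi> n (u, \<omega>)) \<partial>time_measure T) \<in> borel_measurable M"
      by (rule section_integral_measurable[OF diffm])
    have "(\<integral>\<^sup>+\<omega>. \<integral>\<^sup>+u. nsq (k (u, \<omega>) - \<phi> n (u, \<omega>)) \<partial>time_measure T \<partial>M) =
        (\<integral>\<^sup>+p. nsq (k p - \<phi> n p) \<partial>time_prod T M)"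
      by (rule nn_integral_time_sections[OF P, where f = "\<lambda>p. nsq (k p - \<phi> n p)"]) (use diffm[of n] in simp)
    then show "(\<integral>\<^sup>+\<omega>. \<integral>\<^sup>+u. nsq (k (u, \<omega>) - \<phi> n (u, \<omega>)) \<partial>time_measure T \<partial>M) \<le> ennreal ((1 / 2) ^ n)"
      using \<phi>(2)[of n] by simp
  qed
  then have lim: "AE \<omega> in M. (\<lambda>n. gamma_norm T (op_diff (section_op T (\<phi> n) \<omega>) (section_op T k \<omega>))) \<longlonglongrightarrow> 0"
    using AE_space
  proof eventually_elim
    case (elim \<omega>)
    have "gamma_norm T (op_diff (section_op T (\<phi> n) \<omega>) (section_op T k \<omega>)) =
        sqrt (enn2real (\<integral>\<^sup>+u. nsq (k (u, \<omega>) - \<phi> n (u, \<omega>)) \<partial>time_measure T))" for n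
      unfolding gamma_norm_op_diff_commute[of T "section_op T (\<phi> n) \<omega>"] section_op_diff[OF k fs \<phi>m \<phi>fs elim(2)]
      using hilbert_section_op_norm(1)[OF H diffm finite_sections_diff[OF k fs \<phi>m \<phi>fs] elim(2)]
      by (metis gamma_norm_nonneg real_sqrt_unique)
    moreover have "(\<lambda>n. sqrt (enn2real (\<integral>\<^sup>+u. nsq (k (u, \<omega>) - \<phi> n (u, \<omega>)) \<partial>time_measure T))) \<longlonglongrightarrow> sqrt 0"
      using elim(1) tendsto_enn2real[of "\<lambda>n. \<integral>\<^sup>+u. nsq (k (u, \<omega>) - \<phi> n (u, \<omega>)) \<partial>time_measure T" 0]
      by (intro tendsto_real_sqrt) simp
    ultimately show ?case by simp
  qed
  have simple: "simple_function M (section_op T (\<phi> n))" for n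
    using simple_function_compose[OF adapted_step_finitely_many_sections[OF \<phi>(1) T Fil], of "rep_op T" n]
    by (simp add: section_op_def o_def)
  have "gamma_strongly_measurable M T (section_op T k)"
    unfolding gamma_strongly_measurable_def
  proof (intro conjI ballI exI[of _ "\<lambda>n. section_op T (\<phi> n)"] allI simple lim)
    show "section_op T k \<omega> \<in> gamma_space T" if "\<omega> \<in> space M" for \<omega>
      by (rule hilbert_section_op_norm(2)[OF H k fs that])
    show "section_op T (\<phi> n) ` space M \<subseteq> gamma_space T" for n
      using hilbert_section_op_norm(2)[OF H \<phi>m \<phi>fs] by blast
  qed
  then show ?thesis using hilbert_L2_gamma_norm(1)[OF H P k fs fin] by (simp add: L2_gamma_def)
qed

text \<open>The sections of a square integrable process are square integrable only almost surely. Replacing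
  the exceptional sections by \<open>0\<close> gives an operator for every sample point.\<close>

theorem hilbert_process_defines_adapted:
  fixes g :: "real \<times> 'a \<Rightarrow> 'b::{banach, second_countable_topology}"
  assumes H: "hilbert_space TYPE('b)" and P: "prob_space M" and T: "T > 0"
    and Fil: "\<And>u. u \<in> {0..T} \<Longrightarrow> space (Fil u) = space M \<and> sets (Fil u) \<subseteq> sets M"
    and g: "g \<in> borel_measurable (adapted_algebra M T Fil)"
    and fin: "(\<integral>\<^sup>+p. nsq (g p) \<partial>time_prod T M) < \<infinity>"
  shows "\<exists>U\<in>L2_gamma_adapted M T Fil. defines_rv M T g U"
proof -
  interpret M: prob_space M by (rule P)
  have Fil': "sets (Fil u) \<subseteq> sets M" if "u \<in> {0..T}" for u using Fil[OF that] by blast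
  have gm[measurable]: "g \<in> borel_measurable (time_prod T M)" by (rule adapted_product_measurable[OF g])
  define q where "q = (\<lambda>\<omega>. \<integral>\<^sup>+u. nsq (g (u, \<omega>)) \<partial>time_measure T)"
  have qm[measurable]: "q \<in> borel_measurable M" unfolding q_def by (rule section_integral_measurable[OF gm])
  define k where "k = (\<lambda>p. if q (snd p) < \<infinity> then g p else 0)"
  have km[measurable]: "k \<in> borel_measurable (time_prod T M)" unfolding k_def by measurable
  have kfs: "finite_sections M T k" unfolding finite_sections_def
  proof
    fix \<omega> show "(\<integral>\<^sup>+u. nsq (k (u, \<omega>)) \<partial>time_measure T) < \<infinity>"
      by (cases "q \<omega> < \<infinity>") (simp_all add: k_def q_def)
  qed
  interpret pair_sigma_finite "time_measure T" M by (rule pair_sigma_finite_time[OF P])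
  have ae: "AE p in time_prod T M. g p = k p"
  proof (rule AE_pair_measure)
    have "AE \<omega> in M. q \<omega> \<noteq> \<infinity>" unfolding q_def by (rule section_integral_finite_AE[OF P gm fin])
    then have "AE \<omega> in M. g (u, \<omega>) = k (u, \<omega>)" for u
      by eventually_elim (simp add: k_def less_top)
    then show "AE u in time_measure T. AE \<omega> in M. g (u, \<omega>) = k (u, \<omega>)" by simp
    show "{p \<in> space (time_prod T M). g p = k p} \<in> sets (time_prod T M)"
      by measurable
  qed
  have kfin: "(\<integral>\<^sup>+p. nsq (k p) \<partial>time_prod T M) < \<infinity>"
  proof -
    have "(\<integral>\<^sup>+p. nsq (k p) \<partial>time_prod T M) = (\<integral>\<^sup>+p. nsq (g p) \<partial>time_prod T M)"
      by (rule nn_integral_cong_AE) (use ae in \<open>eventually_elim, simp\<close>)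
    then show ?thesis using fin by simp
  qed
  have approx: "\<exists>\<phi>\<in>adapted_step T Fil. (\<integral>\<^sup>+p. nsq (k p - \<phi> p) \<partial>time_prod T M) < ennreal e"
    if e: "e > 0" for e
  proof -
    obtain \<phi> where \<phi>: "\<phi> \<in> adapted_step T Fil" "(\<integral>\<^sup>+p. nsq (g p - \<phi> p) \<partial>time_prod T M) < ennreal e"
      using adapted_step_dense[OF T M.sigma_finite_measure_axioms Fil g fin e] by blast
    have "(\<integral>\<^sup>+p. nsq (k p - \<phi> p) \<partial>time_prod T M) = (\<integral>\<^sup>+p. nsq (g p - \<phi> p) \<partial>time_prod T M)"
      by (rule nn_integral_cong_AE) (use ae in \<open>eventually_elim, simp\<close>)
    then show ?thesis using \<phi> by (intro bexI[of _ \<phi>]) simp_all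
  qed
  have "\<forall>n. \<exists>\<phi>. \<phi> \<in> adapted_step T Fil \<and>
      (\<integral>\<^sup>+p. nsq (k p - \<phi> p) \<partial>time_prod T M) < ennreal ((1 / 2) ^ n)"
  proof
    fix n show "\<exists>\<phi>. \<phi> \<in> adapted_step T Fil \<and>
      (\<integral>\<^sup>+p. nsq (k p - \<phi> p) \<partial>time_prod T M) < ennreal ((1 / 2) ^ n)"
      using approx[of "(1 / 2) ^ n"] by (simp add: Bex_def)
  qed
  from choice[OF this] obtain \<psi> where \<psi>: "\<forall>n. \<psi> n \<in> adapted_step T Fil \<and>
      (\<integral>\<^sup>+p. nsq (k p - \<psi> n p) \<partial>time_prod T M) < ennreal ((1 / 2) ^ n)" ..
  have U: "section_op T k \<in> L2_gamma M T"
    by (rule hilbert_section_op_L2_gamma[OF H P T Fil' km kfs kfin, where \<phi> = \<psi>]) (use \<psi> in \<open>auto intro: less_imp_le\<close>)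
  have "\<exists>\<phi>\<in>adapted_step T Fil. \<exists>Y\<in>L2_gamma M T. defines_rv M T \<phi> Y \<and>
      L2_gamma_norm M T (\<lambda>\<omega>. op_diff (section_op T k \<omega>) (Y \<omega>)) < e" if e: "e > 0" for e
  proof -
    have "e\<^sup>2 > 0" using e by simp
    from approx[OF this] obtain \<phi> where \<phi>: "\<phi> \<in> adapted_step T Fil"
      "(\<integral>\<^sup>+p. nsq (k p - \<phi> p) \<partial>time_prod T M) < ennreal (e\<^sup>2)" by blast
    have \<phi>m: "\<phi> \<in> borel_measurable (time_prod T M)"
      by (rule adapted_step_product_measurable[OF \<phi>(1) T Fil'])
    have \<phi>fs: "finite_sections M T \<phi>"
      using adapted_step_nsq_finite(1)[OF P \<phi>(1)] by (simp add: finite_sections_def)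
    have Y: "section_op T \<phi> \<in> L2_gamma M T"
      by (rule hilbert_section_op_L2_gamma[OF H P T Fil' \<phi>m \<phi>fs adapted_step_nsq_finite(2)[OF P \<phi>(1)], where \<phi> = "\<lambda>_. \<phi>"])
        (use \<phi>(1) in simp_all)
    define d where "d = (\<lambda>p. k p - \<phi> p)"
    have dm: "d \<in> borel_measurable (time_prod T M)" unfolding d_def using km \<phi>m by simp
    have dfs: "finite_sections M T d" unfolding d_def by (rule finite_sections_diff[OF km kfs \<phi>m \<phi>fs])
    have dlt: "(\<integral>\<^sup>+p. nsq (d p) \<partial>time_prod T M) < ennreal (e\<^sup>2)" using \<phi>(2) by (simp add: d_def)
    have dfin: "(\<integral>\<^sup>+p. nsq (d p) \<partial>time_prod T M) < \<infinity>"
      using dlt by (rule order_less_trans) simp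
    have "L2_gamma_norm M T (\<lambda>\<omega>. op_diff (section_op T k \<omega>) (section_op T \<phi> \<omega>)) = L2_gamma_norm M T (section_op T d)"
      unfolding L2_gamma_norm_def d_def
      by (intro arg_cong[where f = sqrt] Bochner_Integration.integral_cong refl)
        (simp add: section_op_diff[OF km kfs \<phi>m \<phi>fs])
    also have "\<dots> = process_norm M T d" by (rule hilbert_L2_gamma_norm(2)[OF H P dm dfs dfin])
    also have "\<dots> < e"
    proof -
      have "enn2real (\<integral>\<^sup>+p. nsq (d p) \<partial>time_prod T M) < e\<^sup>2"
        using dlt by (cases "\<integral>\<^sup>+p. nsq (d p) \<partial>time_prod T M") (simp_all add: ennreal_less_iff)
      then show ?thesis unfolding process_norm_alt[OF dm] using e by (intro real_less_lsqrt) auto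
    qed
    finally show ?thesis using \<phi>(1) Y section_op_defines_rv[OF \<phi>m \<phi>fs] by blast
  qed
  then have "section_op T k \<in> L2_gamma_adapted M T Fil" using U by (simp add: L2_gamma_adapted_def)
  moreover have "defines_rv M T g (section_op T k)"
    by (rule defines_rv_cong_AE[OF P section_op_defines_rv[OF km kfs] gm ae])
  ultimately show ?thesis by blast
qed

text \<open>Almost surely \<open>U \<omega>\<close> is the operator represented by the section of \<open>g\<close>, so the
  isometry for operators can be integrated over the sample points.\<close>

theorem hilbert_isometry:
  fixes g :: "real \<times> 'a \<Rightarrow> 'b::{banach, second_countable_topology}"
  assumes H: "hilbert_space TYPE('b)" and P: "prob_space M"
    and g: "g \<in> borel_measurable (time_prod T M)"
    and fin: "(\<integral>\<^sup>+p. nsq (g p) \<partial>time_prod T M) < \<infinity>"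
    and U: "U \<in> L2_gamma M T" and def: "defines_rv M T g U"
  shows "process_norm M T g = L2_gamma_norm M T U"
proof -
  obtain D :: "('b \<Rightarrow>\<^sub>L real) set" where D: "countable D" "separating D" using countable_separating_set by blast
  have w: "AE \<omega> in M. weakly_represents T D (\<lambda>u. g (u, \<omega>)) (U \<omega>)"
    by (rule defines_rv_weakly_represents[OF def _ D(1)]) (rule L2_gammaD(3)[OF U])
  have "AE \<omega> in M. (gamma_norm T (U \<omega>))\<^sup>2 = enn2real (\<integral>\<^sup>+u. nsq (g (u, \<omega>)) \<partial>time_measure T)"
    using w section_integral_finite_AE[OF P g fin] AE_space
  proof eventually_elim
    case (elim \<omega>)
    have m: "(\<lambda>u. g (u, \<omega>)) \<in> borel_measurable (time_measure T)" by (rule section_measurable[OF g elim(3)])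
    have f: "(\<integral>\<^sup>+u. nsq (g (u, \<omega>)) \<partial>time_measure T) < \<infinity>" using elim(2) by (simp add: less_top)
    have "U \<omega> = rep_op T (\<lambda>u. g (u, \<omega>))"
      by (rule weakly_represents_rep_op[OF D(2) elim(1) L2_gammaD(3)[OF U elim(3)] m f])
    then show ?case using hilbert_gamma_norm_sq[OF H m f] by (simp add: gamma_norm_def)
  qed
  then have "(\<integral>\<omega>. (gamma_norm T (U \<omega>))\<^sup>2 \<partial>M) = (\<integral>\<omega>. enn2real (\<integral>\<^sup>+u. nsq (g (u, \<omega>)) \<partial>time_measure T) \<partial>M)"
    using L2_gammaD(2)[OF U] section_integral_enn2real(1)[OF P g fin]
    by (intro integral_cong_AE) (auto simp only: borel_measurable_integrable)
  then show ?thesis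
    unfolding L2_gamma_norm_def process_norm_alt[OF g] section_integral_enn2real(2)[OF P g fin] by simp
qed

section \<open>Subtrajectory integrals\<close>

theorem lemma3p11:
  fixes M :: "'a measure" and W :: "real \<Rightarrow> 'a \<Rightarrow> real" and T :: real
    and Fil :: "real \<Rightarrow> 'a measure"
    and H :: "real \<times> 'a \<Rightarrow> 'b::{banach, second_countable_topology} set"
  assumes "T > 0"
    and "prob_space M"
    and "brownian_motion M T W"
    and "Fil = aug_filtration M W"
    and "sets M = sets (Fil T)"
    and "reflexive_space TYPE('b)"
    and "\<And>t \<omega>. t \<in> {0..T} \<Longrightarrow> \<omega> \<in> space M \<Longrightarrow> compact (H (t, \<omega>)) \<and> H (t, \<omega>) \<noteq> {}"
    and "Delta M T Fil H \<noteq> {}"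
  shows "(cotype_2 TYPE('b) \<longrightarrow>
           (\<forall>X\<in>Delta M T Fil H. \<exists>g\<in>subtraj_integrals M T Fil H. defines_rv M T g X)) \<and>
         (hilbert_space TYPE('b) \<longrightarrow>
           (\<forall>g\<in>subtraj_integrals M T Fil H.
              (\<exists>U\<in>Delta M T Fil H. defines_rv M T g U) \<and>
              (\<forall>U\<in>Delta M T Fil H. defines_rv M T g U \<longrightarrow>
                 process_norm M T g = L2_gamma_norm M T U)))"
proof (intro conjI impI ballI)
  note T = assms(1) and P = assms(2)
  have complete: "complete_measure M" using aug_filtration_complete[of M W T] assms(4,5) by simp
  have Fil_mono: "sets (Fil u) \<subseteq> sets (Fil v)" if "u \<le> v" for u v
    unfolding assms(4) by (rule aug_filtration_mono[OF that])
  have Fil_sub: "sets (Fil u) \<subseteq> sets M" if "u \<in> {0..T}" for u using Fil_mono[of u T] that assms(5) by simp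
  have Fil: "space (Fil u) = space M \<and> sets (Fil u) \<subseteq> sets M" if "u \<in> {0..T}" for u
    using Fil_sub[OF that] by (simp add: assms(4))
  {
    fix X assume cot: "cotype_2 TYPE('b)" and "X \<in> Delta M T Fil H"
    then obtain h where X: "X \<in> L2_gamma_adapted M T Fil" and h: "defines_rv M T h X"
      and hH: "AE p in time_prod T M. h p \<in> H p" unfolding Delta_def by blast
    obtain g where g: "g \<in> borel_measurable (adapted_algebra M T Fil)"
      "AE p in time_prod T M. g p = h p" "(\<integral>\<^sup>+p. nsq (g p) \<partial>time_prod T M) < \<infinity>"
      using cotype_2_adapted_version[OF P complete T Fil_sub Fil_mono cot X h] by blast
    have gm: "g \<in> borel_measurable (time_prod T M)" by (rule adapted_product_measurable[OF g(1)])
    have "AE p in time_prod T M. g p \<in> H p" using g(2) hH by eventually_elim simp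
    then have "g \<in> subtraj_integrals M T Fil H"
      unfolding subtraj_integrals_def using g(1,3) integrable_nsq_iff[OF gm] by blast
    moreover have "defines_rv M T g X" by (rule defines_rv_cong_AE[OF P h gm g(2)])
    ultimately show "\<exists>g\<in>subtraj_integrals M T Fil H. defines_rv M T g X" by blast
  }
  fix g assume Hil: "hilbert_space TYPE('b)" and "g \<in> subtraj_integrals M T Fil H"
  then have g: "g \<in> borel_measurable (adapted_algebra M T Fil)"
    and int: "integrable (time_prod T M) (\<lambda>p. (norm (g p))\<^sup>2)"
    and gH: "AE p in time_prod T M. g p \<in> H p" unfolding subtraj_integrals_def by blast+
  have gm: "g \<in> borel_measurable (time_prod T M)" by (rule adapted_product_measurable[OF g])
  have fin: "(\<integral>\<^sup>+p. nsq (g p) \<partial>time_prod T M) < \<infinity>" using int integrable_nsq_iff[OF gm] by blast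
  obtain U where "U \<in> L2_gamma_adapted M T Fil" "defines_rv M T g U"
    using hilbert_process_defines_adapted[OF Hil P T Fil g fin] by blast
  then show "\<exists>U\<in>Delta M T Fil H. defines_rv M T g U" using gH unfolding Delta_def by blast
  fix U assume "U \<in> Delta M T Fil H" and def: "defines_rv M T g U"
  then have "U \<in> L2_gamma M T" unfolding Delta_def L2_gamma_adapted_def by blast
  then show "process_norm M T g = L2_gamma_norm M T U" by (rule hilbert_isometry[OF Hil P gm fin _ def])
qed

end
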